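(* Let $T$ be a tree and $k$ a positive integer. Then the rainbow Turán density $\pi_k^{\ast}(T)=\lim_{n\to\infty}\mathrm{ex}_k^{\ast}(n,T)/\binom{n}{2}$ can be computed by solving finitely many polynomial optimization problems. Moreover, $\pi_k^{\ast}(T)$ is an algebraic number.
   Context: A graph system of order $k$ on a vertex set $V$ is a tuple $\mathcal{G}=(G_1,\dots,G_k)$ of simple graphs on the common vertex set $V$. A graph $H$ with $V(H)\subseteq V$ is a rainbow subgraph of $\mathcal{G}$ if there is an injective map $\psi:E(H)\to[k]$ with $e\in E(G_{\psi(e)})$ for every $e\in E(H)$; $\mathcal{G}$ is rainbow $H$-free if it has no rainbow subgraph isomorphic to $H$. $\mathrm{ex}_k^{\ast}(n,H)$ is the maximum of $\min_{1\le i\le k}|E(G_i)|$ over all rainbow $H$-free graph systems $(G_1,\dots,G_k)$ on $[n]$. *)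

theory Defs
  imports Complex_Main "HOL-Computational_Algebra.Polynomial" "HOL-Library.Nat_Bijection"
begin

section \<open>Graphs and graph systems\<close>

type_synonym 'v graph = "'v set \<times> 'v set set"

abbreviation verts :: "'v graph \<Rightarrow> 'v set" where "verts \<equiv> fst"
abbreviation edges :: "'v graph \<Rightarrow> 'v set set" where "edges \<equiv> snd"

definition simple_graph :: "'v graph \<Rightarrow> bool" where
  "simple_graph G \<longleftrightarrow> finite (verts G) \<and> (\<forall>e\<in>edges G. e \<subseteq> verts G \<and> card e = 2)"

definition graph_iso :: "'v graph \<Rightarrow> 'w graph \<Rightarrow> bool" where
  "graph_iso G H \<longleftrightarrow>
     (\<exists>f. bij_betw f (verts G) (verts H) \<and> (\<lambda>e. f ` e) ` edges G = edges H)"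

definition connected_graph :: "'v graph \<Rightarrow> bool" where
  "connected_graph G \<longleftrightarrow> verts G \<noteq> {} \<and>
     (\<forall>u\<in>verts G. \<forall>v\<in>verts G. (u, v) \<in> {(x, y). {x, y} \<in> edges G}\<^sup>*)"

definition is_cycle :: "'v graph \<Rightarrow> 'v list \<Rightarrow> bool" where
  "is_cycle G vs \<longleftrightarrow> length vs \<ge> 3 \<and> distinct vs \<and>
     (\<forall>i<length vs. {vs ! i, vs ! (Suc i mod length vs)} \<in> edges G)"

definition is_tree :: "'v graph \<Rightarrow> bool" where
  "is_tree G \<longleftrightarrow> simple_graph G \<and> connected_graph G \<and> (\<nexists>vs. is_cycle G vs)"

text \<open>A graph system of order \<open>k\<close> on \<open>V\<close> is a family indexed by \<open>{1..k}\<close>; its values at other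
  indices are irrelevant.\<close>

definition graph_system :: "nat \<Rightarrow> 'v set \<Rightarrow> (nat \<Rightarrow> 'v graph) \<Rightarrow> bool" where
  "graph_system k V G \<longleftrightarrow> (\<forall>i\<in>{1..k}. simple_graph (G i) \<and> verts (G i) = V)"

definition rainbow_subgraph :: "nat \<Rightarrow> 'v set \<Rightarrow> (nat \<Rightarrow> 'v graph) \<Rightarrow> 'v graph \<Rightarrow> bool" where
  "rainbow_subgraph k V G H \<longleftrightarrow> simple_graph H \<and> verts H \<subseteq> V \<and>
     (\<exists>\<psi>. inj_on \<psi> (edges H) \<and> \<psi> ` edges H \<subseteq> {1..k} \<and> (\<forall>e\<in>edges H. e \<in> edges (G (\<psi> e))))"

definition rainbow_free :: "nat \<Rightarrow> 'v set \<Rightarrow> (nat \<Rightarrow> 'v graph) \<Rightarrow> 'w graph \<Rightarrow> bool" where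
  "rainbow_free k V G T \<longleftrightarrow> (\<nexists>H. rainbow_subgraph k V G H \<and> graph_iso H T)"

text \<open>The set below is finite, so its supremum in \<open>nat\<close> is its maximum whenever it is nonempty.
  It is empty only if \<open>T\<close> is edgeless and fits into \<open>{1..n}\<close>; the supremum is then \<open>0\<close>.\<close>

definition rainbow_ex :: "nat \<Rightarrow> nat \<Rightarrow> 'w graph \<Rightarrow> nat" where
  "rainbow_ex k n T =
     Sup {Min ((\<lambda>i. card (edges (G i))) ` {1..k}) | G :: nat \<Rightarrow> nat graph.
            graph_system k {1..n} G \<and> rainbow_free k {1..n} G T}"

definition rainbow_ratio :: "nat \<Rightarrow> 'w graph \<Rightarrow> nat \<Rightarrow> real" where
  "rainbow_ratio k T n = real (rainbow_ex k n T) / real (n choose 2)"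

definition rainbow_density :: "nat \<Rightarrow> 'w graph \<Rightarrow> real" where
  "rainbow_density k T = lim (rainbow_ratio k T)"


section \<open>Polynomial optimization problems\<close>

text \<open>A polynomial over the integers is a list of terms; the term \<open>(c, [e\<^sub>0, e\<^sub>1, \<dots>])\<close> stands for
  \<open>c * x\<^sub>0 ^ e\<^sub>0 * x\<^sub>1 ^ e\<^sub>1 * \<dots>\<close>. Missing exponents count as \<open>0\<close> and exponents of non-existing
  variables are ignored (both by truncation in \<open>map2\<close>). Integer coefficients make a
  problem a finite object; with arbitrary real ones, every real number would trivially be an
  optimal value.\<close>

type_synonym int_mpoly = "(int \<times> nat list) list"

definition mpoly_eval :: "int_mpoly \<Rightarrow> real list \<Rightarrow> real" where
  "mpoly_eval p xs = (\<Sum>(c, es)\<leftarrow>p. of_int c * prod_list (map2 (\<lambda>x e. x ^ e) xs es))"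

text \<open>The problem \<open>(m, f, gs)\<close> is to maximize \<open>f\<close> over all points of \<open>\<real>\<^sup>m\<close> at which every member
  of \<open>gs\<close> is nonnegative.\<close>

type_synonym poly_problem = "nat \<times> int_mpoly \<times> int_mpoly list"

fun feasible_set :: "poly_problem \<Rightarrow> real list set" where
  "feasible_set (m, f, gs) = {xs. length xs = m \<and> (\<forall>g\<in>set gs. mpoly_eval g xs \<ge> 0)}"

fun objective :: "poly_problem \<Rightarrow> real list \<Rightarrow> real" where
  "objective (m, f, gs) = mpoly_eval f"

definition optimal_value :: "poly_problem \<Rightarrow> real \<Rightarrow> bool" where
  "optimal_value P v \<longleftrightarrow>
     (\<exists>xs\<in>feasible_set P. objective P xs = v) \<and> (\<forall>ys\<in>feasible_set P. objective P ys \<le> v)"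

definition solved_by :: "real \<Rightarrow> poly_problem list \<Rightarrow> bool" where
  "solved_by r Ps \<longleftrightarrow> Ps \<noteq> [] \<and> (\<forall>P\<in>set Ps. \<exists>v. optimal_value P v) \<and>
     r = Max {v. \<exists>P\<in>set Ps. optimal_value P v}"


section \<open>Computability\<close>

text \<open>Kleene's partial recursive functions. \<open>rec_eval A xs y\<close> says that program \<open>A\<close> halts on
  input \<open>xs\<close> with output \<open>y\<close>.\<close>

datatype recf = RZero | RSucc | RProj nat | RComp recf "recf list" | RPrim recf recf | RMin recf

inductive rec_eval :: "recf \<Rightarrow> nat list \<Rightarrow> nat \<Rightarrow> bool" where
  zero: "rec_eval RZero xs 0"
| succ: "rec_eval RSucc [x] (Suc x)"
| proj: "i < length xs \<Longrightarrow> rec_eval (RProj i) xs (xs ! i)"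
| comp: "list_all2 (\<lambda>g y. rec_eval g xs y) gs ys \<Longrightarrow> rec_eval f ys z \<Longrightarrow>
           rec_eval (RComp f gs) xs z"
| prim_0: "rec_eval f xs z \<Longrightarrow> rec_eval (RPrim f g) (0 # xs) z"
| prim_Suc: "rec_eval (RPrim f g) (n # xs) y \<Longrightarrow> rec_eval g (n # y # xs) z \<Longrightarrow>
           rec_eval (RPrim f g) (Suc n # xs) z"
| minimize: "rec_eval f (n # xs) 0 \<Longrightarrow> (\<forall>m<n. \<exists>y>0. rec_eval f (m # xs) y) \<Longrightarrow>
           rec_eval (RMin f) xs n"

lemma rec_eval_deterministic: "rec_eval A xs y \<Longrightarrow> rec_eval A xs z \<Longrightarrow> y = z"
proof (induction A xs y arbitrary: z rule: rec_eval.induct)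
  case (zero xs)
  from zero.prems show ?case by cases simp
next
  case (succ x)
  from succ.prems show ?case by cases simp
next
  case (proj i xs)
  from proj.prems show ?case by cases simp
next
  case (comp xs gs ys f w)
  from comp.prems show ?case
  proof cases
    case c: (comp ys')
    have "ys = ys'"
      using comp.IH(1) c(1) by (auto simp: list_all2_conv_all_nth intro: nth_equalityI)
    then show ?thesis using comp.IH(2) c(2) by simp
  qed
next
  case (prim_0 f xs w g)
  from prim_0.prems show ?case by cases (simp_all add: prim_0.IH)
next
  case (prim_Suc f g n xs y w)
  from prim_Suc.prems show ?case
  proof cases
    case p: (prim_Suc y')
    then show ?thesis using prim_Suc.IH by blast
  qed
next
  case (minimize f n xs)
  from minimize.prems have z: "rec_eval f (z # xs) 0" "\<forall>m<z. \<exists>y>0. rec_eval f (m # xs) y"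
    by (cases, simp)+
  consider "n < z" | "z < n" | "n = z" by linarith
  then show ?case
  proof cases
    case 1
    then obtain y where "y > 0" "rec_eval f (n # xs) y" using z(2) by blast
    then show ?thesis using minimize.IH(1) by fastforce
  next
    case 2
    then obtain y where "y > 0" "\<forall>x. rec_eval f (z # xs) x \<longrightarrow> y = x"
      using minimize.IH(2) by blast
    then show ?thesis using z(1) by fastforce
  qed
qed

text \<open>\<open>encodes_graph c T\<close>: the number \<open>c\<close> codes a vertex count \<open>m\<close> together with a list of edges
  such that the resulting graph on \<open>{..<m}\<close> is isomorphic to \<open>T\<close>. A graph has many codes.\<close>

definition encodes_graph :: "nat \<Rightarrow> 'v graph \<Rightarrow> bool" where
  "encodes_graph c T \<longleftrightarrow>
     (\<exists>m es. c = prod_encode (m, list_encode (map prod_encode es)) \<and>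
             graph_iso T ({..<m}, (\<lambda>(u, v). {u, v}) ` set es))"

definition mpoly_encode :: "int_mpoly \<Rightarrow> nat" where
  "mpoly_encode p =
     list_encode (map (\<lambda>(c, es). prod_encode (int_encode c, list_encode es)) p)"

fun problem_encode :: "poly_problem \<Rightarrow> nat" where
  "problem_encode (m, f, gs) =
     prod_encode (m, prod_encode (mpoly_encode f, list_encode (map mpoly_encode gs)))"

definition problems_encode :: "poly_problem list \<Rightarrow> nat" where
  "problems_encode Ps = list_encode (map problem_encode Ps)"

end

theory Submission
  imports Defs "HOL-Analysis.Function_Topology"
begin

text \<open>
  Order the vertices of \<open>T\<close> so that every vertex but the first has a unique earlier neighbour, its
  parent. A pattern assigns to each colour a symmetric relation on \<open>M\<close> parts. If no rainbow copy of
  \<open>T\<close> maps homomorphically into the pattern, then its blow-ups are rainbow \<open>T\<close>-free; this gives the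
  lower bound \<open>max\<^sub>x min\<^sub>i x\<^sup>T P\<^sub>i x\<close> on the density, \<open>x\<close> ranging over the part sizes. Conversely,
  in a rainbow \<open>T\<close>-free system classify the vertices by iterated types: which colours lead to many
  neighbours of which type, to bounded depth. Deleting \<open>O(n)\<close> edges leaves only edges whose type is
  frequent at both ends, and the pattern of the remaining edges admits no rainbow homomorphism
  from \<open>T\<close>, since such a homomorphism could be turned greedily into a rainbow copy. The number of
  types is bounded by a tower in \<open>|T|\<close> and \<open>k\<close>, so the density is the maximum over finitely many
  patterns. The patterns are made variables of one polynomial problem: each potential rainbow
  homomorphism is excluded by a monomial constraint \<open>- t \<cdot> \<Prod>p \<ge> 0\<close>, where the factor \<open>t\<close> keeps the
  problem feasible (with optimum \<open>0\<close>) when \<open>T\<close> is a single vertex.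

  The optimum \<open>t\<close> is algebraic: otherwise some derivation \<open>D\<close> on a subring of \<open>\<real>\<close> has \<open>D t = 1\<close>, and
  moving the optimal \<open>x\<close> in the direction \<open>D x\<close> increases the objective.
\<close>

section \<open>Computable functions\<close>

text \<open>The lower and upper bounds differ by \<open>O(n)\<close> around the same maximum, so
  they also give existence of the limit. Every depth \<open>D\<close> at least \<open>m\<close> and
  every \<open>M\<close> at least \<open>type_bound k D\<close> yield this limit, hence the same
  maximum. The program exploits this freedom: it takes the code \<open>c\<close> itself as depth and
  \<open>M = k + type_bound k c\<close>, where the summand \<open>k\<close> lets colours serve as
  base \<open>M\<close> digits. The parent function occurs in proofs only; the problem sees the tree
  as an edge relation and ranges over all maps of its vertices and edges.

  Patterns may be relaxed to densities in \<open>[0, 1]\<close> because only the support matters: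
  raising the positive densities to 1 keeps the monomial constraints and lowers no weight.

  The obstacle in the upper bound is that what is frequent at depth \<open>d\<close> is decided by
  the type of depth \<open>d + 1\<close>. The embedding therefore spends one level of depth per tree
  vertex, and depth \<open>m\<close> is enough.

  Algebraicity needs no elimination theory: the derivation gives a first-order variation of the
  optimal weights, which themselves need not be algebraic.\<close>

definition computable :: "nat \<Rightarrow> (nat list \<Rightarrow> nat) \<Rightarrow> bool" where
  "computable n f \<longleftrightarrow> (\<exists>A. \<forall>xs. length xs = n \<longrightarrow> rec_eval A xs (f xs))"

lemma computable_cong:
  assumes "computable n g" and "\<And>xs. length xs = n \<Longrightarrow> f xs = g xs"
  shows "computable n f"
  using assms unfolding computable_def by auto

lemma computable_nth: "i < n \<Longrightarrow> computable n (\<lambda>xs. xs ! i)"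
  unfolding computable_def by (auto intro: rec_eval.proj)

lemma computable_nth_tl: "Suc i < n \<Longrightarrow> computable n (\<lambda>xs. tl xs ! i)"
  by (rule computable_cong[OF computable_nth[of "Suc i"]]) (auto simp: nth_tl)

lemma computable_compose:
  assumes "computable (length gs) f" and "\<And>g. g \<in> set gs \<Longrightarrow> computable n g"
  shows "computable n (\<lambda>xs. f (map (\<lambda>g. g xs) gs))"
proof -
  obtain A where A: "\<And>xs. length xs = length gs \<Longrightarrow> rec_eval A xs (f xs)"
    using assms(1) unfolding computable_def by blast
  obtain B where B: "\<And>g xs. g \<in> set gs \<Longrightarrow> length xs = n \<Longrightarrow> rec_eval (B g) xs (g xs)"
    using assms(2) unfolding computable_def by metis
  have "rec_eval (RComp A (map B gs)) xs (f (map (\<lambda>g. g xs) gs))" if "length xs = n" for xs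
    using A B that
    by (intro rec_eval.comp[where ys = "map (\<lambda>g. g xs) gs"])
      (auto simp: list_all2_conv_all_nth)
  then show ?thesis unfolding computable_def by blast
qed

lemma computable_Suc: "computable n f \<Longrightarrow> computable n (\<lambda>xs. Suc (f xs))"
proof -
  have "computable 1 (\<lambda>ys. Suc (ys ! 0))"
    unfolding computable_def
    by (intro exI[of _ RSucc]) (auto simp: length_Suc_conv intro: rec_eval.succ)
  then show "computable n f \<Longrightarrow> ?thesis"
    using computable_compose[of "[f]" "\<lambda>ys. Suc (ys ! 0)" n] by simp
qed

lemma computable_const: "computable n (\<lambda>xs. c)"
proof (induction c)
  case 0
  then show ?case unfolding computable_def using rec_eval.zero by blast
qed (rule computable_Suc)

lemma map_nth_upt_tl: "length xs = n \<Longrightarrow> map (\<lambda>i. xs ! i) [1..<n] = tl xs"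
  by (metis One_nat_def drop_0 drop_Suc list.sel(3) map_nth map_tl tl_drop tl_upt)

text \<open>Variables are de Bruijn indices: a bound variable is pushed in front of the argument
  list, so under a binder it is \<open>ys ! 0\<close> and the old arguments are
  \<open>tl ys\<close>. All binders below follow this convention.\<close>

lemma computable_let:
  assumes "computable (Suc n) (\<lambda>ys. F (ys ! 0) (tl ys))" and "computable n g"
  shows "computable n (\<lambda>xs. F (g xs) xs)"
proof -
  let ?gs = "g # map (\<lambda>i xs. xs ! i) [0..<n]"
  have "computable n (\<lambda>xs. (\<lambda>ys. F (ys ! 0) (tl ys)) (map (\<lambda>g. g xs) ?gs))"
    by (rule computable_compose) (use assms in \<open>auto intro: computable_nth\<close>)
  then show ?thesis
    by (rule computable_cong) (auto simp: comp_def map_nth)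
qed

lemma computable_tl:
  assumes "computable n f"
  shows "computable (Suc n) (\<lambda>ys. f (tl ys))"
proof -
  let ?gs = "map (\<lambda>i xs. xs ! i) [1..<Suc n]"
  have "computable (Suc n) (\<lambda>xs. f (map (\<lambda>g. g xs) ?gs))"
    by (rule computable_compose) (use assms in \<open>auto intro: computable_nth simp del: upt_Suc\<close>)
  then show ?thesis
    by (rule computable_cong) (simp add: comp_def map_nth_upt_tl del: upt_Suc One_nat_def)
qed

text \<open>The step of a recursion sees the counter and the accumulated value in front of the old
  arguments. This weakening serves summands that depend on the counter but not on the accumulated
  value.\<close>

lemma computable_tl_tl:
  assumes "computable (Suc n) (\<lambda>ys. F (ys ! 0) (tl ys))"
  shows "computable (Suc (Suc n)) (\<lambda>ys. F (ys ! 0) (tl (tl ys)))"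
proof -
  let ?gs = "(\<lambda>xs. xs ! 0) # map (\<lambda>i xs. xs ! i) [2..<Suc (Suc n)]"
  have "computable (Suc (Suc n)) (\<lambda>xs. (\<lambda>ys. F (ys ! 0) (tl ys)) (map (\<lambda>g. g xs) ?gs))"
    by (rule computable_compose) (use assms in \<open>auto intro: computable_nth simp del: upt_Suc\<close>)
  moreover have "map (\<lambda>i. xs ! i) [2..<Suc (Suc n)] = tl (tl xs)"
    if "length xs = Suc (Suc n)" for xs :: "nat list"
    using that by (intro nth_equalityI) (auto simp: nth_tl simp del: upt_Suc)
  ultimately show ?thesis
    by (elim computable_cong) (simp add: comp_def del: upt_Suc)
qed

text \<open>\<open>RPrim\<close> recurses on the head of its input, so the recursion is built with a
  fresh head variable, for which the bound \<open>t\<close> is then substituted.\<close>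

lemma computable_rec:
  assumes "computable n t" "computable n a"
    and "computable (Suc (Suc n)) (\<lambda>ys. b (ys ! 0) (ys ! 1) (tl (tl ys)))"
  shows "computable n (\<lambda>xs. rec_nat (a xs) (\<lambda>i y. b i y xs) (t xs))"
proof -
  obtain A where A: "\<And>xs. length xs = n \<Longrightarrow> rec_eval A xs (a xs)"
    using assms(2) unfolding computable_def by blast
  obtain B where B: "\<And>ys. length ys = Suc (Suc n) \<Longrightarrow> rec_eval B ys (b (ys ! 0) (ys ! 1) (tl (tl ys)))"
    using assms(3) unfolding computable_def by blast
  have "rec_eval (RPrim A B) (i # xs) (rec_nat (a xs) (\<lambda>i y. b i y xs) i)" if "length xs = n" for i xs
  proof (induction i)
    case 0
    show ?case by (auto intro: rec_eval.prim_0 A that)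
  next
    case (Suc i)
    show ?case
      using rec_eval.prim_Suc[OF Suc, OF B] that by simp
  qed
  then have "computable (Suc n) (\<lambda>ys. rec_nat (a (tl ys)) (\<lambda>i y. b i y (tl ys)) (ys ! 0))"
    unfolding computable_def
    by (intro exI[of _ "RPrim A B"]) (auto simp: length_Suc_conv)
  then show ?thesis
    by (rule computable_let[OF _ assms(1), of "\<lambda>i xs. rec_nat (a xs) (\<lambda>i y. b i y xs) i"])
qed

section \<open>Arithmetic, bounded quantifiers and pairing\<close>

lemma computable_add:
  assumes "computable n f" "computable n g"
  shows "computable n (\<lambda>xs. f xs + g xs)"
proof -
  have "computable n (\<lambda>xs. rec_nat (f xs) (\<lambda>i y. Suc y) (g xs))"
    by (intro computable_rec assms computable_Suc computable_nth) auto
  moreover have "rec_nat a (\<lambda>i y. Suc y) b = a + b" for a b :: nat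
    by (induction b) auto
  ultimately show ?thesis by simp
qed

lemma computable_sum:
  assumes "computable n b" "computable (Suc n) (\<lambda>ys. f (ys ! 0) (tl ys))"
  shows "computable n (\<lambda>xs. \<Sum>i<b xs. f i xs)"
proof -
  have "computable n (\<lambda>xs. rec_nat 0 (\<lambda>i y. y + f i xs) (b xs))"
    by (intro computable_rec assms computable_add computable_const computable_nth
        computable_tl_tl) auto
  moreover have "rec_nat 0 (\<lambda>i y. y + f i xs) k = (\<Sum>i<k. f i xs)" for k xs
    by (induction k) auto
  ultimately show ?thesis by simp
qed

lemma computable_mult:
  assumes "computable n f" "computable n g"
  shows "computable n (\<lambda>xs. f xs * g xs)"
proof -
  have "computable n (\<lambda>xs. \<Sum>i<f xs. g xs)"
    by (intro computable_sum assms computable_tl)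
  then show ?thesis by simp
qed

lemma computable_power:
  assumes "computable n f" "computable n g"
  shows "computable n (\<lambda>xs. f xs ^ g xs)"
proof -
  have "computable n (\<lambda>xs. rec_nat 1 (\<lambda>i y. y * f xs) (g xs))"
    by (intro computable_rec assms computable_mult computable_const computable_nth
        computable_tl[of _ "\<lambda>ys. f (tl ys)"] computable_tl) auto
  moreover have "rec_nat 1 (\<lambda>i y. y * a) b = a ^ b" for a b :: nat
    by (induction b) auto
  ultimately show ?thesis by simp
qed

lemma computable_diff:
  assumes "computable n f" "computable n g"
  shows "computable n (\<lambda>xs. f xs - g xs)"
proof -
  have pred: "computable n (\<lambda>xs. h xs - 1)" if "computable n h" for n h
  proof -
    have "computable n (\<lambda>xs. rec_nat 0 (\<lambda>i y. i) (h xs))"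
      by (intro computable_rec that computable_const computable_nth) auto
    moreover have "rec_nat 0 (\<lambda>i y. i) m = m - 1" for m :: nat
      by (cases m) auto
    ultimately show ?thesis by simp
  qed
  have "computable n (\<lambda>xs. rec_nat (f xs) (\<lambda>i y. y - 1) (g xs))"
    by (intro computable_rec assms pred computable_nth) auto
  moreover have "rec_nat a (\<lambda>i y. y - 1) b = a - b" for a b :: nat
    by (induction b) auto
  ultimately show ?thesis by simp
qed

lemma computable_less:
  assumes "computable n f" "computable n g"
  shows "computable n (\<lambda>xs. of_bool (f xs < g xs))"
proof (rule computable_cong)
  show "computable n (\<lambda>xs. 1 - (1 - (g xs - f xs)))"
    by (intro computable_diff computable_const assms)
qed auto

lemma computable_not:
  assumes "computable n (\<lambda>xs. of_bool (P xs))"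
  shows "computable n (\<lambda>xs. of_bool (\<not> P xs))"
proof (rule computable_cong)
  show "computable n (\<lambda>xs. 1 - of_bool (P xs))"
    by (intro computable_diff computable_const assms)
qed auto

lemma computable_conj:
  assumes "computable n (\<lambda>xs. of_bool (P xs))" "computable n (\<lambda>xs. of_bool (Q xs))"
  shows "computable n (\<lambda>xs. of_bool (P xs \<and> Q xs))"
proof (rule computable_cong)
  show "computable n (\<lambda>xs. of_bool (P xs) * of_bool (Q xs))"
    by (intro computable_mult assms)
qed auto

lemma computable_disj:
  assumes "computable n (\<lambda>xs. of_bool (P xs))" "computable n (\<lambda>xs. of_bool (Q xs))"
  shows "computable n (\<lambda>xs. of_bool (P xs \<or> Q xs))"
proof (rule computable_cong)
  show "computable n (\<lambda>xs. of_bool (\<not> (\<not> P xs \<and> \<not> Q xs)))"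
    by (intro computable_not computable_conj assms)
qed auto

lemma computable_eq:
  assumes "computable n f" "computable n g"
  shows "computable n (\<lambda>xs. of_bool (f xs = g xs))"
proof (rule computable_cong)
  show "computable n (\<lambda>xs. of_bool (\<not> f xs < g xs \<and> \<not> g xs < f xs))"
    by (intro computable_not computable_conj computable_less assms)
qed auto

lemma computable_bex:
  assumes "computable n b" "computable (Suc n) (\<lambda>ys. of_bool (P (ys ! 0) (tl ys)))"
  shows "computable n (\<lambda>xs. of_bool (\<exists>i<b xs. P i xs))"
proof (rule computable_cong)
  show "computable n (\<lambda>xs. of_bool (0 < (\<Sum>i<b xs. of_bool (P i xs) :: nat)))"
    by (intro computable_less computable_const computable_sum assms)
  show "of_bool (\<exists>i<b xs. P i xs) = of_bool (0 < (\<Sum>i<b xs. of_bool (P i xs) :: nat))" for xs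
    by (rule arg_cong[where f = of_bool]) (auto simp: card_gt_0_iff)
qed

lemma computable_ball:
  assumes "computable n b" "computable (Suc n) (\<lambda>ys. of_bool (P (ys ! 0) (tl ys)))"
  shows "computable n (\<lambda>xs. of_bool (\<forall>i<b xs. P i xs))"
proof (rule computable_cong)
  show "computable n (\<lambda>xs. of_bool (\<not> (\<exists>i<b xs. \<not> P i xs)))"
    by (intro computable_not computable_bex assms)
qed auto

text \<open>The quotient counts the \<open>i < a\<close> with \<open>(i + 1) * b \<le> a\<close>.
  For \<open>b = 0\<close> every \<open>i\<close> would count, hence the factor that restores
  \<open>a div 0 = 0\<close>.\<close>

lemma computable_div:
  assumes "computable n f" "computable n g"
  shows "computable n (\<lambda>xs. f xs div g xs)"
proof -
  have "computable n (\<lambda>xs. of_bool (0 < g xs) * (\<Sum>i<f xs. of_bool (\<not> f xs < Suc i * g xs)))"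
    by (intro computable_mult computable_less computable_const assms computable_sum computable_not
        computable_tl computable_Suc computable_nth) auto
  moreover have "of_bool (0 < b) * (\<Sum>i<a. of_bool (\<not> a < Suc i * b)) = a div b" for a b :: nat
  proof (cases "b = 0")
    case False
    have "{i. i < a \<and> \<not> a < Suc i * b} = {..<a div b}"
    proof -
      have "i < a \<and> \<not> a < Suc i * b \<longleftrightarrow> i < a div b" for i
        using False less_eq_div_iff_mult_less_eq[of b "Suc i" a]
        by (metis div_le_dividend less_le_trans not_less Suc_le_eq neq0_conv)
      then show ?thesis by auto
    qed
    then show ?thesis using False by (simp add: Collect_conj_eq lessThan_def)
  qed simp
  ultimately show ?thesis by simp
qed

lemma computable_mod:
  assumes "computable n f" "computable n g"
  shows "computable n (\<lambda>xs. f xs mod g xs)"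
proof (rule computable_cong)
  show "computable n (\<lambda>xs. f xs - f xs div g xs * g xs)"
    by (intro computable_diff computable_mult computable_div assms)
qed (simp add: minus_div_mult_eq_mod)

lemma computable_prod_encode:
  assumes "computable n f" "computable n g"
  shows "computable n (\<lambda>xs. prod_encode (f xs, g xs))"
proof -
  have "computable n (\<lambda>xs. (f xs + g xs) * Suc (f xs + g xs) div 2 + f xs)"
    by (intro computable_add computable_div computable_mult computable_Suc computable_const assms)
  then show ?thesis by (simp add: prod_encode_def triangle_def)
qed

text \<open>Both components of a pair are at most its code, so decoding is a bounded search. Exactly
  one \<open>a\<close> passes the test, and the sum extracts it.\<close>

lemma computable_fst_prod_decode:
  assumes "computable n f"
  shows "computable n (\<lambda>xs. fst (prod_decode (f xs)))"
proof -
  have "computable n (\<lambda>xs. \<Sum>a<Suc (f xs). a * of_bool (\<exists>b<Suc (f xs). prod_encode (a, b) = f xs))"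
    by (intro computable_sum computable_mult computable_Suc computable_bex computable_eq
        computable_prod_encode computable_nth computable_nth_tl computable_tl assms) auto
  moreover have "(\<Sum>a<Suc z. a * of_bool (\<exists>b<Suc z. prod_encode (a, b) = z)) = fst (prod_decode z)" for z
  proof -
    obtain x y where z: "z = prod_encode (x, y)" by (metis prod.collapse prod_decode_inverse)
    have "(\<Sum>a<Suc z. a * of_bool (\<exists>b<Suc z. prod_encode (a, b) = z))
        = (\<Sum>a<Suc z. if a = x then x else 0)"
      using le_prod_encode_2[of y x] z by (intro sum.cong) (auto simp: less_Suc_eq_le)
    then show ?thesis using le_prod_encode_1[of x y] z by (auto simp: less_Suc_eq_le)
  qed
  ultimately show ?thesis by simp
qed

lemma computable_snd_prod_decode:
  assumes "computable n f"
  shows "computable n (\<lambda>xs. snd (prod_decode (f xs)))"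
proof -
  have "computable n (\<lambda>xs. \<Sum>b<Suc (f xs). b * of_bool (\<exists>a<Suc (f xs). prod_encode (a, b) = f xs))"
    by (intro computable_sum computable_mult computable_Suc computable_bex computable_eq
        computable_prod_encode computable_nth computable_nth_tl computable_tl assms) auto
  moreover have "(\<Sum>b<Suc z. b * of_bool (\<exists>a<Suc z. prod_encode (a, b) = z)) = snd (prod_decode z)" for z
  proof -
    obtain x y where z: "z = prod_encode (x, y)" by (metis prod.collapse prod_decode_inverse)
    have "(\<Sum>b<Suc z. b * of_bool (\<exists>a<Suc z. prod_encode (a, b) = z))
        = (\<Sum>b<Suc z. if b = y then y else 0)"
      using le_prod_encode_1[of x y] z by (intro sum.cong) (auto simp: less_Suc_eq_le)
    then show ?thesis using le_prod_encode_2[of y x] z by (auto simp: less_Suc_eq_le)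
  qed
  ultimately show ?thesis by simp
qed

section \<open>Reading and building list codes\<close>

definition list_code_mem :: "nat \<Rightarrow> nat \<Rightarrow> bool" where
  "list_code_mem e L \<longleftrightarrow>
     (\<exists>i<L. 0 < rec_nat L (\<lambda>_ y. snd (prod_decode (y - 1))) i \<and>
            fst (prod_decode (rec_nat L (\<lambda>_ y. snd (prod_decode (y - 1))) i - 1)) = e)"

lemma rec_nat_list_encode_tl:
  "rec_nat (list_encode zs) (\<lambda>_ y. snd (prod_decode (y - 1))) i = list_encode (drop i zs)"
proof (induction i)
  case (Suc i)
  have "snd (prod_decode 0) = 0" by (simp add: prod_decode_def prod_decode_aux.simps)
  \<comment> \<open>The code 0 of the empty list is a fixed point, since \<open>0 - 1 = 0\<close>
    decodes to second component 0. This agrees with \<open>tl [] = []\<close>.\<close>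
  then have "snd (prod_decode (list_encode ws - 1)) = list_encode (tl ws)" for ws
    by (cases ws) auto
  with Suc show ?case by (simp add: drop_Suc tl_drop)
qed simp

lemma length_le_list_encode: "length zs \<le> list_encode zs"
proof (induction zs)
  case (Cons z zs)
  then show ?case using le_prod_encode_2[of "list_encode zs" z] by simp
qed simp

text \<open>A list is no longer than its code, so the first \<open>L\<close> iterated tails reach
  every entry; a tail has a head exactly if its code is positive.\<close>

lemma list_code_mem_list_encode: "list_code_mem e (list_encode zs) \<longleftrightarrow> e \<in> set zs"
proof -
  have "0 < list_encode ws \<and> fst (prod_decode (list_encode ws - 1)) = e \<longleftrightarrow> ws \<noteq> [] \<and> hd ws = e" for ws
    by (cases ws) auto
  then have "list_code_mem e (list_encode zs) \<longleftrightarrow> (\<exists>i<list_encode zs. drop i zs \<noteq> [] \<and> hd (drop i zs) = e)"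
    unfolding list_code_mem_def rec_nat_list_encode_tl by simp
  also have "\<dots> \<longleftrightarrow> (\<exists>i<length zs. zs ! i = e)"
  proof
    assume "\<exists>i<length zs. zs ! i = e"
    then obtain i where "i < length zs" "zs ! i = e" by blast
    with length_le_list_encode[of zs]
    show "\<exists>i<list_encode zs. drop i zs \<noteq> [] \<and> hd (drop i zs) = e"
      by (intro exI[of _ i]) (auto simp: hd_drop_conv_nth)
  qed (auto simp: hd_drop_conv_nth not_le)
  finally show ?thesis by (simp add: in_set_conv_nth)
qed

lemma computable_list_code_mem:
  assumes "computable n f" "computable n g"
  shows "computable n (\<lambda>xs. of_bool (list_code_mem (f xs) (g xs)))"
  unfolding list_code_mem_def
  by (intro computable_bex computable_conj computable_less computable_const computable_eq
      computable_fst_prod_decode computable_snd_prod_decode computable_diff computable_rec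
      computable_nth computable_tl assms) auto

text \<open>A list code grows only at its head, so the entries are produced from the last to the
  first, whence \<open>n - Suc r\<close>. Starting from the code \<open>L\<close> of a further list
  turns concatenations into nested tabulations.\<close>

definition list_code_tab :: "nat \<Rightarrow> (nat \<Rightarrow> nat) \<Rightarrow> nat \<Rightarrow> nat" where
  "list_code_tab n f L = rec_nat L (\<lambda>r y. Suc (prod_encode (f (n - Suc r), y))) n"

lemma list_code_tab_list_encode: "list_code_tab n f (list_encode zs) = list_encode (map f [0..<n] @ zs)"
proof -
  have "rec_nat (list_encode zs) (\<lambda>r y. Suc (prod_encode (f (n - Suc r), y))) r
      = list_encode (map f [n - r..<n] @ zs)" if "r \<le> n" for r
    using that
  proof (induction r)
    case (Suc r)
    then have "[n - Suc r..<n] = (n - Suc r) # [n - r..<n]"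
      by (simp add: upt_conv_Cons Suc_diff_Suc)
    with Suc show ?case by simp
  qed simp
  then show ?thesis by (simp add: list_code_tab_def)
qed

lemma computable_list_code_tab:
  assumes "computable n b" "computable (Suc n) (\<lambda>ys. f (ys ! 0) (tl ys))" "computable n L"
  shows "computable n (\<lambda>xs. list_code_tab (b xs) (\<lambda>i. f i xs) (L xs))"
proof -
  have "computable (Suc (Suc n)) (\<lambda>ys. f (b (tl (tl ys)) - Suc (ys ! 0)) (tl (tl ys)))"
    by (rule computable_let[of _ "\<lambda>w ys. f w (tl (tl ys))"])
      (auto intro!: computable_diff computable_Suc computable_nth computable_tl assms
        computable_tl_tl[of _ "\<lambda>w ys. f w (tl ys)"] computable_tl_tl[of _ f])
  then show ?thesis
    unfolding list_code_tab_def
    by (intro computable_rec computable_Suc computable_prod_encode computable_nth assms) auto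
qed

section \<open>Derivations and algebraic maxima\<close>

text \<open>\<open>S\<close> is a subring, not a subfield: adjoining an element then involves
  polynomial values only, no quotients. The values of \<open>D\<close> may lie outside
  \<open>S\<close>.\<close>

definition derivation_on :: "'a::field_char_0 set \<Rightarrow> ('a \<Rightarrow> 'a) \<Rightarrow> bool" where
  "derivation_on S D \<longleftrightarrow> 1 \<in> S \<and> (\<forall>x\<in>S. - x \<in> S) \<and>
     (\<forall>x\<in>S. \<forall>y\<in>S. x + y \<in> S \<and> x * y \<in> S \<and>
        D (x + y) = D x + D y \<and> D (x * y) = x * D y + y * D x)"

lemma derivation_onD:
  assumes "derivation_on S D" "x \<in> S" "y \<in> S"
  shows "x + y \<in> S" "x * y \<in> S" "- x \<in> S"
    "D (x + y) = D x + D y" "D (x * y) = x * D y + y * D x"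
  using assms unfolding derivation_on_def by auto

lemma derivation_on_one:
  assumes "derivation_on S D"
  shows "1 \<in> S" "D 1 = 0"
proof -
  show 1: "1 \<in> S" using assms unfolding derivation_on_def by blast
  show "D 1 = 0" using derivation_onD(5)[OF assms 1 1] by simp
qed

lemma derivation_on_zero:
  assumes "derivation_on S D"
  shows "0 \<in> S" "D 0 = 0"
proof -
  show 0: "0 \<in> S"
    using derivation_onD(1,3)[OF assms derivation_on_one(1)[OF assms]]
    by (metis add.right_inverse assms derivation_onD(1) derivation_on_one(1))
  show "D 0 = 0" using derivation_onD(4)[OF assms 0 0] by simp
qed

lemma derivation_on_minus:
  assumes "derivation_on S D" "x \<in> S"
  shows "D (- x) = - D x"
proof -
  have "D (x + - x) = D x + D (- x)"
    using derivation_onD(3,4)[OF assms] assms by (metis derivation_onD(3,4))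
  then show ?thesis
    using derivation_on_zero(2)[OF assms(1)] by (simp add: add_eq_0_iff)
qed

lemma derivation_on_sum:
  assumes "derivation_on S D" "\<And>i. i \<in> I \<Longrightarrow> f i \<in> S"
  shows "sum f I \<in> S \<and> D (sum f I) = (\<Sum>i\<in>I. D (f i))"
  using assms(2)
proof (induction I rule: infinite_finite_induct)
  case (insert i I)
  then show ?case using derivation_onD[OF assms(1)] by auto
qed (auto simp: derivation_on_zero[OF assms(1)])

lemma derivation_on_Ints: "derivation_on \<int> (\<lambda>_. 0)"
  unfolding derivation_on_def by auto

lemma derivation_on_map_poly_mult:
  assumes D: "derivation_on S D"
    and p: "\<And>i. coeff p i \<in> S" and q: "\<And>i. coeff q i \<in> S"
  shows "map_poly D (p * q) = map_poly D p * q + p * map_poly D q"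
proof (rule poly_eqI)
  fix n
  have "coeff p i * coeff q (n - i) \<in> S" for i
    using derivation_onD[OF D p q] by blast
  then have "D (coeff (p * q) n) = (\<Sum>i\<le>n. D (coeff p i * coeff q (n - i)))"
    unfolding coeff_mult by (intro conjunct2[OF derivation_on_sum[OF D]])
  also have "\<dots> = (\<Sum>i\<le>n. D (coeff p i) * coeff q (n - i) + coeff p i * D (coeff q (n - i)))"
    using derivation_onD(5)[OF D p q] by (simp add: algebra_simps)
  finally show "coeff (map_poly D (p * q)) n = coeff (map_poly D p * q + p * map_poly D q) n"
    by (simp add: coeff_map_poly derivation_on_zero(2)[OF D] coeff_mult sum.distrib)
qed

text \<open>The new ring consists of the values at \<alpha> of polynomials over \<open>S\<close>.
  Once the derivative \<beta> of \<alpha> is chosen, the product rule dictates the extension. It is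
  well defined if it vanishes on all polynomials with root \<alpha>: no condition if \<alpha> is
  transcendental over \<open>S\<close>, and otherwise one that determines \<beta>.\<close>

lemma derivation_on_extend:
  fixes \<alpha> :: "'a::field_char_0"
  assumes D: "derivation_on S D"
  shows "\<exists>S' D'. derivation_on S' D' \<and> S \<subseteq> S' \<and> \<alpha> \<in> S' \<and> (\<forall>x\<in>S. D' x = D x) \<and>
    ((\<forall>p. (\<forall>i. coeff p i \<in> S) \<longrightarrow> poly p \<alpha> = 0 \<longrightarrow> p = 0) \<longrightarrow> D' \<alpha> = 1)"
proof -
  define P where "P = {p. \<forall>i. coeff p i \<in> S}"
  note D0 = derivation_on_zero[OF D] and D1 = derivation_on_one[OF D]
  have P_add: "p + q \<in> P" if "p \<in> P" "q \<in> P" for p q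
    using that derivation_onD(1)[OF D] unfolding P_def by auto
  have P_minus: "- p \<in> P" if "p \<in> P" for p
    using that derivation_onD(3)[OF D] unfolding P_def by auto
  have P_mult: "p * q \<in> P" if "p \<in> P" "q \<in> P" for p q
  proof -
    have S: "coeff p i * coeff q j \<in> S" for i j
      using that derivation_onD(2)[OF D] unfolding P_def by auto
    have "(\<Sum>i\<le>n. coeff p i * coeff q (n - i)) \<in> S" for n
      by (rule conjunct1[OF derivation_on_sum[OF D]]) (rule S)
    then show ?thesis by (simp add: P_def coeff_mult)
  qed
  have P_monom: "monom c i \<in> P" if "c \<in> S" for c i
    using that D0 unfolding P_def by auto
  have P_coeff: "coeff p i \<in> S" if "p \<in> P" for p i
    using that unfolding P_def by auto
  \<comment> \<open>The derivative that \<open>poly p \<alpha>\<close> must have if \<alpha> has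
    derivative \<beta>: differentiate the coefficients and the argument.\<close>
  define E where "E \<beta> p = poly (map_poly D p) \<alpha> + \<beta> * poly (pderiv p) \<alpha>" for \<beta> p
  have E_add: "E \<beta> (p + q) = E \<beta> p + E \<beta> q" if "p \<in> P" "q \<in> P" for \<beta> p q
  proof -
    have "map_poly D (p + q) = map_poly D p + map_poly D q"
      by (rule poly_eqI) (simp add: coeff_map_poly D0 derivation_onD(4)[OF D] P_coeff that)
    then show ?thesis by (simp add: E_def pderiv_add algebra_simps)
  qed
  have E_minus: "E \<beta> (- p) = - E \<beta> p" if "p \<in> P" for \<beta> p
  proof -
    have "map_poly D (- p) = - map_poly D p"
      by (rule poly_eqI) (simp add: coeff_map_poly D0 derivation_on_minus[OF D] P_coeff that)
    then show ?thesis by (simp add: E_def pderiv_minus algebra_simps)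
  qed
  have E_mult: "E \<beta> (p * q) = poly p \<alpha> * E \<beta> q + poly q \<alpha> * E \<beta> p" if "p \<in> P" "q \<in> P" for \<beta> p q
    using derivation_on_map_poly_mult[OF D, of p q] P_coeff that
    by (simp add: E_def pderiv_mult algebra_simps)
  obtain \<beta> where \<beta>: "\<And>p. p \<in> P \<Longrightarrow> poly p \<alpha> = 0 \<Longrightarrow> E \<beta> p = 0"
    and \<beta>1: "(\<forall>p\<in>P. poly p \<alpha> = 0 \<longrightarrow> p = 0) \<longrightarrow> \<beta> = 1"
  proof (cases "\<forall>p\<in>P. poly p \<alpha> = 0 \<longrightarrow> p = 0")
    case True
    have "E 1 p = 0" if "p \<in> P" "poly p \<alpha> = 0" for p
    proof -
      have "p = 0" using True that by blast
      then show ?thesis by (simp add: E_def)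
    qed
    then show ?thesis using that[of 1] by blast
  next
    case False
    \<comment> \<open>An annihilating polynomial of least degree. In characteristic 0 its derivative
      is nonzero of smaller degree, so it does not vanish at \<alpha>, and
      \<open>E \<beta> m = 0\<close> can be solved for \<beta>.\<close>
    define m where "m = arg_min degree (\<lambda>m. m \<in> P \<and> poly m \<alpha> = 0 \<and> m \<noteq> 0)"
    from False obtain m0 where "m0 \<in> P \<and> poly m0 \<alpha> = 0 \<and> m0 \<noteq> 0" by blast
    from arg_min_nat_lemma[of "\<lambda>m. m \<in> P \<and> poly m \<alpha> = 0 \<and> m \<noteq> 0", OF this, of degree]
    have m: "m \<in> P" "poly m \<alpha> = 0" "m \<noteq> 0"
      and min: "\<And>p. p \<in> P \<Longrightarrow> poly p \<alpha> = 0 \<Longrightarrow> p \<noteq> 0 \<Longrightarrow> degree m \<le> degree p"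
      unfolding m_def by auto
    have deg: "degree m > 0"
    proof (rule ccontr)
      assume "\<not> degree m > 0"
      then obtain c where "m = [:c:]" by (metis degree_eq_zeroE gr0I)
      with m show False by simp
    qed
    have "pderiv m \<in> P"
    proof -
      have "of_nat j * x \<in> S" if "x \<in> S" for j and x
        by (induction j) (auto simp: D0 algebra_simps intro!: derivation_onD(1)[OF D] that)
      then show ?thesis using m(1) unfolding P_def by (simp add: coeff_pderiv del: of_nat_Suc)
    qed
    moreover have "pderiv m \<noteq> 0" using deg by (simp add: pderiv_eq_0_iff)
    moreover have "degree (pderiv m) < degree m" using deg by (simp add: degree_pderiv)
    ultimately have m': "poly (pderiv m) \<alpha> \<noteq> 0" using min[of "pderiv m"] by force
    define \<beta> where "\<beta> = - poly (map_poly D m) \<alpha> / poly (pderiv m) \<alpha>"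
    have Em: "E \<beta> m = 0" using m' by (simp add: E_def \<beta>_def)
    have "E \<beta> p = 0" if "p \<in> P" "poly p \<alpha> = 0" for p
      using that
    proof (induction "degree p" arbitrary: p rule: less_induct)
      case less
      show ?case
      proof (cases "p = 0")
        case False
        then have le: "degree m \<le> degree p" using min less by blast
        \<comment> \<open>Pseudo-division: multiplying \<open>p\<close> by the leading coefficient
          of \<open>m\<close> cancels the top term without leaving \<open>S\<close>. Since
          \<open>p\<close> and \<open>m\<close> vanish at \<alpha>, and
          \<open>E \<beta> m = 0\<close>, this only scales \<open>E \<beta> p\<close> by that
          coefficient.\<close>
        let ?c = "[:lead_coeff m:]" and ?h = "monom (lead_coeff p) (degree p - degree m)"
        let ?q = "?c * p + - (?h * m)"
        have cP: "?c \<in> P" using P_monom[of "lead_coeff m" 0] P_coeff m by (simp add: monom_0)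
        have hP: "?h \<in> P" using P_monom P_coeff less by blast
        have "coeff ?q (degree p) = 0"
          using le by (simp add: coeff_monom_mult) (simp add: mult.commute)?
        moreover have "degree ?q \<le> degree p"
        proof (rule degree_le, intro allI impI)
          fix i assume "degree p < i"
          then show "coeff ?q i = 0" using le by (simp add: coeff_monom_mult coeff_eq_0)
        qed
        ultimately have "degree ?q < degree p \<or> ?q = 0"
          by (metis deg le le_neq_implies_less leading_coeff_0_iff)
        moreover have "?q \<in> P" "poly ?q \<alpha> = 0"
          using P_add[OF P_mult[OF cP less.prems(1)] P_minus[OF P_mult[OF hP m(1)]]] less.prems m
          by auto
        ultimately have "E \<beta> ?q = 0"
          using less.hyps by (auto simp: E_def)
        moreover have "E \<beta> ?q = lead_coeff m * E \<beta> p"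
          using m less.prems Em
          by (simp only: E_add[OF P_mult[OF cP less.prems(1)] P_minus[OF P_mult[OF hP m(1)]]]
              E_minus[OF P_mult[OF hP m(1)]] E_mult[OF cP less.prems(1)] E_mult[OF hP m(1)]) simp
        ultimately show ?thesis using m by simp
      qed (simp add: E_def)
    qed
    with that[of \<beta>] False show ?thesis by blast
  qed
  define S' where "S' = (\<lambda>p. poly p \<alpha>) ` P"
  define D' where "D' x = E \<beta> (SOME p. p \<in> P \<and> poly p \<alpha> = x)" for x
  have D': "D' (poly p \<alpha>) = E \<beta> p" if "p \<in> P" for p
  proof -
    define q where "q = (SOME q. q \<in> P \<and> poly q \<alpha> = poly p \<alpha>)"
    have q: "q \<in> P \<and> poly q \<alpha> = poly p \<alpha>"
      unfolding q_def by (rule someI[of _ p]) (use that in simp)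
    have "E \<beta> (q + - p) = 0"
      using q P_add[of q "- p"] P_minus[OF that] by (intro \<beta>) auto
    then have "E \<beta> q = E \<beta> p"
      using q that E_add[of q "- p" \<beta>] E_minus[of p \<beta>] P_minus[of p] by simp
    then show ?thesis unfolding D'_def q_def .
  qed
  have const: "[:x:] \<in> P" if "x \<in> S" for x
    using P_monom[OF that, of 0] by (simp add: monom_0)
  have "derivation_on S' D'"
    unfolding derivation_on_def
  proof (intro conjI ballI)
    show "1 \<in> S'" unfolding S'_def using const[OF D1(1)] by (intro image_eqI[of _ _ "[:1:]"]) auto
  next
    fix x assume "x \<in> S'"
    then obtain p where p: "p \<in> P" "x = poly p \<alpha>" unfolding S'_def by blast
    show "- x \<in> S'" unfolding S'_def using P_minus[of p] p by (intro image_eqI[of _ _ "- p"]) auto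
    fix y assume "y \<in> S'"
    then obtain q where q: "q \<in> P" "y = poly q \<alpha>" unfolding S'_def by blast
    show "x + y \<in> S'" unfolding S'_def using P_add p q by (intro image_eqI[of _ _ "p + q"]) auto
    show "x * y \<in> S'" unfolding S'_def using P_mult p q by (intro image_eqI[of _ _ "p * q"]) auto
    show "D' (x + y) = D' x + D' y"
      using D'[OF P_add, of p q] D' E_add p q by simp
    show "D' (x * y) = x * D' y + y * D' x"
      using D'[OF P_mult, of p q] D' E_mult p q by simp
  qed
  moreover have "S \<subseteq> S'" 
  proof
    fix x assume "x \<in> S"
    then show "x \<in> S'" unfolding S'_def using const by (intro image_eqI[of _ _ "[:x:]"]) auto
  qed
  moreover have aP: "[:0, 1:] \<in> P" using P_monom[OF D1(1), of 1] by (simp add: monom_altdef)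
  moreover have "\<alpha> \<in> S'" unfolding S'_def using aP by (intro image_eqI[of _ _ "[:0, 1:]"]) auto
  moreover have "D' x = D x" if "x \<in> S" for x
    using D'[OF const[OF that]] by (simp add: E_def map_poly_pCons D0)
  moreover have "D' \<alpha> = \<beta>"
    using D'[OF aP] by (simp add: E_def map_poly_pCons D0 D1 pderiv_pCons)
  ultimately show ?thesis using \<beta>1 unfolding P_def by blast
qed

lemma derivation_on_extend_finite:
  assumes "derivation_on S D" "finite A"
  shows "\<exists>S' D'. derivation_on S' D' \<and> S \<union> A \<subseteq> S' \<and> (\<forall>x\<in>S. D' x = D x)"
  using assms(2)
proof (induction A)
  case empty
  show ?case using assms(1) by blast
next
  case (insert a A)
  then obtain S1 D1 where 1: "derivation_on S1 D1" "S \<union> A \<subseteq> S1" "\<forall>x\<in>S. D1 x = D x" by blast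
  from derivation_on_extend[OF 1(1), of a] obtain S2 D2 where
    "derivation_on S2 D2" "S1 \<subseteq> S2" "a \<in> S2" "\<forall>x\<in>S1. D2 x = D1 x" by blast
  with 1 show ?case by (intro exI[of _ S2] exI[of _ D2]) auto
qed

text \<open>\<open>algebraic\<close> refers to integer coefficients, so a transcendental
  \<open>t\<close> is free over the integers with the zero derivation and its derivative may be
  prescribed. The elements of \<open>A\<close> are adjoined afterwards, with no control over their
  derivatives.\<close>

lemma derivation_on_transcendental:
  fixes t :: "'a::field_char_0"
  assumes "\<not> algebraic t" "finite A"
  obtains S D where "derivation_on S D" "A \<subseteq> S" "t \<in> S" "D t = 1"
proof -
  from derivation_on_extend[OF derivation_on_Ints, of t] obtain S1 D1 where
    1: "derivation_on S1 D1" "t \<in> S1" "D1 t = 1"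
    using assms(1) unfolding algebraic_def by metis
  from derivation_on_extend_finite[OF 1(1) assms(2)] 1 that show ?thesis by auto
qed

text \<open>With part sizes \<open>x a * n\<close>, the blow-up has \<open>n\<^sup>2\<close> times
  this many ordered adjacent pairs up to \<open>O(n)\<close>, so this is its limiting edge density.
  A loop at \<open>a\<close> makes part \<open>a\<close> a clique.\<close>

definition pattern_weight :: "nat \<Rightarrow> (nat \<Rightarrow> nat \<Rightarrow> bool) \<Rightarrow> (nat \<Rightarrow> real) \<Rightarrow> real" where
  "pattern_weight M P x = (\<Sum>a<M. \<Sum>b<M. of_bool (P a b) * (x a * x b))"

lemma pattern_weight_perturb:
  "pattern_weight M P (\<lambda>a. x a + e * d a) =
     pattern_weight M P x + e * (\<Sum>a<M. \<Sum>b<M. of_bool (P a b) * (x a * d b + x b * d a))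
       + e\<^sup>2 * pattern_weight M P d"
  unfolding pattern_weight_def sum_distrib_left sum.distrib[symmetric]
  by (intro sum.cong refl) (simp add: algebra_simps power2_eq_square)

text \<open>If the maximum \<open>t\<close> were transcendental, a derivation \<open>D\<close> with \<open>D t = 1\<close> would yield the
  improving direction \<open>D x\<close>: the weights equal to \<open>t\<close> grow at rate \<open>1\<close>, a tight constraint
  \<open>\<Sum>x = 1\<close> stays tight because \<open>D 1 = 0\<close>, and coordinates equal to \<open>0\<close> do not move.\<close>

lemma algebraic_max_min_pattern_weight:
  fixes x :: "nat \<Rightarrow> real" and k :: nat
  assumes x: "\<And>a. a < M \<Longrightarrow> 0 \<le> x a" "sum x {..<M} \<le> 1"
    and t: "\<And>i. i < k \<Longrightarrow> t \<le> pattern_weight M (P i) x"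
    and max: "\<And>y s. \<lbrakk>\<And>a. a < M \<Longrightarrow> 0 \<le> y a; sum y {..<M} \<le> 1;
        \<And>i. i < k \<Longrightarrow> s \<le> pattern_weight M (P i) y\<rbrakk> \<Longrightarrow> s \<le> t"
    and "0 < k"
  shows "algebraic t"
proof (rule ccontr)
  assume "\<not> algebraic t"
  then obtain S D where D: "derivation_on S D" "x ` {..<M} \<subseteq> S" "t \<in> S" "D t = 1"
    by (rule derivation_on_transcendental[of t "x ` {..<M}"]) auto
  define d where "d a = D (x a)" for a
  define y where "y e a = x a + e * d a" for e a
  have xS: "x a \<in> S" if "a < M" for a using D that by auto
  have ev_nonneg: "\<forall>\<^sub>F e in at_right 0. \<forall>a\<in>{..<M}. 0 \<le> y e a"
  proof (intro eventually_ball_finite ballI)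
    fix a assume "a \<in> {..<M}"
    show "\<forall>\<^sub>F e in at_right 0. 0 \<le> y e a"
    proof (cases "x a = 0")
      case True
      then show ?thesis using derivation_on_zero[OF D(1)] by (simp add: y_def d_def)
    next
      case False
      have "((\<lambda>e. y e a) \<longlongrightarrow> x a + 0 * d a) (at_right 0)"
        unfolding y_def by (intro tendsto_intros)
      moreover have "0 < x a + 0 * d a" using False x \<open>a \<in> {..<M}\<close> by (simp add: less_le)
      ultimately have "\<forall>\<^sub>F e in at_right 0. 0 < y e a" by (rule order_tendstoD)
      then show ?thesis by eventually_elim simp
    qed
  qed auto
  have ev_sum: "\<forall>\<^sub>F e in at_right 0. sum (y e) {..<M} \<le> 1"
  proof (cases "sum x {..<M} = 1")
    case True
    have "sum d {..<M} = D (sum x {..<M})"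
      using derivation_on_sum[OF D(1), of "{..<M}" x] xS by (simp add: d_def)
    also have "\<dots> = 0" using True derivation_on_one[OF D(1)] by simp
    finally show ?thesis
      using True by (simp add: y_def sum.distrib sum_distrib_left[symmetric])
  next
    case False
    have "((\<lambda>e. sum (y e) {..<M}) \<longlongrightarrow> (\<Sum>a<M. x a + 0 * d a)) (at_right 0)"
      unfolding y_def by (intro tendsto_intros)
    moreover have "(\<Sum>a<M. x a + 0 * d a) < 1" using False x by simp
    ultimately have "\<forall>\<^sub>F e in at_right 0. sum (y e) {..<M} < 1" by (rule order_tendstoD)
    then show ?thesis by eventually_elim simp
  qed
  have ev_weight: "\<forall>\<^sub>F e in at_right 0. \<forall>i\<in>{..<k}. t < pattern_weight M (P i) (y e)"
  proof (intro eventually_ball_finite ballI)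
    fix i assume i: "i \<in> {..<k}"
    define w1 where "w1 = (\<Sum>a<M. \<Sum>b<M. of_bool (P i a b) * (x a * d b + x b * d a))"
    define w where "w e = pattern_weight M (P i) x + e * w1 + e\<^sup>2 * pattern_weight M (P i) d" for e
    have y: "pattern_weight M (P i) (y e) = w e" for e
      unfolding y_def w_def w1_def by (rule pattern_weight_perturb)
    show "\<forall>\<^sub>F e in at_right 0. t < pattern_weight M (P i) (y e)"
    proof (cases "pattern_weight M (P i) x = t")
      case True
      have S0: "of_bool b * z \<in> S \<and> D (of_bool b * z) = of_bool b * D z" if "z \<in> S" for b z
        using that derivation_on_zero[OF D(1)] by (cases b) auto
      have 1: "of_bool (P i a b) * (x a * x b) \<in> S \<and>
          D (of_bool (P i a b) * (x a * x b)) = of_bool (P i a b) * (x a * d b + x b * d a)"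
        if "a < M" "b < M" for a b
        using S0 derivation_onD[OF D(1) xS[OF that(1)] xS[OF that(2)]] by (simp add: d_def)
      have 2: "(\<Sum>b<M. of_bool (P i a b) * (x a * x b)) \<in> S \<and>
          D (\<Sum>b<M. of_bool (P i a b) * (x a * x b))
          = (\<Sum>b<M. of_bool (P i a b) * (x a * d b + x b * d a))" if "a < M" for a
        using derivation_on_sum[OF D(1), of "{..<M}" "\<lambda>b. of_bool (P i a b) * (x a * x b)"] 1 that
        by simp
      have "D (pattern_weight M (P i) x) = w1"
        unfolding pattern_weight_def w1_def
        using derivation_on_sum[OF D(1), of "{..<M}" "\<lambda>a. \<Sum>b<M. of_bool (P i a b) * (x a * x b)"] 2
        by simp
      then have "w1 = 1" using True D by simp
      \<comment> \<open>The first-order gain \<open>e\<close> outweighs the quadratic term for small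
        \<open>e\<close>.\<close>
      have "((\<lambda>e. 1 + e * pattern_weight M (P i) d) \<longlongrightarrow> 1 + 0 * pattern_weight M (P i) d) (at_right 0)"
        by (intro tendsto_intros)
      then have "\<forall>\<^sub>F e in at_right 0. 0 < 1 + e * pattern_weight M (P i) d"
        by (rule order_tendstoD) simp
      moreover have "\<forall>\<^sub>F e in at_right 0. (0::real) < e" by (rule eventually_at_right_less)
      ultimately show ?thesis
      proof eventually_elim
        case (elim e)
        then have "0 < e * (1 + e * pattern_weight M (P i) d)" by simp
        then show ?case
          unfolding y w_def True \<open>w1 = 1\<close> by (simp add: algebra_simps power2_eq_square)
      qed
    next
      case False
      have "(w \<longlongrightarrow> pattern_weight M (P i) x + 0 * w1 + 0\<^sup>2 * pattern_weight M (P i) d) (at_right 0)"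
        unfolding w_def by (intro tendsto_intros)
      moreover have "t < pattern_weight M (P i) x + 0 * w1 + 0\<^sup>2 * pattern_weight M (P i) d"
        using False t i by (simp add: less_le)
      ultimately show ?thesis unfolding y by (rule order_tendstoD)
    qed
  qed auto
  from eventually_happens[OF eventually_conj[OF ev_nonneg eventually_conj[OF ev_sum ev_weight]]]
  obtain e where e: "\<forall>a\<in>{..<M}. 0 \<le> y e a" "sum (y e) {..<M} \<le> 1"
    "\<forall>i\<in>{..<k}. t < pattern_weight M (P i) (y e)"
    by (auto simp: trivial_limit_at_right_real)
  let ?s = "Min ((\<lambda>i. pattern_weight M (P i) (y e)) ` {..<k})"
  have "?s \<le> t"
    by (rule max[of "y e"]) (use e in auto)
  moreover have "t < ?s"
    using e \<open>0 < k\<close> by (subst Min_gr_iff) auto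
  ultimately show False by simp
qed

section \<open>Rainbow copies, rainbow homomorphisms and the lower bound\<close>

lemma card_ordered_edges:
  assumes "finite V" and "\<And>e. e \<in> E \<Longrightarrow> e \<subseteq> V \<and> card e = 2"
  shows "card {(u, v). {u, v} \<in> E} = 2 * card E"
proof -
  have "finite E" using assms by (meson PowI finite_Pow_iff finite_subset subsetI)
  have eq: "{(u, v). {u, v} \<in> E} = (\<Union>e\<in>E. {(u, v). {u, v} = e})" by auto
  have two: "card {(u, v). {u, v} = e} = 2 \<and> finite {(u, v). {u, v} = e}" if e: "e \<in> E" for e
  proof -
    obtain a b where ab: "e = {a, b}" "a \<noteq> b" using assms(2)[OF e] by (auto simp: card_2_iff)
    then have "{(u, v). {u, v} = e} = {(a, b), (b, a)}" by (auto simp: doubleton_eq_iff)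
    then show ?thesis using ab by simp
  qed
  have "card {(u, v). {u, v} \<in> E} = (\<Sum>e\<in>E. card {(u, v). {u, v} = e})"
    unfolding eq by (rule card_UN_disjoint) (use \<open>finite E\<close> two in auto)
  also have "\<dots> = 2 * card E" using two by simp
  finally show ?thesis .
qed

text \<open>A relation rather than a graph: loops of \<open>Q\<close> contribute diagonal pairs, at
  most one per vertex, which the bounds absorb in their linear terms.\<close>

definition blowup :: "nat \<Rightarrow> (nat \<Rightarrow> 'v set) \<Rightarrow> (nat \<Rightarrow> nat \<Rightarrow> bool) \<Rightarrow> ('v \<times> 'v) set" where
  "blowup M A Q = (\<Union>a<M. \<Union>b\<in>{b. b < M \<and> Q a b}. A a \<times> A b)"

lemma card_blowup:
  assumes "\<And>a. a < M \<Longrightarrow> finite (A a)"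
    and "\<And>a b u. \<lbrakk>a < M; b < M; u \<in> A a; u \<in> A b\<rbrakk> \<Longrightarrow> a = b"
  shows "card (blowup M A Q) = (\<Sum>a<M. \<Sum>b<M. of_bool (Q a b) * (card (A a) * card (A b)))"
    and "finite (blowup M A Q)"
proof -
  have fin: "finite (\<Union>b\<in>{b. b < M \<and> Q a b}. A a \<times> A b)" if "a < M" for a
    using assms(1) that by auto
  then show "finite (blowup M A Q)" by (auto simp: blowup_def)
  have disj: "A a \<inter> A b = {}" if "a < M" "b < M" "a \<noteq> b" for a b
    using assms(2) that by blast
  have inner: "card (\<Union>b\<in>{b. b < M \<and> Q a b}. A a \<times> A b) = (\<Sum>b\<in>{b. b < M \<and> Q a b}. card (A a \<times> A b))"
    if a: "a < M" for a
  proof (rule card_UN_disjoint)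
    show "\<forall>i\<in>{b. b < M \<and> Q a b}. finite (A a \<times> A i)" using assms(1) a by auto
    show "\<forall>i\<in>{b. b < M \<and> Q a b}. \<forall>j\<in>{b. b < M \<and> Q a b}. i \<noteq> j \<longrightarrow>
      A a \<times> A i \<inter> A a \<times> A j = {}"
      using disj by blast
  qed auto
  have "card (blowup M A Q) = (\<Sum>a<M. card (\<Union>b\<in>{b. b < M \<and> Q a b}. A a \<times> A b))"
    unfolding blowup_def
  proof (rule card_UN_disjoint)
    show "\<forall>i\<in>{..<M}. \<forall>j\<in>{..<M}. i \<noteq> j \<longrightarrow>
      (\<Union>b\<in>{b. b < M \<and> Q i b}. A i \<times> A b) \<inter> (\<Union>b\<in>{b. b < M \<and> Q j b}. A j \<times> A b) = {}"
      using disj by blast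
  qed (use fin in auto)
  also have "\<dots> = (\<Sum>a<M. \<Sum>b\<in>{b. b < M \<and> Q a b}. card (A a \<times> A b))"
    by (intro sum.cong refl inner) simp
  also have "\<dots> = (\<Sum>a<M. \<Sum>b<M. of_bool (Q a b) * (card (A a) * card (A b)))"
  proof (rule sum.cong[OF refl])
    fix a
    have "(\<Sum>b<M. of_bool (Q a b) * (card (A a) * card (A b)))
        = (\<Sum>b<M. if Q a b then card (A a \<times> A b) else 0)"
      by (intro sum.cong) (auto simp: card_cartesian_product)
    also have "\<dots> = (\<Sum>b\<in>{b. b < M \<and> Q a b}. card (A a \<times> A b))"
      by (subst sum.inter_filter[symmetric]) (auto intro: sum.cong)
    finally show "(\<Sum>b\<in>{b. b < M \<and> Q a b}. card (A a \<times> A b))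
        = (\<Sum>b<M. of_bool (Q a b) * (card (A a) * card (A b)))" by simp
  qed
  finally show "card (blowup M A Q) = (\<Sum>a<M. \<Sum>b<M. of_bool (Q a b) * (card (A a) * card (A b)))" .
qed

text \<open>\<open>m\<close> and \<open>par\<close> determine \<open>T\<close> up to isomorphism,
  and \<open>g\<close> only names its vertices. Statements about patterns can therefore speak of
  \<open>m\<close> and \<open>par\<close> alone.\<close>

definition tree_order :: "nat \<Rightarrow> (nat \<Rightarrow> nat) \<Rightarrow> (nat \<Rightarrow> 'v) \<Rightarrow> 'v graph \<Rightarrow> bool" where
  "tree_order m par g T \<longleftrightarrow> 0 < m \<and> bij_betw g {..<m} (verts T) \<and> (\<forall>j\<in>{1..<m}. par j < j) \<and>
     edges T = (\<lambda>j. {g j, g (par j)}) ` {1..<m}"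

text \<open>The child is the later end of its edge. If two edges agreed with their ends exchanged,
  each child would precede the other.\<close>

lemma inj_on_parent_edge:
  fixes m :: nat
  assumes "inj_on g {..<m}" and "\<And>j. j \<in> {1..<m} \<Longrightarrow> par j < j"
  shows "inj_on (\<lambda>j. {g j, g (par j)}) {1..<m}"
proof (rule inj_onI)
  fix i j assume ij: "i \<in> {1..<m}" "j \<in> {1..<m}" "{g i, g (par i)} = {g j, g (par j)}"
  note p = assms(2)[OF ij(1)] assms(2)[OF ij(2)]
  show "i = j"
  proof (cases "g i = g j")
    case True
    then show ?thesis using inj_onD[OF assms(1)] ij by auto
  next
    case False
    then have "g i = g (par j)" "g (par i) = g j" using ij(3) by (auto simp: doubleton_eq_iff)
    moreover have "par i < m" "par j < m" using p ij(1,2) by auto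
    ultimately have "i = par j" "par i = j"
      using inj_onD[OF assms(1), of i "par j"] inj_onD[OF assms(1), of "par i" j] ij(1,2) p by auto
    then show ?thesis using p by simp
  qed
qed

text \<open>By \<open>inj_on_parent_edge\<close> the vertices other than the root index the edges,
  so \<psi> colours an edge through its child.\<close>

definition rainbow_copy ::
  "nat \<Rightarrow> (nat \<Rightarrow> nat) \<Rightarrow> nat \<Rightarrow> 'v set \<Rightarrow> (nat \<Rightarrow> 'v graph) \<Rightarrow> (nat \<Rightarrow> 'v) \<Rightarrow> (nat \<Rightarrow> nat) \<Rightarrow> bool" where
  "rainbow_copy m par k V G f \<psi> \<longleftrightarrow> inj_on f {..<m} \<and> f ` {..<m} \<subseteq> V \<and>
     inj_on \<psi> {1..<m} \<and> \<psi> ` {1..<m} \<subseteq> {1..k} \<and>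
     (\<forall>j\<in>{1..<m}. {f j, f (par j)} \<in> edges (G (\<psi> j)))"

lemma rainbow_copy_imp_not_free:
  assumes T: "tree_order m par g T" and f: "rainbow_copy m par k V G f \<psi>"
  shows "\<not> rainbow_free k V G T"
proof -
  define ed where "ed j = {f j, f (par j)}" for j
  define H where "H = (f ` {..<m}, ed ` {1..<m})"
  have par: "\<And>j. j \<in> {1..<m} \<Longrightarrow> par j < j" and g: "bij_betw g {..<m} (verts T)"
    and eT: "edges T = (\<lambda>j. {g j, g (par j)}) ` {1..<m}"
    using T by (auto simp: tree_order_def)
  have parm: "par j < m" if "j \<in> {1..<m}" for j
    using par[OF that] that by (meson atLeastLessThan_iff less_trans)
  have inj: "inj_on f {..<m}" using f by (simp add: rainbow_copy_def)
  have ied: "inj_on ed {1..<m}" using inj_on_parent_edge[OF inj par] by (simp add: ed_def[abs_def])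
  define h where "h = g \<circ> inv_into {..<m} f"
  have hf: "h (f j) = g j" if "j < m" for j using inj that by (simp add: h_def)
  have "simple_graph H"
    unfolding simple_graph_def
  proof (intro conjI ballI)
    fix e assume "e \<in> edges H"
    then obtain j where j: "j \<in> {1..<m}" "e = {f j, f (par j)}" by (auto simp: H_def ed_def)
    then have "f j \<noteq> f (par j)" using inj_onD[OF inj, of j "par j"] par[OF j(1)] parm[OF j(1)] by auto
    then show "card e = 2" "e \<subseteq> verts H" using j parm[OF j(1)] by (auto simp: H_def)
  qed (simp add: H_def)
  moreover have "verts H \<subseteq> V" using f by (simp add: H_def rainbow_copy_def)
  moreover have "\<exists>\<psi>'. inj_on \<psi>' (edges H) \<and> \<psi>' ` edges H \<subseteq> {1..k} \<and> (\<forall>e\<in>edges H. e \<in> edges (G (\<psi>' e)))"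
  proof (intro exI[of _ "\<psi> \<circ> inv_into {1..<m} ed"] conjI)
    have inv: "inv_into {1..<m} ed (ed j) = j" if "j \<in> {1..<m}" for j using ied that by simp
    have "inj_on \<psi> {1..<m}" using f by (simp add: rainbow_copy_def)
    then show "inj_on (\<psi> \<circ> inv_into {1..<m} ed) (edges H)"
      unfolding H_def inj_on_def by (auto simp: inv simp del: atLeastLessThan_iff One_nat_def)
    from inv show "(\<psi> \<circ> inv_into {1..<m} ed) ` edges H \<subseteq> {1..k}"
      "\<forall>e\<in>edges H. e \<in> edges (G ((\<psi> \<circ> inv_into {1..<m} ed) e))"
      using f by (auto simp: H_def rainbow_copy_def ed_def simp del: atLeastLessThan_iff One_nat_def)
  qed
  moreover have "graph_iso H T"
    unfolding graph_iso_def
  proof (intro exI[of _ h] conjI)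
    show "bij_betw h (verts H) (verts T)"
      unfolding h_def using g inj by (auto simp: H_def intro: bij_betw_trans bij_betw_inv_into inj_on_imp_bij_betw)
    have "h ` ed j = {g j, g (par j)}" if "j \<in> {1..<m}" for j
      using that parm[OF that] hf by (simp add: ed_def)
    then show "(\<lambda>e. h ` e) ` edges H = edges T"
      unfolding eT H_def by (force simp: image_image simp del: atLeastLessThan_iff One_nat_def intro!: image_cong)
  qed
  ultimately show ?thesis unfolding rainbow_free_def rainbow_subgraph_def by blast
qed

lemma not_free_imp_rainbow_copy:
  assumes T: "tree_order m par g T" and "\<not> rainbow_free k V G T"
  shows "\<exists>f \<psi>. rainbow_copy m par k V G f \<psi>"
proof -
  have par: "\<And>j. j \<in> {1..<m} \<Longrightarrow> par j < j" and g: "bij_betw g {..<m} (verts T)"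
    and eT: "edges T = (\<lambda>j. {g j, g (par j)}) ` {1..<m}"
    using T by (auto simp: tree_order_def)
  have parm: "par j < m" if "j \<in> {1..<m}" for j
    using par[OF that] that by (meson atLeastLessThan_iff less_trans)
  from assms(2) obtain H where H0: "rainbow_subgraph k V G H" "graph_iso H T"
    unfolding rainbow_free_def by blast
  obtain \<psi> where H: "simple_graph H" "verts H \<subseteq> V" "inj_on \<psi> (edges H)"
    "\<psi> ` edges H \<subseteq> {1..k}" "\<forall>e\<in>edges H. e \<in> edges (G (\<psi> e))"
    using H0(1) unfolding rainbow_subgraph_def by auto
  obtain h where h: "bij_betw h (verts H) (verts T)" "(\<lambda>e. h ` e) ` edges H = edges T"
    using H0(2) unfolding graph_iso_def by blast
  define f where "f = inv_into (verts H) h \<circ> g"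
  have f: "bij_betw f {..<m} (verts H)"
    unfolding f_def using g h by (intro bij_betw_trans[OF g] bij_betw_inv_into)
  have hf: "h (f j) = g j" if "j < m" for j
  proof -
    have "g j \<in> h ` verts H" using g h that by (auto simp: bij_betw_def)
    then show ?thesis by (simp add: f_def f_inv_into_f)
  qed
  have ed: "{f j, f (par j)} \<in> edges H" if j: "j \<in> {1..<m}" for j
  proof -
    have "{g j, g (par j)} \<in> (\<lambda>e. h ` e) ` edges H" using j unfolding h eT by blast
    then obtain e where e: "e \<in> edges H" "h ` e = {g j, g (par j)}" by auto
    have "e \<subseteq> verts H" using H(1) e by (auto simp: simple_graph_def)
    moreover have "{f j, f (par j)} \<subseteq> verts H" using f j parm[OF j] by (auto simp: bij_betw_def)
    moreover have "h ` e = h ` {f j, f (par j)}" using e(2) hf j parm[OF j] by simp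
    ultimately have "e = {f j, f (par j)}"
      using h(1) by (meson bij_betw_def inj_on_image_eq_iff)
    with e show ?thesis by simp
  qed
  have "rainbow_copy m par k V G f (\<lambda>j. \<psi> {f j, f (par j)})"
    unfolding rainbow_copy_def
  proof (intro conjI)
    show "inj_on f {..<m}" "f ` {..<m} \<subseteq> V" using f H(2) by (auto simp: bij_betw_def)
    then show "inj_on (\<lambda>j. \<psi> {f j, f (par j)}) {1..<m}"
      using comp_inj_on[OF inj_on_parent_edge[of f m par], of \<psi>] par inj_on_subset[OF H(3)] ed
      by (auto simp: comp_def image_subset_iff simp del: atLeastLessThan_iff One_nat_def)
    show "(\<lambda>j. \<psi> {f j, f (par j)}) ` {1..<m} \<subseteq> {1..k}"
      "\<forall>j\<in>{1..<m}. {f j, f (par j)} \<in> edges (G (\<psi> {f j, f (par j)}))"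
      using ed H by blast+
  qed
  then show ?thesis by blast
qed

text \<open>Only the colours must be distinct; tree vertices may share a part. Colours start at 0
  here, so colour \<open>i\<close> of a pattern corresponds to the graph with index
  \<open>i + 1\<close>.\<close>

definition rainbow_hom :: "nat \<Rightarrow> (nat \<Rightarrow> nat) \<Rightarrow> nat \<Rightarrow> nat \<Rightarrow> (nat \<Rightarrow> nat \<Rightarrow> nat \<Rightarrow> bool) \<Rightarrow> bool" where
  "rainbow_hom m par k M P \<longleftrightarrow> (\<exists>\<phi> \<psi>. (\<forall>j<m. \<phi> j < M) \<and> inj_on \<psi> {1..<m} \<and>
     (\<forall>j\<in>{1..<m}. \<psi> j < k \<and> P (\<psi> j) (\<phi> j) (\<phi> (par j))))"

text \<open>For \<open>M\<close> large enough the largest such \<open>t\<close> is the density. The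
  guard \<open>0 < t\<close> agrees with the convention that the empty supremum in
  \<open>rainbow_ex\<close> is 0.\<close>

definition attainable :: "nat \<Rightarrow> (nat \<Rightarrow> nat) \<Rightarrow> nat \<Rightarrow> nat \<Rightarrow> real \<Rightarrow> bool" where
  "attainable m par k M t \<longleftrightarrow> 0 \<le> t \<and> (\<exists>P x. (\<forall>i a b. P i a b \<longrightarrow> P i b a) \<and>
     (0 < t \<longrightarrow> \<not> rainbow_hom m par k M P) \<and> (\<forall>a<M. 0 \<le> x a) \<and> sum x {..<M} \<le> 1 \<and>
     (\<forall>i<k. t \<le> pattern_weight M (P i) x))"

section \<open>The lower bound from blow-ups\<close>

lemma graph_system_simple:
  assumes "graph_system k V G" "i \<in> {1..k}"
  shows "finite V \<and> (\<forall>e\<in>edges (G i). e \<subseteq> V \<and> card e = 2)"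
proof -
  have "simple_graph (G i)" "verts (G i) = V" using assms by (simp_all add: graph_system_def)
  then show ?thesis by (simp add: simple_graph_def)
qed

text \<open>A crude bound suffices: it makes \<open>Sup\<close> an upper bound, and a maximum if the
  set is nonempty.\<close>

lemma min_card_edges_bound:
  assumes "k \<ge> 1"
  shows "{Min ((\<lambda>i. card (edges (G i))) ` {1..k}) | G :: nat \<Rightarrow> nat graph.
            graph_system k {1..n} G \<and> rainbow_free k {1..n} G T} \<subseteq> {..2 ^ n}"
proof clarify
  fix G :: "nat \<Rightarrow> nat graph" assume G: "graph_system k {1..n} G"
  have "edges (G 1) \<subseteq> Pow {1..n}" using graph_system_simple[OF G, of 1] assms by auto
  then have "card (edges (G 1)) \<le> 2 ^ n" using card_mono[of "Pow {1..n}"] by (simp add: card_Pow)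
  moreover have "Min ((\<lambda>i. card (edges (G i))) ` {1..k}) \<le> card (edges (G 1))"
    using assms by (intro Min_le) auto
  ultimately show "Min ((\<lambda>i. card (edges (G i))) ` {1..k}) \<le> 2 ^ n" by linarith
qed

lemma rainbow_ex_ge:
  assumes "graph_system k {1..n} G" "rainbow_free k {1..n} G T" "k \<ge> 1"
    and "\<And>i. i \<in> {1..k} \<Longrightarrow> c \<le> card (edges (G i))"
  shows "c \<le> rainbow_ex k n T"
proof -
  let ?X = "{Min ((\<lambda>i. card (edges (G i))) ` {1..k}) | G :: nat \<Rightarrow> nat graph.
            graph_system k {1..n} G \<and> rainbow_free k {1..n} G T}"
  have "bdd_above ?X"
    using min_card_edges_bound[OF assms(3)] by (rule bdd_above_mono[rotated]) simp
  then have "Min ((\<lambda>i. card (edges (G i))) ` {1..k}) \<le> rainbow_ex k n T"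
    unfolding rainbow_ex_def using assms by (intro cSup_upper) auto
  moreover have "c \<le> Min ((\<lambda>i. card (edges (G i))) ` {1..k})"
    using assms by (subst Min_ge_iff) auto
  ultimately show ?thesis by linarith
qed

text \<open>Rounding the part sizes down costs at most \<open>(x a + x b) * n\<close> for the parts
  \<open>a\<close> and \<open>b\<close>, in total at most \<open>2 * M * n\<close>; the diagonal
  pairs cost at most \<open>n\<close>.\<close>

lemma rainbow_ex_lower:
  assumes T: "tree_order m par g T" and "k \<ge> 1" "0 < M" and t: "attainable m par k M t"
  shows "t * (real n)\<^sup>2 - real (2 * M + 1) * real n \<le> 2 * real (rainbow_ex k n T)"
proof (cases "t = 0")
  case False
  then have "0 < t" using t by (simp add: attainable_def)
  then obtain P x where sym: "\<And>i a b. P i a b \<Longrightarrow> P i b a" and P: "\<not> rainbow_hom m par k M P"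
    and x: "\<And>a. a < M \<Longrightarrow> 0 \<le> x a" "sum x {..<M} \<le> 1"
    and tx: "\<And>i. i < k \<Longrightarrow> t \<le> pattern_weight M (P i) x"
    using t unfolding attainable_def by metis
  define c where "c a = nat \<lfloor>x a * n\<rfloor>" for a
  have c: "x a * n - 1 \<le> c a" "c a \<le> x a * n" if "a < M" for a
  proof -
    have "0 \<le> x a * n" using x(1)[OF that] by simp
    then have "real (c a) = of_int \<lfloor>x a * n\<rfloor>" unfolding c_def by simp
    then show "x a * n - 1 \<le> c a" "c a \<le> x a * n" by linarith+
  qed
  define s where "s a = sum c {..<a}" for a
  have s_mono: "s a \<le> s b" if "a \<le> b" for a b
    unfolding s_def using that by (intro sum_mono2) auto
  have "real (s M) \<le> (\<Sum>a<M. x a * n)" unfolding s_def of_nat_sum by (intro sum_mono c) auto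
  also have "\<dots> = sum x {..<M} * n" by (simp add: sum_distrib_right)
  also have "\<dots> \<le> 1 * real n" using x(2) by (intro mult_right_mono) auto
  finally have sM: "s M \<le> n" by simp
  \<comment> \<open>Consecutive intervals of the prescribed sizes; the vertices beyond
    \<open>s M\<close> stay isolated.\<close>
  define A where "A a = {s a<..s (Suc a)}" for a
  have A_sub: "A a \<subseteq> {1..n}" if "a < M" for a
    using s_mono[of "Suc a" M] sM that unfolding A_def by auto
  have A_card: "card (A a) = c a" for a unfolding A_def s_def by simp
  have A_disj: "a = b" if "u \<in> A a" "u \<in> A b" for a b u
  proof (rule ccontr)
    assume "a \<noteq> b"
    then have "Suc a \<le> b \<or> Suc b \<le> a" by linarith
    then show False using s_mono[of "Suc a" b] s_mono[of "Suc b" a] that unfolding A_def by auto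
  qed
  define E where "E i = {{u, v} | u v. u \<noteq> v \<and> (u, v) \<in> blowup M A (P (i - 1))}" for i :: nat
  define G where "G i = ({1..n}, E i)" for i
  have sys: "graph_system k {1..n} G"
    unfolding graph_system_def simple_graph_def G_def E_def blowup_def using A_sub by fastforce
  have E_D: "\<exists>a b. a < M \<and> b < M \<and> u \<in> A a \<and> v \<in> A b \<and> P (i - 1) a b" if "{u, v} \<in> E i" for u v i
  proof -
    from that obtain u' v' a b where "{u, v} = {u', v'}" "a < M" "b < M" "u' \<in> A a" "v' \<in> A b" "P (i - 1) a b"
      unfolding E_def blowup_def by blast
    moreover from this have "u = u' \<and> v = v' \<or> u = v' \<and> v = u'" by (simp add: doubleton_eq_iff)
    moreover have "P (i - 1) b a" using sym calculation by blast
    ultimately show ?thesis by blast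
  qed
  have free: "rainbow_free k {1..n} G T"
  proof (rule ccontr)
    assume "\<not> rainbow_free k {1..n} G T"
    then obtain f \<psi> where f: "rainbow_copy m par k {1..n} G f \<psi>"
      using not_free_imp_rainbow_copy[OF T] by blast
    \<comment> \<open>The default 0 matters only for the one-vertex tree: otherwise every vertex of
      the copy lies on an edge, hence in a part.\<close>
    define \<phi> where "\<phi> j = (if \<exists>a<M. f j \<in> A a then SOME a. a < M \<and> f j \<in> A a else 0)" for j
    have \<phi>: "\<phi> j = a" if "a < M" "f j \<in> A a" for a j
    proof -
      have "(SOME a. a < M \<and> f j \<in> A a) = a" using that A_disj by (intro some_equality) auto
      then show ?thesis using that unfolding \<phi>_def by auto
    qed
    have "rainbow_hom m par k M P"
      unfolding rainbow_hom_def
    proof (rule exI[of _ \<phi>], rule exI[of _ "\<lambda>j. \<psi> j - 1"], intro conjI allI impI ballI)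
      fix j
      show "\<phi> j < M"
      proof (cases "\<exists>a<M. f j \<in> A a")
        case False
        then show ?thesis using \<open>0 < M\<close> unfolding \<phi>_def by auto
      qed (use \<phi> in auto)
    next
      show "inj_on (\<lambda>j. \<psi> j - 1) {1..<m}"
      proof (rule inj_onI)
        fix i j assume ij: "i \<in> {1..<m}" "j \<in> {1..<m}" "\<psi> i - 1 = \<psi> j - 1"
        then have "\<psi> i \<in> {1..k}" "\<psi> j \<in> {1..k}" using f unfolding rainbow_copy_def by blast+
        then have "\<psi> i = \<psi> j" using ij(3) by auto
        then show "i = j" using f ij unfolding rainbow_copy_def by (auto dest: inj_onD)
      qed
    next
      fix j assume j: "j \<in> {1..<m}"
      then have "\<psi> j \<in> {1..k}" using f unfolding rainbow_copy_def by blast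
      then show "\<psi> j - 1 < k" by auto
      have "{f j, f (par j)} \<in> E (\<psi> j)" using f j unfolding rainbow_copy_def G_def by auto
      then show "P (\<psi> j - 1) (\<phi> j) (\<phi> (par j))" using E_D \<phi> by metis
    qed
    then show False using P by blast
  qed
  have edge_count: "t * (real n)\<^sup>2 - real (2 * M + 1) * real n \<le> 2 * real (card (E i))" if i: "i \<in> {1..k}" for i
  proof -
    let ?R = "blowup M A (P (i - 1))"
    have fin: "finite ?R" and cR: "card ?R = (\<Sum>a<M. \<Sum>b<M. of_bool (P (i - 1) a b) * (card (A a) * card (A b)))"
      using card_blowup[of M A "P (i - 1)"] A_disj by (auto simp: A_def)
    have "?R \<subseteq> {(u, v). {u, v} \<in> E i} \<union> (\<lambda>u. (u, u)) ` {1..n}"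
    proof clarify
      fix u v assume uv: "(u, v) \<in> ?R" "(u, v) \<notin> (\<lambda>u. (u, u)) ` {1..n}"
      have "u \<in> {1..n}" using uv(1) A_sub unfolding blowup_def by blast
      then have "u \<noteq> v" using uv(2) by blast
      then show "{u, v} \<in> E i" using uv(1) unfolding E_def by blast
    qed
    moreover have Ei: "e \<subseteq> {1..n} \<and> card e = 2" if "e \<in> E i" for e
      using graph_system_simple[OF sys i] that by (auto simp: G_def)
    moreover have "finite {(u, v). {u, v} \<in> E i}"
      by (rule finite_subset[of _ "{1..n} \<times> {1..n}"]) (use Ei in auto)
    ultimately have "card ?R \<le> card {(u, v). {u, v} \<in> E i} + card ((\<lambda>u. (u, u)) ` {1..n})"
      by (meson card_Un_le card_mono finite_Un finite_atLeastAtMost finite_imageI le_trans)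
    also have "card {(u, v). {u, v} \<in> E i} = 2 * card (E i)"
      using card_ordered_edges[of "{1..n}" "E i"] Ei by simp
    also have "card ((\<lambda>u. (u, u)) ` {1..n}) \<le> n" using card_image_le[of "{1..n}"] by simp
    finally have 1: "real (card ?R) \<le> 2 * real (card (E i)) + n" by linarith
    have "t * (real n)\<^sup>2 - 2 * M * n \<le> pattern_weight M (P (i - 1)) x * (real n)\<^sup>2 - 2 * M * n"
      using tx[of "i - 1"] i by (auto intro!: mult_right_mono)
    also have "\<dots> \<le> pattern_weight M (P (i - 1)) x * (real n)\<^sup>2 - 2 * M * n * sum x {..<M}"
      using x(2) by (simp add: mult_left_le)
    \<comment> \<open>The loss is distributed over the ordered pairs of parts so that it can be
      compared with the rounding error termwise.\<close>
    also have "2 * M * n * sum x {..<M} = (\<Sum>a<M. \<Sum>b<M. (x a + x b) * n)"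
      by (simp add: sum.distrib sum_distrib_left[symmetric] sum_distrib_right[symmetric] algebra_simps)
    also have "pattern_weight M (P (i - 1)) x * (real n)\<^sup>2 - \<dots>
        = (\<Sum>a<M. \<Sum>b<M. of_bool (P (i - 1) a b) * (x a * x b) * (real n)\<^sup>2 - (x a + x b) * n)"
      unfolding pattern_weight_def by (simp only: sum_subtractf sum_distrib_right)
    also have "\<dots> \<le> (\<Sum>a<M. \<Sum>b<M. of_bool (P (i - 1) a b) * (real (c a) * real (c b)))"
    proof (intro sum_mono)
      fix a b assume "a \<in> {..<M}" "b \<in> {..<M}"
      then have a: "a < M" and b: "b < M" by auto
      show "of_bool (P (i - 1) a b) * (x a * x b) * (real n)\<^sup>2 - (x a + x b) * n
          \<le> of_bool (P (i - 1) a b) * (real (c a) * real (c b))"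
      proof (cases "P (i - 1) a b")
        case True
        define p where "p = x a * n - c a"
        define q where "q = x b * n - c b"
        have pq: "0 \<le> p" "p \<le> 1" "0 \<le> q" "q \<le> 1" using c[OF a] c[OF b] unfolding p_def q_def by auto
        have eqs: "real (c a) = x a * n - p" "real (c b) = x b * n - q" unfolding p_def q_def by auto
        have "real (c a) * real (c b) = x a * x b * (real n)\<^sup>2 - p * (x b * n) - q * (x a * n) + p * q"
          unfolding eqs by (simp add: algebra_simps power2_eq_square)
        moreover have "p * (x b * n) \<le> x b * n" "q * (x a * n) \<le> x a * n" "0 \<le> p * q"
          using pq x(1)[OF a] x(1)[OF b] by (auto intro!: mult_left_le_one_le mult_nonneg_nonneg)
        ultimately show ?thesis using True by (simp add: algebra_simps)
      next
        case False
        then show ?thesis using x(1)[OF a] x(1)[OF b] by simp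
      qed
    qed
    also have "\<dots> = real (card ?R)" unfolding cR A_card by simp
    finally show ?thesis using 1 by (simp add: algebra_simps)
  qed
  define r where "r = t * (real n)\<^sup>2 - real (2 * M + 1) * real n"
  have "nat \<lceil>r / 2\<rceil> \<le> rainbow_ex k n T"
  proof (rule rainbow_ex_ge[OF sys free \<open>k \<ge> 1\<close>])
    fix i assume "i \<in> {1..k}"
    from edge_count[OF this] show "nat \<lceil>r / 2\<rceil> \<le> card (edges (G i))"
      unfolding r_def[symmetric] G_def by (simp add: nat_le_iff ceiling_le_iff)
  qed
  then show ?thesis unfolding r_def[symmetric] by linarith
next
  case True
  have "0 \<le> real (2 * M + 1) * real n" "0 \<le> 2 * real (rainbow_ex k n T)" by simp_all
  moreover have "t * (real n)\<^sup>2 = 0" using True by simp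
  ultimately show ?thesis by linarith
qed

section \<open>Vertex types\<close>

text \<open>Depth \<open>d + 1\<close> refines depth \<open>d\<close> by a set of pairs of a colour
  and a depth-\<open>d\<close> type; there are \<open>k * type_bound k d\<close> such pairs.\<close>

primrec type_bound :: "nat \<Rightarrow> nat \<Rightarrow> nat" where
  "type_bound k 0 = 1"
| "type_bound k (Suc d) = type_bound k d * 2 ^ (k * type_bound k d)"

text \<open>The depth-\<open>d\<close> type of a vertex records, for every colour \<open>i\<close> and every depth-\<open>d'\<close> type
  with \<open>d' < d\<close>, whether at least \<open>C\<close> neighbours in colour \<open>i\<close> have that type. It is coded by a
  number below \<open>type_bound k d\<close> whose residue modulo \<open>type_bound k d'\<close> is the depth-\<open>d'\<close> type.\<close>

primrec vtype :: "nat \<Rightarrow> 'v set \<Rightarrow> (nat \<Rightarrow> 'v set set) \<Rightarrow> nat \<Rightarrow> nat \<Rightarrow> 'v \<Rightarrow> nat" where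
  "vtype C V E k 0 v = 0"
| "vtype C V E k (Suc d) v = vtype C V E k d v + type_bound k d *
     set_encode {q. q < k * type_bound k d \<and>
       C \<le> card {w \<in> V. {v, w} \<in> E (q div type_bound k d) \<and> vtype C V E k d w = q mod type_bound k d}}"

lemma type_bound_pos: "0 < type_bound k d"
  by (induction d) auto

lemma type_bound_mono: "d \<le> d' \<Longrightarrow> type_bound k d \<le> type_bound k d'"
  by (rule lift_Suc_mono_le) auto

lemma set_encode_less: "A \<subseteq> {..<n} \<Longrightarrow> set_encode A < 2 ^ n"
proof -
  assume "A \<subseteq> {..<n}"
  then have "set_encode A \<le> (\<Sum>i<n. 2 ^ i)"
    unfolding set_encode_def by (intro sum_mono2) auto
  also have "\<dots> = 2 ^ n - 1" by (simp add: mask_eq_sum_exp_nat lessThan_def)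
  finally show ?thesis by (metis Suc_pred' le_imp_less_Suc zero_less_numeral zero_less_power)
qed

lemma vtype_less: "vtype C V E k d v < type_bound k d"
proof (induction d)
  case (Suc d)
  let ?T = "type_bound k d"
  let ?S = "{q. q < k * ?T \<and> C \<le> card {w \<in> V. {v, w} \<in> E (q div ?T) \<and> vtype C V E k d w = q mod ?T}}"
  have "set_encode ?S < 2 ^ (k * ?T)" by (rule set_encode_less) auto
  then have "?T * (set_encode ?S + 1) \<le> ?T * 2 ^ (k * ?T)" by (intro mult_le_mono) auto
  with Suc show ?case by simp
qed simp

text \<open>Residue and quotient modulo \<open>type_bound k d\<close> recover the shallower type and
  the set of frequent pairs, where colour \<open>i\<close> with type \<open>s\<close> is the number
  \<open>i * type_bound k d + s\<close>.\<close>

lemma vtype_Suc_eqD: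
  assumes "vtype C V E k (Suc d) u = vtype C V E k (Suc d) v"
  shows "vtype C V E k d u = vtype C V E k d v"
    and "\<lbrakk>i < k; s < type_bound k d\<rbrakk> \<Longrightarrow>
      C \<le> card {w \<in> V. {u, w} \<in> E i \<and> vtype C V E k d w = s} \<longleftrightarrow>
      C \<le> card {w \<in> V. {v, w} \<in> E i \<and> vtype C V E k d w = s}"
proof -
  let ?T = "type_bound k d"
  let ?S = "\<lambda>v. {q. q < k * ?T \<and> C \<le> card {w \<in> V. {v, w} \<in> E (q div ?T) \<and> vtype C V E k d w = q mod ?T}}"
  have eq: "vtype C V E k d u + ?T * set_encode (?S u) = vtype C V E k d v + ?T * set_encode (?S v)"
    using assms by simp
  have less: "vtype C V E k d u < ?T" "vtype C V E k d v < ?T" by (rule vtype_less)+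
  from arg_cong[OF eq, of "\<lambda>z. z mod ?T"] less
  show d: "vtype C V E k d u = vtype C V E k d v" by simp
  have "set_encode (?S u) = set_encode (?S v)"
    using eq d type_bound_pos[of k d] by simp
  then have S: "?S u = ?S v"
    by (subst (asm) set_encode_eq) auto
  assume i: "i < k" and s: "s < ?T"
  have "i * ?T + s < Suc i * ?T" using s by simp
  also have "\<dots> \<le> k * ?T" using i by (intro mult_le_mono1) simp
  finally have "i * ?T + s < k * ?T" .
  moreover have "(i * ?T + s) div ?T = i" "(i * ?T + s) mod ?T = s" using s by auto
  ultimately have "i * ?T + s \<in> ?S v \<longleftrightarrow> C \<le> card {w \<in> V. {v, w} \<in> E i \<and> vtype C V E k d w = s}" for v
    by simp
  with S show "C \<le> card {w \<in> V. {u, w} \<in> E i \<and> vtype C V E k d w = s} \<longleftrightarrow>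
      C \<le> card {w \<in> V. {v, w} \<in> E i \<and> vtype C V E k d w = s}" by blast
qed

lemma vtype_eq_le:
  assumes "vtype C V E k D u = vtype C V E k D v" "d \<le> D"
  shows "vtype C V E k d u = vtype C V E k d v"
  using assms(2,1) by (induction D rule: dec_induct) (use vtype_Suc_eqD(1) in metis)+

section \<open>Frequent types and retained edges\<close>

definition frequent :: "nat \<Rightarrow> 'v set \<Rightarrow> (nat \<Rightarrow> 'v set set) \<Rightarrow> nat \<Rightarrow> nat \<Rightarrow> nat \<Rightarrow> 'v \<Rightarrow> nat \<Rightarrow> bool" where
  "frequent C V E k i d v s \<longleftrightarrow> C \<le> card {w \<in> V. {v, w} \<in> E i \<and> vtype C V E k d w = s}"

text \<open>All depths below \<open>D\<close> are required because the embedding uses depth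
  \<open>D - r\<close> when it places tree vertex \<open>r\<close>.\<close>

definition retained :: "nat \<Rightarrow> 'v set \<Rightarrow> (nat \<Rightarrow> 'v set set) \<Rightarrow> nat \<Rightarrow> nat \<Rightarrow> nat \<Rightarrow> 'v \<Rightarrow> 'v \<Rightarrow> bool" where
  "retained C V E k D i u v \<longleftrightarrow> {u, v} \<in> E i \<and> u \<in> V \<and> v \<in> V \<and>
     (\<forall>d<D. frequent C V E k i d u (vtype C V E k d v) \<and> frequent C V E k i d v (vtype C V E k d u))"

text \<open>A single witnessing edge is enough: for colours below \<open>k\<close>, being frequent
  at a depth below \<open>D\<close> depends only on the depth-\<open>D\<close> type, so it holds for
  the whole part.\<close>

definition type_pattern :: "nat \<Rightarrow> 'v set \<Rightarrow> (nat \<Rightarrow> 'v set set) \<Rightarrow> nat \<Rightarrow> nat \<Rightarrow> nat \<Rightarrow> nat \<Rightarrow> nat \<Rightarrow> bool" where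
  "type_pattern C V E k D i a b \<longleftrightarrow>
     (\<exists>u v. retained C V E k D i u v \<and> vtype C V E k D u = a \<and> vtype C V E k D v = b)"

lemma retained_sym: "retained C V E k D i u v \<Longrightarrow> retained C V E k D i v u"
  unfolding retained_def by (simp add: insert_commute)

lemma type_pattern_sym:
  assumes "type_pattern C V E k D i a b"
  shows "type_pattern C V E k D i b a"
proof -
  obtain u v where "retained C V E k D i u v" "vtype C V E k D u = a" "vtype C V E k D v = b"
    using assms unfolding type_pattern_def by auto
  then have "retained C V E k D i v u \<and> vtype C V E k D v = b \<and> vtype C V E k D u = a"
    by (simp add: retained_sym)
  then show ?thesis unfolding type_pattern_def by blast
qed

text \<open>Greedy embedding: vertex \<open>j\<close> of the tree is placed on a vertex whose depth-\<open>(D - j)\<close> type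
  is the truncation of the prescribed type, so that it still has \<open>m\<close> candidates for each child.\<close>

lemma rainbow_hom_type_pattern_imp_copy:
  fixes m :: nat
  assumes hom: "rainbow_hom m par k M (type_pattern m V E k D)"
    and par: "\<And>j. j \<in> {1..<m} \<Longrightarrow> par j < j" and "0 < m" "m \<le> D" "V \<noteq> {}" "finite V"
  shows "\<exists>f \<psi>. inj_on f {..<m} \<and> f ` {..<m} \<subseteq> V \<and> inj_on \<psi> {1..<m} \<and>
    (\<forall>j\<in>{1..<m}. \<psi> j < k \<and> {f j, f (par j)} \<in> E (\<psi> j))"
proof -
  let ?t = "vtype m V E k"
  obtain \<phi> \<psi> where \<psi>: "inj_on \<psi> {1..<m}" "\<And>j. j \<in> {1..<m} \<Longrightarrow> \<psi> j < k"
    and P: "\<And>j. j \<in> {1..<m} \<Longrightarrow> type_pattern m V E k D (\<psi> j) (\<phi> j) (\<phi> (par j))"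
    using hom unfolding rainbow_hom_def by blast
  have "\<exists>f. inj_on f {..<r} \<and> f ` {..<r} \<subseteq> V \<and> (\<forall>j\<in>{1..<r}. {f j, f (par j)} \<in> E (\<psi> j)) \<and>
      (\<forall>j<r. \<forall>u\<in>V. ?t D u = \<phi> j \<longrightarrow> ?t (D - j) (f j) = ?t (D - j) u)" if "1 \<le> r" "r \<le> m" for r
    using that
  proof (induction r rule: dec_induct)
    case base
    \<comment> \<open>If no vertex has type \<open>\<phi> 0\<close>, any vertex will do. This can
      only happen for \<open>m = 1\<close>, as otherwise vertex 0 is the parent of vertex 1.\<close>
    have "\<exists>u0\<in>V. \<forall>u\<in>V. ?t D u = \<phi> 0 \<longrightarrow> ?t D u0 = ?t D u"
      using \<open>V \<noteq> {}\<close> by (cases "\<exists>u0\<in>V. ?t D u0 = \<phi> 0") auto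
    then obtain u0 where "u0 \<in> V" "\<forall>u\<in>V. ?t D u = \<phi> 0 \<longrightarrow> ?t D u0 = ?t D u" by blast
    then show ?case by (intro exI[of _ "\<lambda>_. u0"]) (auto simp: inj_on_def)
  next
    case (step r)
    then obtain f where f: "inj_on f {..<r}" "f ` {..<r} \<subseteq> V"
      "\<forall>j\<in>{1..<r}. {f j, f (par j)} \<in> E (\<psi> j)"
      "\<And>j u. \<lbrakk>j < r; u \<in> V; ?t D u = \<phi> j\<rbrakk> \<Longrightarrow> ?t (D - j) (f j) = ?t (D - j) u"
      by auto
    have r: "r \<in> {1..<m}" using step by auto
    let ?i = "\<psi> r" and ?p = "par r" and ?d = "D - r"
    have p: "?p < r" by (rule par[OF r])
    obtain u v where uv: "retained m V E k D ?i u v" "?t D u = \<phi> r" "?t D v = \<phi> ?p"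
      using P[OF r] unfolding type_pattern_def by blast
    then have "u \<in> V" "v \<in> V" unfolding retained_def by auto
    have "?d < D" using r \<open>m \<le> D\<close> by auto
    then have freq: "frequent m V E k ?i ?d v (?t ?d u)"
      using uv(1) unfolding retained_def by blast
    \<comment> \<open>The parent's image agrees with \<open>v\<close> to depth
      \<open>D - par r\<close>, at least \<open>D - r + 1\<close> since \<open>par r < r\<close>.
      The extra level decides what is frequent at depth \<open>D - r\<close>.\<close>
    have "?t (D - ?p) (f ?p) = ?t (D - ?p) v" by (rule f(4)[OF p \<open>v \<in> V\<close> uv(3)])
    then have "?t (Suc ?d) (f ?p) = ?t (Suc ?d) v"
      by (rule vtype_eq_le) (use p r \<open>m \<le> D\<close> in auto)
    from vtype_Suc_eqD(2)[OF this \<psi>(2)[OF r] vtype_less[of m V E k ?d u]] freq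
    have "m \<le> card {w \<in> V. {f ?p, w} \<in> E ?i \<and> ?t ?d w = ?t ?d u}"
      unfolding frequent_def by simp
    \<comment> \<open>With threshold \<open>m\<close>, the \<open>r < m\<close> vertices already
      placed cannot exhaust the candidates.\<close>
    moreover have "card (f ` {..<r}) < m"
      using r card_image_le[of "{..<r}" f] by auto
    ultimately have "\<not> {w \<in> V. {f ?p, w} \<in> E ?i \<and> ?t ?d w = ?t ?d u} \<subseteq> f ` {..<r}"
      using card_mono[of "f ` {..<r}"] by (meson finite_imageI finite_lessThan leD le_trans)
    then obtain w where w: "w \<in> V" "{f ?p, w} \<in> E ?i" "?t ?d w = ?t ?d u" "w \<notin> f ` {..<r}"
      by blast
    show ?case
    proof (intro exI[of _ "f(r := w)"] conjI allI impI ballI)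
      show "inj_on (f(r := w)) {..<Suc r}"
        using f(1) w(4) by (auto simp: lessThan_Suc inj_on_fun_updI)
      show "(f(r := w)) ` {..<Suc r} \<subseteq> V" using f(2) w(1) by (auto simp: lessThan_Suc)
    next
      fix j assume j: "j \<in> {1..<Suc r}"
      have "par j < r" "j < m" using j par[of j] r by (auto simp: less_Suc_eq)
      then show "{(f(r := w)) j, (f(r := w)) (par j)} \<in> E (\<psi> j)"
        using w(2) f(3) j by (cases "j = r") (auto simp: insert_commute)
    next
      fix j u' assume j: "j < Suc r" "u' \<in> V" "?t D u' = \<phi> j"
      show "?t (D - j) ((f(r := w)) j) = ?t (D - j) u'"
      proof (cases "j = r")
        case True
        then have "?t D u' = ?t D u" using j uv by simp
        from vtype_eq_le[OF this, of ?d] show ?thesis using w(3) True by simp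
      qed (use j f(4) in auto)
    qed
  qed
  from this[of m] \<open>0 < m\<close> obtain f where "inj_on f {..<m}" "f ` {..<m} \<subseteq> V"
    "\<forall>j\<in>{1..<m}. {f j, f (par j)} \<in> E (\<psi> j)" by auto
  with \<psi> show ?thesis by blast
qed

text \<open>An edge is lost if at some depth the type of one end is infrequent at the other. A
  vertex has at most \<open>C\<close> neighbours of each infrequent type; the factors
  \<open>D\<close>, \<open>type_bound k D\<close> and 2 count the depths, the types and the choice
  of the end.\<close>

lemma card_not_retained:
  assumes "finite V" and E: "\<And>e. e \<in> E i \<Longrightarrow> e \<subseteq> V"
  shows "card {(u, v). {u, v} \<in> E i \<and> \<not> retained C V E k D i u v}
    \<le> 2 * (D * (card V * (type_bound k D * C)))"
proof -
  let ?t = "vtype C V E k" and ?T = "type_bound k D"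
  define B where "B d = (\<Union>v\<in>V. \<Union>s<?T. (\<lambda>u. (v, u)) `
    {u \<in> V. {v, u} \<in> E i \<and> ?t d u = s \<and> \<not> frequent C V E k i d v s})" for d
  have inner: "card ((\<lambda>u. (v, u)) ` {u \<in> V. {v, u} \<in> E i \<and> ?t d u = s \<and> \<not> frequent C V E k i d v s}) \<le> C" for v d s
  proof (cases "frequent C V E k i d v s")
    case False
    then have "card {u \<in> V. {v, u} \<in> E i \<and> ?t d u = s} \<le> C" unfolding frequent_def by simp
    moreover have "card ((\<lambda>u. (v, u)) ` {u \<in> V. {v, u} \<in> E i \<and> ?t d u = s \<and> \<not> frequent C V E k i d v s})
        \<le> card {u \<in> V. {v, u} \<in> E i \<and> ?t d u = s}"
      using False card_image_le[of "{u \<in> V. {v, u} \<in> E i \<and> ?t d u = s}" "\<lambda>u. (v, u)"] assms(1) by simp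
    ultimately show ?thesis by linarith
  qed simp
  have B_card: "card (B d) \<le> card V * (?T * C)" for d
  proof -
    have "card (B d) \<le> (\<Sum>v\<in>V. card (\<Union>s<?T. (\<lambda>u. (v, u)) `
        {u \<in> V. {v, u} \<in> E i \<and> ?t d u = s \<and> \<not> frequent C V E k i d v s}))"
      unfolding B_def by (rule card_UN_le[OF assms(1)])
    also have "\<dots> \<le> (\<Sum>v\<in>V. \<Sum>s<?T. card ((\<lambda>u. (v, u)) `
        {u \<in> V. {v, u} \<in> E i \<and> ?t d u = s \<and> \<not> frequent C V E k i d v s}))"
      by (intro sum_mono card_UN_le) simp
    also have "\<dots> \<le> (\<Sum>v\<in>V. \<Sum>s<?T. C)" by (intro sum_mono inner)
    finally show ?thesis by simp
  qed
  have B_fin: "finite (B d)" for d unfolding B_def using assms(1) by auto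
  have B_swap: "card (prod.swap ` B d) \<le> card V * (?T * C)" for d
    using card_image_le[OF B_fin[of d], of prod.swap] B_card[of d] by linarith
  have B_I: "(v, u) \<in> B d" if "{v, u} \<in> E i" "u \<in> V" "v \<in> V" "d < D" "\<not> frequent C V E k i d v (?t d u)" for u v d
  proof -
    have "?t d u < ?T"
      using vtype_less[of C V E k d u] type_bound_mono[of d D k] that by linarith
    with that show ?thesis unfolding B_def by blast
  qed
  have "{(u, v). {u, v} \<in> E i \<and> \<not> retained C V E k D i u v} \<subseteq> (\<Union>d<D. B d \<union> prod.swap ` B d)"
  proof clarify
    fix u v assume uv: "{u, v} \<in> E i" "\<not> retained C V E k D i u v"
    have V: "u \<in> V" "v \<in> V" using E[OF uv(1)] by auto
    then obtain d where d: "d < D" "\<not> frequent C V E k i d u (?t d v) \<or> \<not> frequent C V E k i d v (?t d u)"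
      using uv unfolding retained_def by blast
    then have "(u, v) \<in> B d \<or> (v, u) \<in> B d"
      using B_I[of u v d] B_I[of v u d] uv V by (auto simp: insert_commute)
    then have "(u, v) \<in> B d \<union> prod.swap ` B d" by force
    then show "(u, v) \<in> (\<Union>d<D. B d \<union> prod.swap ` B d)" using d(1) by blast
  qed
  then have "card {(u, v). {u, v} \<in> E i \<and> \<not> retained C V E k D i u v}
      \<le> card (\<Union>d<D. B d \<union> prod.swap ` B d)"
    by (rule card_mono[rotated]) (use B_fin in auto)
  also have "\<dots> \<le> (\<Sum>d<D. card (B d \<union> prod.swap ` B d))" by (rule card_UN_le) simp
  also have "\<dots> \<le> (\<Sum>d<D. card V * (?T * C) + card V * (?T * C))"
  proof (rule sum_mono)
    fix d
    show "card (B d \<union> prod.swap ` B d) \<le> card V * (?T * C) + card V * (?T * C)"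
      using card_Un_le[of "B d" "prod.swap ` B d"] B_card[of d] B_swap[of d] by linarith
  qed
  finally show ?thesis by (simp add: algebra_simps)
qed

section \<open>The upper bound and the limit\<close>

lemma rainbow_ex_attained:
  assumes "k \<ge> 1"
  shows "rainbow_ex k n T = 0 \<or> (\<exists>G. graph_system k {1..n} G \<and> rainbow_free k {1..n} G T \<and>
    rainbow_ex k n T = Min ((\<lambda>i. card (edges (G i))) ` {1..k}))"
proof -
  let ?X = "{Min ((\<lambda>i. card (edges (G i))) ` {1..k}) | G :: nat \<Rightarrow> nat graph.
            graph_system k {1..n} G \<and> rainbow_free k {1..n} G T}"
  have "?X \<subseteq> {..2 ^ n}" by (rule min_card_edges_bound[OF assms])
  then have fin: "finite ?X" by (rule finite_subset) simp
  show ?thesis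
  proof (cases "?X = {}")
    case True
    then show ?thesis unfolding rainbow_ex_def by (simp add: Sup_nat_def)
  next
    case False
    have "Sup ?X = Max ?X" by (rule cSup_eq_Max[OF fin False])
    then have "Sup ?X \<in> ?X" using Max_in[OF fin False] by (simp only:)
    then show ?thesis unfolding rainbow_ex_def by blast
  qed
qed

lemma pattern_weight_nonneg: "(\<And>a. a < M \<Longrightarrow> 0 \<le> x a) \<Longrightarrow> 0 \<le> pattern_weight M P x"
  unfolding pattern_weight_def by (intro sum_nonneg) simp

lemma attainable_0: "attainable m par k M 0"
  unfolding attainable_def
  by (intro conjI exI[of _ "\<lambda>_ _ _. False"] exI[of _ "\<lambda>_. 0 :: real"]) (auto intro: pattern_weight_nonneg)

text \<open>The pattern consists of the types in an extremal system, weighted by their frequencies;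
  parts from \<open>type_bound k D\<close> on are empty. The value \<open>t\<close> depends on
  \<open>n\<close>, and only the maximum over all attainable values removes this dependence.\<close>

lemma rainbow_ex_upper:
  assumes T: "tree_order m par g T" and "k \<ge> 1" "m \<le> D" "type_bound k D \<le> M" "n \<ge> 1"
  shows "\<exists>t. attainable m par k M t \<and>
    2 * real (rainbow_ex k n T) \<le> t * (real n)\<^sup>2 + real (2 * D * type_bound k D * m) * real n"
  using rainbow_ex_attained[OF \<open>k \<ge> 1\<close>, of n T]
proof (elim disjE exE conjE)
  assume "rainbow_ex k n T = 0"
  then show ?thesis by (intro exI[of _ 0]) (simp add: attainable_0)
next
  fix G assume sys: "graph_system k {1..n} G" and free: "rainbow_free k {1..n} G T"
    and ex: "rainbow_ex k n T = Min ((\<lambda>i. card (edges (G i))) ` {1..k})"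
  let ?V = "{1..n}"
  define E where "E i = edges (G (Suc i))" for i
  have Ei: "e \<subseteq> ?V \<and> card e = 2" if "e \<in> E i" "i < k" for e i
    using graph_system_simple[OF sys, of "Suc i"] that by (auto simp: E_def)
  define P where "P = type_pattern m ?V E k D"
  define A where "A a = {v \<in> ?V. vtype m ?V E k D v = a}" for a
  define x where "x a = real (card (A a)) / n" for a
  have par: "\<And>j. j \<in> {1..<m} \<Longrightarrow> par j < j" and "0 < m" using T by (auto simp: tree_order_def)
  have hom: "\<not> rainbow_hom m par k M P"
  proof
    assume "rainbow_hom m par k M P"
    then have "\<exists>f \<psi>. inj_on f {..<m} \<and> f ` {..<m} \<subseteq> ?V \<and> inj_on \<psi> {1..<m} \<and>
      (\<forall>j\<in>{1..<m}. \<psi> j < k \<and> {f j, f (par j)} \<in> E (\<psi> j))"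
      unfolding P_def
      by (rule rainbow_hom_type_pattern_imp_copy) (use par \<open>0 < m\<close> assms in auto)
    then obtain f \<psi> where f: "inj_on f {..<m}" "f ` {..<m} \<subseteq> ?V" and \<psi>: "inj_on \<psi> {1..<m}"
      "\<forall>j\<in>{1..<m}. \<psi> j < k \<and> {f j, f (par j)} \<in> E (\<psi> j)"
      by (elim exE conjE)
    then have "rainbow_copy m par k ?V G f (\<lambda>j. Suc (\<psi> j))"
      unfolding rainbow_copy_def
    proof (intro conjI f)
      show "inj_on (\<lambda>j. Suc (\<psi> j)) {1..<m}" using \<psi>(1) by (simp add: inj_on_def)
      show "(\<lambda>j. Suc (\<psi> j)) ` {1..<m} \<subseteq> {1..k}"
      proof clarify
        fix j assume "j \<in> {1..<m}"
        with \<psi>(2) have "\<psi> j < k" by blast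
        then show "Suc (\<psi> j) \<in> {1..k}" by simp
      qed
      show "\<forall>j\<in>{1..<m}. {f j, f (par j)} \<in> edges (G (Suc (\<psi> j)))"
        using \<psi>(2) unfolding E_def by blast
    qed
    from rainbow_copy_imp_not_free[OF T this] free show False by blast
  qed
  have A_disj: "\<And>a b u. \<lbrakk>u \<in> A a; u \<in> A b\<rbrakk> \<Longrightarrow> a = b" unfolding A_def by auto
  have "(\<Sum>a<M. card (A a)) = card (\<Union>a<M. A a)"
    by (rule card_UN_disjoint[symmetric]) (auto simp: A_def)
  also have "\<dots> \<le> card ?V" by (intro card_mono) (auto simp: A_def)
  finally have "(\<Sum>a<M. card (A a)) \<le> n" by simp
  then have "real (\<Sum>a<M. card (A a)) \<le> n" by (simp only: of_nat_le_iff)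
  then have x_sum: "sum x {..<M} \<le> 1"
    unfolding x_def sum_divide_distrib[symmetric] using \<open>n \<ge> 1\<close> by simp
  have count: "2 * real (card (E i)) \<le> pattern_weight M (P i) x * (real n)\<^sup>2 + real (2 * D * type_bound k D * m) * real n"
    if i: "i < k" for i
  proof -
    let ?B = "{(u, v). {u, v} \<in> E i \<and> \<not> retained m ?V E k D i u v}"
    have R: "finite (blowup M A (P i))"
      "card (blowup M A (P i)) = (\<Sum>a<M. \<Sum>b<M. of_bool (P i a b) * (card (A a) * card (A b)))"
      by (rule card_blowup; simp add: A_def)+
    have fin: "finite {(u, v). {u, v} \<in> E i}"
      by (rule finite_subset[of _ "?V \<times> ?V"]) (use Ei[OF _ i] in auto)
    have "{(u, v). {u, v} \<in> E i} \<subseteq> blowup M A (P i) \<union> ?B"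
    proof clarify
      fix u v assume uv: "{u, v} \<in> E i" "(u, v) \<notin> blowup M A (P i)" "retained m ?V E k D i u v"
      have "vtype m ?V E k D w < M" for w
        using vtype_less[of m ?V E k D w] assms(4) by linarith
      moreover have "u \<in> ?V" "v \<in> ?V" using uv(3) unfolding retained_def by auto
      moreover have "P i (vtype m ?V E k D u) (vtype m ?V E k D v)"
        using uv(3) unfolding P_def type_pattern_def by blast
      ultimately have "(u, v) \<in> blowup M A (P i)" unfolding blowup_def A_def by auto
      with uv(2) show False by blast
    qed
    then have "card {(u, v). {u, v} \<in> E i} \<le> card (blowup M A (P i) \<union> ?B)"
      by (rule card_mono[rotated]) (use R(1) finite_subset[OF _ fin, of ?B] in auto)
    also have "\<dots> \<le> card (blowup M A (P i)) + card ?B" by (rule card_Un_le)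
    also have "card ?B \<le> 2 * (D * (card ?V * (type_bound k D * m)))"
      by (rule card_not_retained) (use Ei[OF _ i] in auto)
    also have "card {(u, v). {u, v} \<in> E i} = 2 * card (E i)"
      by (rule card_ordered_edges[of ?V]) (use Ei[OF _ i] in auto)
    finally have "2 * card (E i) \<le> card (blowup M A (P i)) + 2 * D * type_bound k D * m * n"
      by (simp add: algebra_simps)
    then have "2 * real (card (E i)) \<le> real (card (blowup M A (P i))) + real (2 * D * type_bound k D * m) * n"
      by (metis (mono_tags, lifting) of_nat_add of_nat_le_iff of_nat_mult of_nat_numeral)
    also have "real (card (blowup M A (P i))) = pattern_weight M (P i) x * (real n)\<^sup>2"
      unfolding R(2) pattern_weight_def sum_distrib_right of_nat_sum
      by (intro sum.cong refl) (use \<open>n \<ge> 1\<close> in \<open>simp add: x_def power2_eq_square\<close>)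
    finally show ?thesis .
  qed
  define t where "t = Min ((\<lambda>i. pattern_weight M (P i) x) ` {..<k})"
  have "t \<in> (\<lambda>i. pattern_weight M (P i) x) ` {..<k}"
    unfolding t_def using \<open>k \<ge> 1\<close> by (intro Min_in) (auto simp: lessThan_empty_iff)
  then obtain i where i: "i < k" "t = pattern_weight M (P i) x" by auto
  have "attainable m par k M t"
    unfolding attainable_def
  proof (intro conjI)
    show "0 \<le> t" unfolding i(2) by (rule pattern_weight_nonneg) (simp add: x_def)
    show "\<exists>P x. (\<forall>i a b. P i a b \<longrightarrow> P i b a) \<and> (0 < t \<longrightarrow> \<not> rainbow_hom m par k M P) \<and>
       (\<forall>a<M. 0 \<le> x a) \<and> sum x {..<M} \<le> 1 \<and> (\<forall>i<k. t \<le> pattern_weight M (P i) x)"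
    proof (rule exI[of _ P], rule exI[of _ x], intro conjI)
      show "\<forall>i a b. P i a b \<longrightarrow> P i b a" unfolding P_def using type_pattern_sym by blast
      show "\<forall>i<k. t \<le> pattern_weight M (P i) x" unfolding t_def by (auto intro: Min_le)
    qed (use hom x_sum in \<open>auto simp: x_def\<close>)
  qed
  moreover have "rainbow_ex k n T \<le> card (E i)"
    unfolding ex E_def using i by (intro Min_le) auto
  then have "2 * real (rainbow_ex k n T) \<le> 2 * real (card (E i))" by simp
  ultimately show ?thesis using count[OF i(1)] i(2) by (intro exI[of _ t]) auto
qed

text \<open>\<open>D\<close> and \<open>M\<close> are arbitrary above their bounds, so maxima for
  different choices coincide as limits of one sequence. The main theorem uses this to compare depth
  \<open>m\<close> with depth \<open>c\<close>.\<close>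

lemma rainbow_ratio_tendsto:
  assumes T: "tree_order m par g T" and "k \<ge> 1" "m \<le> D" "type_bound k D \<le> M"
    and t: "attainable m par k M t" and max: "\<And>s. attainable m par k M s \<Longrightarrow> s \<le> t"
  shows "rainbow_ratio k T \<longlonglongrightarrow> t"
proof -
  have "0 < M" using type_bound_pos[of k D] assms(4) by linarith
  define K where "K = real (2 * D * type_bound k D * m) + real (2 * M + 1)"
  have bounds: "\<bar>rainbow_ratio k T n - t\<bar> \<le> (K + \<bar>t\<bar>) / real (n - 1)" if "n \<ge> 2" for n
  proof -
    have n1: "real (n - 1) = real n - 1" using that by (simp add: of_nat_diff)
    have "n choose 2 = n * (n - 1) div 2" by (rule choose_two)
    moreover have "even (n * (n - 1))" by (cases n) auto
    ultimately have "2 * (n choose 2) = n * (n - 1)" by simp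
    then have ch: "2 * real (n choose 2) = real n * (real n - 1)"
      unfolding n1[symmetric] by (metis of_nat_mult of_nat_numeral)
    let ?r = "real (rainbow_ex k n T)"
    have pos: "0 < real n * (real n - 1)" using that by simp
    have ratio: "rainbow_ratio k T n = 2 * ?r / (real n * (real n - 1))"
      unfolding rainbow_ratio_def ch[symmetric] by simp
    obtain s where s: "attainable m par k M s"
      "2 * ?r \<le> s * (real n)\<^sup>2 + real (2 * D * type_bound k D * m) * real n"
      using rainbow_ex_upper[OF T assms(2,3,4), of n] \<open>n \<ge> 2\<close> by auto
    have "s * (real n)\<^sup>2 \<le> t * (real n)\<^sup>2" using max[OF s(1)] by (intro mult_right_mono) auto
    moreover have "0 \<le> real (2 * D * type_bound k D * m) * real n" "0 \<le> real (2 * M + 1) * real n" by simp_all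
    ultimately have "2 * ?r \<le> t * (real n)\<^sup>2 + K * real n"
      using s(2) unfolding K_def distrib_right by linarith
    moreover have "t * (real n)\<^sup>2 - K * real n \<le> 2 * ?r"
      using rainbow_ex_lower[OF T assms(2) \<open>0 < M\<close> t, of n]
        \<open>0 \<le> real (2 * D * type_bound k D * m) * real n\<close> unfolding K_def distrib_right by linarith
    \<comment> \<open>Passing from \<open>n\<^sup>2\<close> to \<open>n * (n - 1)\<close>, twice the
      number of vertex pairs, costs a further \<open>\<bar>t\<bar> * n\<close>.\<close>
    moreover have "t * (real n)\<^sup>2 = t * (real n * (real n - 1)) + t * real n"
      by (simp add: algebra_simps power2_eq_square)
    moreover have "- \<bar>t\<bar> * real n \<le> t * real n" "t * real n \<le> \<bar>t\<bar> * real n" by (intro mult_right_mono; simp)+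
    ultimately have "\<bar>2 * ?r - t * (real n * (real n - 1))\<bar> \<le> (K + \<bar>t\<bar>) * real n"
      unfolding abs_le_iff by (simp add: algebra_simps)
    then have "\<bar>2 * ?r - t * (real n * (real n - 1))\<bar> / (real n * (real n - 1)) \<le> (K + \<bar>t\<bar>) * real n / (real n * (real n - 1))"
      using pos by (intro divide_right_mono) auto
    also have "\<dots> = (K + \<bar>t\<bar>) / real (n - 1)" using that n1 by simp
    also have "\<bar>2 * ?r - t * (real n * (real n - 1))\<bar> / (real n * (real n - 1))
        = \<bar>(2 * ?r - t * (real n * (real n - 1))) / (real n * (real n - 1))\<bar>"
      using pos by (simp add: abs_divide)
    also have "(2 * ?r - t * (real n * (real n - 1))) / (real n * (real n - 1)) = rainbow_ratio k T n - t"
      unfolding ratio diff_divide_distrib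
      using nonzero_mult_div_cancel_right[of "real n * (real n - 1)" t] pos that by auto
    finally show ?thesis .
  qed
  have "(\<lambda>n. (K + \<bar>t\<bar>) / real n) \<longlonglongrightarrow> 0" by (rule lim_const_over_n)
  then have "(\<lambda>n. (K + \<bar>t\<bar>) / real (Suc n - 1)) \<longlonglongrightarrow> 0" by simp
  then have "(\<lambda>n. (K + \<bar>t\<bar>) / real (n - 1)) \<longlonglongrightarrow> 0" by (rule LIMSEQ_imp_Suc)
  then have "(\<lambda>n. rainbow_ratio k T n - t) \<longlonglongrightarrow> 0"
  proof (rule tendsto_0_le)
    have "0 \<le> K" by (simp add: K_def)
    then have "norm (rainbow_ratio k T n - t) \<le> norm ((K + \<bar>t\<bar>) / real (n - 1)) * 1" if "n \<ge> 2" for n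
      using bounds[OF that] by simp
    then show "\<forall>\<^sub>F n in sequentially. norm (rainbow_ratio k T n - t) \<le> norm ((K + \<bar>t\<bar>) / real (n - 1)) * 1"
      unfolding eventually_sequentially by blast
  qed
  then show ?thesis by (simp add: LIM_zero_iff)
qed

section \<open>Ordering the vertices of a tree\<close>

definition path_in :: "'v set set \<Rightarrow> 'v set \<Rightarrow> 'v \<Rightarrow> 'v \<Rightarrow> 'v list \<Rightarrow> bool" where
  "path_in E S x y vs \<longleftrightarrow> vs \<noteq> [] \<and> hd vs = x \<and> last vs = y \<and> distinct vs \<and> set vs \<subseteq> S \<and>
     successively (\<lambda>u v. {u, v} \<in> E) vs"

text \<open>This rules out a second neighbour of a new vertex \<open>y\<close> in a connected part
  of a tree. Distinct ends give the path two vertices, so with \<open>y\<close> there are the three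
  that a cycle needs.\<close>

lemma path_in_closes_cycle:
  assumes vs: "path_in (edges T) S x x' vs" and "y \<notin> S" "x \<noteq> x'"
    and "{x, y} \<in> edges T" "{x', y} \<in> edges T"
  shows "is_cycle T (y # vs)"
proof -
  have ne: "vs \<noteq> []" "hd vs = x" "last vs = x'" "distinct vs" "set vs \<subseteq> S"
    and suc: "\<And>i. Suc i < length vs \<Longrightarrow> {vs ! i, vs ! Suc i} \<in> edges T"
    using vs by (auto simp: path_in_def successively_conv_nth)
  have len: "2 \<le> length vs"
  proof (rule ccontr)
    assume "\<not> 2 \<le> length vs"
    then have "length vs = 1" using ne(1) by (cases vs) (auto simp: Suc_le_eq)
    then have "hd vs = last vs" by (cases vs) auto
    then show False using ne assms(3) by simp
  qed
  show ?thesis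
    unfolding is_cycle_def
  proof (intro conjI allI impI)
    show "3 \<le> length (y # vs)" using len by simp
    show "distinct (y # vs)" using ne assms(2) by auto
    fix i assume i: "i < length (y # vs)"
    consider "i = 0" | "i = length vs" "0 < i" | j where "i = Suc j" "Suc j < length vs"
      using i ne(1) by (cases i) (auto simp: less_Suc_eq)
    then show "{(y # vs) ! i, (y # vs) ! (Suc i mod length (y # vs))} \<in> edges T"
    proof cases
      case 1
      then show ?thesis using ne len assms(4) by (simp add: hd_conv_nth insert_commute)
    next
      case 2
      then have "(y # vs) ! i = x'" using ne by (cases i) (auto simp: last_conv_nth)
      then show ?thesis using 2 assms(5) by simp
    next
      case 3
      then show ?thesis using suc[of j] by simp
    qed
  qed
qed

lemma connected_graph_crossing_edge:
  assumes "connected_graph T" "s \<in> S" "S \<subseteq> verts T" "S \<noteq> verts T"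
  obtains x y where "x \<in> S" "y \<notin> S" "{x, y} \<in> edges T"
proof -
  obtain v where v: "v \<in> verts T" "v \<notin> S" using assms by blast
  have "(s, v) \<in> {(x, y). {x, y} \<in> edges T}\<^sup>*"
    using assms v unfolding connected_graph_def by blast
  then have "\<exists>x\<in>S. \<exists>y. y \<notin> S \<and> {x, y} \<in> edges T"
    using \<open>v \<notin> S\<close>
  proof (induction rule: rtrancl_induct)
    case (step y z)
    then show ?case by (cases "y \<in> S") auto
  qed (use assms in auto)
  then show ?thesis using that by blast
qed

lemma is_tree_imp_tree_order:
  assumes "is_tree T"
  shows "\<exists>m par g. tree_order m par g T"
proof -
  let ?V = "verts T" and ?E = "edges T"
  have simple: "finite ?V" "\<And>e. e \<in> ?E \<Longrightarrow> e \<subseteq> ?V \<and> card e = 2"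
    and conn: "connected_graph T" and acyc: "\<nexists>vs. is_cycle T vs"
    using assms by (auto simp: is_tree_def simple_graph_def)
  obtain v where v: "v \<in> ?V" using conn unfolding connected_graph_def by blast
  have pos: "0 < card ?V" using v simple(1) by (auto simp: card_gt_0_iff)
  \<comment> \<open>The first \<open>r\<close> vertices induce exactly the parent edges. Paths
    inside the ordered set belong to the invariant because they close a cycle if the next vertex has
    two neighbours there.\<close>
  define ok where "ok r g par \<longleftrightarrow> inj_on g {..<r} \<and> g ` {..<r} \<subseteq> ?V \<and> (\<forall>j\<in>{1..<r}. par j < j) \<and>
      {e \<in> ?E. e \<subseteq> g ` {..<r}} = (\<lambda>j. {g j, g (par j)}) ` {1..<r} \<and>
      (\<forall>x\<in>g ` {..<r}. \<forall>y\<in>g ` {..<r}. \<exists>vs. path_in ?E (g ` {..<r}) x y vs)"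
    for r :: nat and g and par :: "nat \<Rightarrow> nat"
  have "\<exists>g par. ok r g par" if "1 \<le> r" "r \<le> card ?V" for r
    using that
  proof (induction r rule: dec_induct)
    case base
    have e: "{..<1::nat} = {0}" by auto
    have "path_in ?E {v} v v [v]" by (simp add: path_in_def)
    moreover have "{e \<in> ?E. e \<subseteq> {v}} = {}"
    proof -
      have False if "e \<in> ?E" "e \<subseteq> {v}" for e
        using card_mono[OF _ that(2)] simple(2)[OF that(1)] by simp
      then show ?thesis by blast
    qed
    ultimately show ?case
      unfolding ok_def
      using v by (intro exI[of _ "\<lambda>_. v"] exI[of _ "\<lambda>_::nat. 0::nat"]) (auto simp: e simp del: One_nat_def)
  next
    case (step r)
    then obtain g par where ok: "ok r g par" by auto
    note g = conjunct1[OF ok[unfolded ok_def]]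
      conjunct1[OF conjunct2[OF ok[unfolded ok_def]]]
      conjunct1[OF conjunct2[OF conjunct2[OF ok[unfolded ok_def]]]]
      conjunct1[OF conjunct2[OF conjunct2[OF conjunct2[OF ok[unfolded ok_def]]]]]
      conjunct2[OF conjunct2[OF conjunct2[OF conjunct2[OF ok[unfolded ok_def]]]]]
    define S where "S = g ` {..<r}"
    have "card S = r" unfolding S_def by (simp add: card_image[OF g(1)])
    then have "S \<noteq> ?V" using step by auto
    have "g 0 \<in> S" using step unfolding S_def by auto
    have "S \<subseteq> ?V" unfolding S_def by (rule g(2))
    obtain x y where xy: "x \<in> S" "y \<notin> S" "{x, y} \<in> ?E"
      by (rule connected_graph_crossing_edge[OF conn \<open>g 0 \<in> S\<close> \<open>S \<subseteq> ?V\<close> \<open>S \<noteq> ?V\<close>])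
    obtain p where p: "p < r" "x = g p" using xy(1) unfolding S_def by auto
    have "y \<in> ?V" using simple(2)[OF xy(3)] by auto
    have uniq: "z = x" if z: "z \<in> S" "{z, y} \<in> ?E" for z
    proof (rule ccontr)
      assume "z \<noteq> x"
      obtain vs where "path_in ?E S x z vs" using g(5) z(1) xy(1) unfolding S_def by blast
      from path_in_closes_cycle[OF this xy(2) _ xy(3) z(2)] \<open>z \<noteq> x\<close> acyc show False by blast
    qed
    define g' where "g' = g(r := y)"
    define par' where "par' = par(r := p)"
    have img: "g' ` {..<Suc r} = insert y S" unfolding g'_def S_def by (auto simp: lessThan_Suc)
    have edges_new: "{e \<in> ?E. e \<subseteq> insert y S} = insert {y, x} {e \<in> ?E. e \<subseteq> S}"
    proof (intro equalityI subsetI)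
      fix e assume e: "e \<in> {e \<in> ?E. e \<subseteq> insert y S}"
      show "e \<in> insert {y, x} {e \<in> ?E. e \<subseteq> S}"
      proof (cases "y \<in> e")
        case True
        obtain z where z: "e = {y, z}" "z \<noteq> y" using simple(2)[of e] e True by (auto simp: card_2_iff)
        then have "z = x" using uniq[of z] e by (auto simp: insert_commute)
        then show ?thesis using z by simp
      qed (use e in auto)
    qed (use xy in \<open>auto simp: insert_commute\<close>)
    have par'_lt: "par' j < j" if "j \<in> {1..<Suc r}" for j
      using that g(3) p unfolding par'_def by (auto simp: less_Suc_eq)
    have "(\<lambda>j. {g' j, g' (par' j)}) ` {1..<Suc r} = insert {y, x} ((\<lambda>j. {g' j, g' (par' j)}) ` {1..<r})"
    proof -
      have "{1..<Suc r} = insert r {1..<r}" using step by auto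
      moreover have "g' r = y" "g' (par' r) = x" using p unfolding g'_def par'_def by auto
      ultimately show ?thesis by (simp only: image_insert)
    qed
    also have "(\<lambda>j. {g' j, g' (par' j)}) ` {1..<r} = (\<lambda>j. {g j, g (par j)}) ` {1..<r}"
    proof (rule image_cong[OF refl])
      fix j assume j: "j \<in> {1..<r}"
      then have "par j < j" using g(3) by blast
      then show "{g' j, g' (par' j)} = {g j, g (par j)}" using j unfolding g'_def par'_def by auto
    qed
    also have "\<dots> = {e \<in> ?E. e \<subseteq> S}" unfolding S_def g(4) ..
    finally have edges_img: "{e \<in> ?E. e \<subseteq> g' ` {..<Suc r}} = (\<lambda>j. {g' j, g' (par' j)}) ` {1..<Suc r}"
      unfolding img edges_new by simp
    have paths: "\<exists>vs. path_in ?E (insert y S) u w vs" if uw: "u \<in> insert y S" "w \<in> insert y S" for u w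
    proof -
      have old: "\<exists>vs. path_in ?E S u w vs" if "u \<in> S" "w \<in> S" for u w
        using g(5) that unfolding S_def by blast
      consider "u = y" "w = y" | "u = y" "w \<in> S" | "u \<in> S" "w = y" | "u \<in> S" "w \<in> S" using uw by blast
      then show ?thesis
      proof cases
        case 1
        then have "path_in ?E (insert y S) u w [y]" by (simp add: path_in_def)
        then show ?thesis by blast
      next
        case 2
        obtain vs where "path_in ?E S x w vs" using old[OF xy(1) 2(2)] by blast
        then have "path_in ?E (insert y S) u w (y # vs)"
          using 2 xy unfolding path_in_def by (auto simp: successively_Cons insert_commute)
        then show ?thesis by blast
      next
        case 3
        obtain vs where "path_in ?E S u x vs" using old[OF 3(1) xy(1)] by blast
        then have "path_in ?E (insert y S) u w (vs @ [y])"
          using 3 xy unfolding path_in_def by (auto simp: successively_append_iff)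
        then show ?thesis by blast
      next
        case 4
        then obtain vs where "path_in ?E S u w vs" using old by blast
        then have "path_in ?E (insert y S) u w vs" unfolding path_in_def by auto
        then show ?thesis by blast
      qed
    qed
    have inj': "inj_on g' {..<Suc r}"
      using g(1) xy(2) unfolding g'_def S_def by (auto simp: lessThan_Suc inj_on_fun_updI)
    have "g' ` {..<Suc r} \<subseteq> ?V" using img g(2) \<open>y \<in> ?V\<close> unfolding S_def by auto
    with inj' par'_lt edges_img paths have "ok (Suc r) g' par'"
      unfolding ok_def img[symmetric] by blast
    then show ?case by blast
  qed
  from this[of "card ?V"] pos obtain g par where ok: "ok (card ?V) g par" by auto
  have g: "inj_on g {..<card ?V}" "g ` {..<card ?V} \<subseteq> ?V"
    "\<forall>j\<in>{1..<card ?V}. par j < (j::nat)"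
    "{e \<in> ?E. e \<subseteq> g ` {..<card ?V}} = (\<lambda>j. {g j, g (par j)}) ` {1..<card ?V}"
    using ok unfolding ok_def by simp_all
  have "g ` {..<card ?V} = ?V"
    by (rule card_subset_eq[OF simple(1) g(2)]) (simp add: card_image[OF g(1)])
  moreover have "{e \<in> ?E. e \<subseteq> ?V} = ?E" using simple(2) by blast
  then have "?E = (\<lambda>j. {g j, g (par j)}) ` {1..<card ?V}"
    using g(4) calculation by simp
  ultimately have "tree_order (card ?V) par g T"
    using g pos unfolding tree_order_def bij_betw_def by simp
  then show ?thesis by blast
qed

lemma tree_order_iso:
  assumes T: "tree_order m par g T" and "graph_iso T T'"
  shows "\<exists>g'. tree_order m par g' T'"
proof -
  obtain h where h: "bij_betw h (verts T) (verts T')" "(\<lambda>e. h ` e) ` edges T = edges T'"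
    using assms(2) unfolding graph_iso_def by blast
  have "edges T' = (\<lambda>j. {(h \<circ> g) j, (h \<circ> g) (par j)}) ` {1..<m}"
    using T unfolding h(2)[symmetric] by (simp add: tree_order_def image_image)
  then have "tree_order m par (h \<circ> g) T'"
    using T h(1) unfolding tree_order_def by (auto intro: bij_betw_trans)
  then show ?thesis by blast
qed

section \<open>The optimization problem\<close>

text \<open>Sum and product determine an unordered pair, as the roots of a quadratic. Both are
  monotone and computable without case distinction.\<close>

definition upair :: "nat \<Rightarrow> nat \<Rightarrow> nat" where
  "upair a b = prod_encode (a + b, a * b)"

lemma upair_commute: "upair a b = upair b a"
  by (simp add: upair_def ac_simps)

lemma upair_eq_iff: "upair a b = upair c d \<longleftrightarrow> a = c \<and> b = d \<or> a = d \<and> b = c"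
proof
  assume "upair a b = upair c d"
  then have *: "a + b = c + d" "a * b = c * d" by (auto simp: upair_def)
  then have i: "int b = int c + int d - int a" "int a * int b = int c * int d"
    by (auto simp flip: of_nat_mult)
  have "(int a - int c) * (int a - int d) = 0"
    using i(2) unfolding i(1) by (simp add: algebra_simps)
  then have "a = c \<or> a = d" by auto
  then show "a = c \<and> b = d \<or> a = d \<and> b = c" using *(1) by auto
qed (auto simp: upair_def ac_simps)

lemma prod_encode_mono: "a \<le> c \<Longrightarrow> b \<le> d \<Longrightarrow> prod_encode (a, b) \<le> prod_encode (c, d)"
  unfolding prod_encode_def triangle_def by (auto intro!: add_mono div_le_mono mult_le_mono)

lemma upair_mono: "a \<le> c \<Longrightarrow> b \<le> d \<Longrightarrow> upair a b \<le> upair c d"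
  unfolding upair_def by (intro prod_encode_mono add_mono mult_le_mono)

text \<open>Variables of the optimization problem: \<open>t\<close> has index \<open>0\<close>, the weight of part \<open>a\<close> has an odd
  index, and the density of colour \<open>i\<close> between the parts \<open>a\<close> and \<open>b\<close> has a positive even index.
  Using \<open>upair\<close> makes the densities symmetric in \<open>a\<close> and \<open>b\<close>.\<close>

definition var_x :: "nat \<Rightarrow> nat" where "var_x a = 2 * a + 1"
definition var_p :: "nat \<Rightarrow> nat \<Rightarrow> nat \<Rightarrow> nat" where "var_p i a b = 2 * prod_encode (i, upair a b) + 2"
definition num_vars :: "nat \<Rightarrow> nat" where "num_vars M = 2 * prod_encode (M, upair M M) + 3"

text \<open>Indices are monotone in colour and parts, so those at \<open>M\<close> bound them all;
  colours below \<open>k\<close> are covered when \<open>k \<le> M\<close>. The indices in between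
  that name nothing are still confined by the box constraints.\<close>

lemma var_less:
  "a < M \<Longrightarrow> var_x a < num_vars M"
  "\<lbrakk>i < M; a < M; b < M\<rbrakk> \<Longrightarrow> var_p i a b < num_vars M"
  "0 < num_vars M"
  using le_prod_encode_1[of M "upair M M"]
  by (auto simp: var_x_def var_p_def num_vars_def less_Suc_eq_le intro!: le_imp_less_Suc prod_encode_mono upair_mono)

lemma var_p_commute: "var_p i a b = var_p i b a"
  by (simp add: var_p_def upair_commute)

lemma var_p_eq_iff: "var_p i a b = var_p i' a' b' \<longleftrightarrow> i = i' \<and> (a = a' \<and> b = b' \<or> a = b' \<and> b = a')"
  by (simp add: var_p_def upair_eq_iff)

section \<open>Digit codes for homomorphisms and the constraints\<close>

definition digit :: "nat \<Rightarrow> nat \<Rightarrow> nat \<Rightarrow> nat" where "digit M j q = (j div M ^ q) mod M"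

lemma digit_less: "0 < M \<Longrightarrow> digit M j q < M"
  by (simp add: digit_def)

lemma exists_digits:
  assumes "\<And>q. q < B \<Longrightarrow> \<theta> q < M"
  shows "\<exists>j<M ^ B. \<forall>q<B. digit M j q = \<theta> q"
  using assms
proof (induction B)
  case (Suc B)
  then obtain j where j: "j < M ^ B" "\<And>q. q < B \<Longrightarrow> digit M j q = \<theta> q" by auto
  have M: "\<theta> B < M" using Suc.prems by simp
  let ?j = "j + \<theta> B * M ^ B"
  have "?j < (1 + \<theta> B) * M ^ B" using j(1) by simp
  also have "\<dots> \<le> M * M ^ B" using M by (intro mult_le_mono1) simp
  finally have "?j < M ^ Suc B" by simp
  moreover have "digit M ?j q = \<theta> q" if "q < Suc B" for q
  proof (cases "q = B")
    case True
    have "M ^ B \<noteq> 0" using j(1) by (cases "M ^ B = 0") auto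
    then have "?j div M ^ B = \<theta> B"
      using div_mult_self1[of "M ^ B" j "\<theta> B"] div_less[OF j(1)] by linarith
    then show ?thesis using True M by (simp add: digit_def)
  next
    case False
    then have q: "q < B" using that by simp
    \<comment> \<open>The new leading term is a multiple of \<open>M ^ (q + 1)\<close>, so it
      vanishes from digit \<open>q\<close> modulo \<open>M\<close>.\<close>
    have "\<theta> B * M ^ B = (\<theta> B * M ^ (B - Suc q) * M) * M ^ q"
      using q by (simp flip: power_add power_Suc add: mult.assoc power_commutes Suc_diff_Suc)
    then have "?j div M ^ q = (j + (\<theta> B * M ^ (B - Suc q) * M) * M ^ q) div M ^ q" by (simp only:)
    also have "\<dots> = \<theta> B * M ^ (B - Suc q) * M + j div M ^ q"
      by (rule div_mult_self1) (use M in auto)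
    finally have "?j div M ^ q = \<theta> B * M ^ (B - Suc q) * M + j div M ^ q" .
    then show ?thesis using j(2)[OF q] by (simp add: digit_def)
  qed
  ultimately show ?case by blast
qed auto

text \<open>A number \<open>j\<close> codes maps \<open>\<phi>\<close> from the tree vertices to parts and \<open>\<psi>\<close> from the tree edges
  to colours: the digits at even positions are the values of \<open>\<phi>\<close>, those at odd positions the
  values of \<open>\<psi>\<close>. The tree enters through the set \<open>Q\<close> of its directed edges, which need not be
  closed under reversal.\<close>

definition colouring_valid :: "nat \<Rightarrow> (nat \<Rightarrow> nat \<Rightarrow> bool) \<Rightarrow> nat \<Rightarrow> nat \<Rightarrow> bool" where
  "colouring_valid m Q M j \<longleftrightarrow> (\<forall>u<m. \<forall>v<m. \<forall>u'<m. \<forall>v'<m. \<not> (Q u v \<and> Q u' v' \<and> upair u v \<noteq> upair u' v' \<and>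
     digit M j (2 * upair u v + 1) = digit M j (2 * upair u' v' + 1)))"

definition hom_var :: "nat \<Rightarrow> (nat \<Rightarrow> nat \<Rightarrow> bool) \<Rightarrow> nat \<Rightarrow> nat \<Rightarrow> nat \<Rightarrow> bool" where
  "hom_var m Q M j w \<longleftrightarrow> (\<exists>u<m. \<exists>v<m. Q u v \<and>
     w = var_p (digit M j (2 * upair u v + 1)) (digit M j (2 * u)) (digit M j (2 * v)))"

text \<open>The largest digit position read is \<open>2 * upair u v + 1\<close> with
  \<open>u\<close> and \<open>v\<close> below \<open>m\<close>, so \<open>2 * upair m m + 2\<close>
  digits suffice.\<close>

definition num_codes :: "nat \<Rightarrow> nat \<Rightarrow> nat" where "num_codes M m = M ^ (2 * upair m m + 2)"

abbreviation unit_exps :: "nat \<Rightarrow> nat \<Rightarrow> nat list" where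
  "unit_exps M w \<equiv> map (\<lambda>v. of_bool (v = w)) [0..<num_vars M]"

text \<open>Here \<open>r\<close> runs over the ordered pairs of parts. Adding the indicators gives
  exponent 2 to the weight variable when both parts coincide.\<close>

definition weight_exps :: "nat \<Rightarrow> nat \<Rightarrow> nat \<Rightarrow> nat list" where
  "weight_exps M i r = map (\<lambda>v. of_bool (v = var_x (r div M)) + of_bool (v = var_x (r mod M)) +
     of_bool (v = var_p i (r div M) (r mod M))) [0..<num_vars M]"

text \<open>Exponents stay at 0 or 1 even for repeated variables: all variables are nonnegative, so
  the constraint only records whether some factor vanishes.\<close>

definition hom_exps :: "nat \<Rightarrow> (nat \<Rightarrow> nat \<Rightarrow> bool) \<Rightarrow> nat \<Rightarrow> nat \<Rightarrow> nat list" where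
  "hom_exps m Q M j = map (\<lambda>v. of_bool (v = 0 \<or> hom_var m Q M j v)) [0..<num_vars M]"

text \<open>Invalid codes get coefficient 0 instead of being filtered out, so that each block is a
  plain tabulation. The term \<open>(1, [])\<close> is the constant 1.\<close>

definition rainbow_constraints :: "nat \<Rightarrow> (nat \<Rightarrow> nat \<Rightarrow> bool) \<Rightarrow> nat \<Rightarrow> nat \<Rightarrow> int_mpoly list" where
  "rainbow_constraints m Q k M =
     map (\<lambda>w. [(1, unit_exps M w)]) [0..<num_vars M] @
     map (\<lambda>w. [(1, []), (- 1, unit_exps M w)]) [0..<num_vars M] @
     [(1, []) # map (\<lambda>a. (- 1, unit_exps M (var_x a))) [0..<M]] @
     map (\<lambda>i. (- 1, unit_exps M 0) # map (\<lambda>r. (1, weight_exps M i r)) [0..<M * M]) [0..<k] @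
     map (\<lambda>j. [(- of_bool (colouring_valid m Q M j), hom_exps m Q M j)]) [0..<num_codes M m]"

definition rainbow_problem :: "nat \<Rightarrow> (nat \<Rightarrow> nat \<Rightarrow> bool) \<Rightarrow> nat \<Rightarrow> nat \<Rightarrow> poly_problem" where
  "rainbow_problem m Q k M = (num_vars M, [(1, unit_exps M 0)], rainbow_constraints m Q k M)"

section \<open>Evaluating the constraints\<close>

lemma mpoly_eval_Nil: "mpoly_eval [] xs = 0"
  by (simp add: mpoly_eval_def)

lemma mpoly_eval_Cons:
  "mpoly_eval ((c, es) # p) xs = of_int c * prod_list (map2 (\<lambda>x e. x ^ e) xs es) + mpoly_eval p xs"
  by (simp add: mpoly_eval_def)

lemma mpoly_eval_map:
  "mpoly_eval (map (\<lambda>r. (c, F r)) [0..<R]) xs =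
     (\<Sum>r<R. of_int c * prod_list (map2 (\<lambda>x e. x ^ e) xs (F r)))"
  by (simp add: mpoly_eval_def comp_def interv_sum_list_conv_sum_set_nat lessThan_atLeast0)

lemma prod_list_exps:
  fixes xs :: "real list"
  assumes "length xs = n"
  shows "prod_list (map2 (\<lambda>x e. x ^ e) xs (map E [0..<n])) = (\<Prod>v<n. (xs ! v) ^ E v)"
proof -
  have "map2 (\<lambda>x e. x ^ e) xs (map E [0..<n]) = map (\<lambda>v. (xs ! v) ^ E v) [0..<n]"
    using assms by (intro nth_equalityI) auto
  moreover have "prod_list (map F [0..<n]) = (\<Prod>v<n. F v)" for F :: "nat \<Rightarrow> real"
    by (induction n) auto
  ultimately show ?thesis by simp
qed

lemma prod_unit_exps:
  fixes xs :: "real list"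
  assumes "length xs = num_vars M" "w < num_vars M"
  shows "prod_list (map2 (\<lambda>x e. x ^ e) xs (unit_exps M w)) = xs ! w"
proof -
  have "(\<Prod>v<num_vars M. (xs ! v) ^ of_bool (v = w)) = (\<Prod>v<num_vars M. if v = w then xs ! v else 1)"
    by (intro prod.cong) auto
  then show ?thesis using assms by (simp add: prod_list_exps)
qed

lemma prod_weight_exps:
  fixes xs :: "real list"
  assumes "length xs = num_vars M" "i < M" "r < M * M"
  shows "prod_list (map2 (\<lambda>x e. x ^ e) xs (weight_exps M i r)) =
    xs ! var_x (r div M) * xs ! var_x (r mod M) * xs ! var_p i (r div M) (r mod M)"
proof -
  have ab: "r div M < M" "r mod M < M"
    using assms by (auto simp: less_mult_imp_div_less)
  have one: "(\<Prod>v<num_vars M. (xs ! v) ^ of_bool (v = w)) = xs ! w" if "w < num_vars M" for w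
    using prod_unit_exps[OF assms(1) that] prod_list_exps[OF assms(1)] by simp
  show ?thesis
    unfolding weight_exps_def prod_list_exps[OF assms(1)] power_add prod.distrib
    using one var_less ab assms(2) by simp
qed

lemma prod_hom_exps:
  fixes xs :: "real list"
  assumes "length xs = num_vars M"
  shows "prod_list (map2 (\<lambda>x e. x ^ e) xs (hom_exps m Q M j)) =
    xs ! 0 * (\<Prod>v\<in>{v. v < num_vars M \<and> hom_var m Q M j v}. xs ! v)"
proof -
  have "\<not> hom_var m Q M j 0" by (auto simp: hom_var_def var_p_def)
  then have "{..<num_vars M} \<inter> {v. v = 0 \<or> hom_var m Q M j v}
      = insert 0 {v. v < num_vars M \<and> hom_var m Q M j v}" "0 \<notin> {v. v < num_vars M \<and> hom_var m Q M j v}"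
    using var_less(3)[of M] by auto
  moreover have "(\<Prod>v<num_vars M. (xs ! v) ^ of_bool (v = 0 \<or> hom_var m Q M j v))
      = (\<Prod>v\<in>{..<num_vars M} \<inter> {v. v = 0 \<or> hom_var m Q M j v}. xs ! v)"
    by (subst prod.inter_restrict) (auto intro!: prod.cong)
  ultimately show ?thesis unfolding hom_exps_def prod_list_exps[OF assms] by simp
qed

lemma sum_div_mod:
  fixes f :: "nat \<Rightarrow> nat \<Rightarrow> 'a::comm_monoid_add"
  shows "(\<Sum>r<M * M. f (r div M) (r mod M)) = (\<Sum>a<M. \<Sum>b<M. f a b)"
proof -
  have "(\<Sum>r<M * M. f (r div M) (r mod M)) = (\<Sum>a<M. \<Sum>r\<in>{a * M..<a * M + M}. f (r div M) (r mod M))"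
    by (rule sum.nat_group[symmetric])
  also have "\<dots> = (\<Sum>a<M. \<Sum>b<M. f a b)"
  proof (rule sum.cong[OF refl])
    fix a
    have "(\<Sum>r\<in>{a * M..<a * M + M}. f (r div M) (r mod M)) = (\<Sum>b\<in>{0..<M}. f ((b + a * M) div M) ((b + a * M) mod M))"
      using sum.shift_bounds_nat_ivl[of "\<lambda>r. f (r div M) (r mod M)" 0 "a * M" M] by (simp add: add.commute)
    also have "\<dots> = (\<Sum>b<M. f a b)" by (intro sum.cong) auto
    finally show "(\<Sum>r\<in>{a * M..<a * M + M}. f (r div M) (r mod M)) = (\<Sum>b<M. f a b)" .
  qed
  finally show ?thesis .
qed

lemma feasible_rainbow_problem_iff:
  assumes "k \<le> M"
  shows "xs \<in> feasible_set (rainbow_problem m Q k M) \<longleftrightarrow>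
    length xs = num_vars M \<and> (\<forall>w<num_vars M. 0 \<le> xs ! w \<and> xs ! w \<le> 1) \<and>
    (\<Sum>a<M. xs ! var_x a) \<le> 1 \<and>
    (\<forall>i<k. xs ! 0 \<le> (\<Sum>a<M. \<Sum>b<M. xs ! var_x a * xs ! var_x b * xs ! var_p i a b)) \<and>
    (\<forall>j<num_codes M m. colouring_valid m Q M j \<longrightarrow>
       xs ! 0 * (\<Prod>v\<in>{v. v < num_vars M \<and> hom_var m Q M j v}. xs ! v) \<le> 0)"
proof (cases "length xs = num_vars M")
  case len: True
  have c1: "mpoly_eval [(1, unit_exps M w)] xs = xs ! w"
    "mpoly_eval [(1, []), (- 1, unit_exps M w)] xs = 1 - xs ! w" if "w < num_vars M" for w
    using prod_unit_exps[OF len that] by (simp_all add: mpoly_eval_Cons mpoly_eval_Nil)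
  have c2: "mpoly_eval ((1, []) # map (\<lambda>a. (- 1, unit_exps M (var_x a))) [0..<M]) xs = 1 - (\<Sum>a<M. xs ! var_x a)"
  proof -
    have "(\<Sum>a<M. - prod_list (map2 (\<lambda>x e. x ^ e) xs (unit_exps M (var_x a)))) = (\<Sum>a<M. - xs ! var_x a)"
      using prod_unit_exps[OF len var_less(1)] by (intro sum.cong) auto
    then show ?thesis by (simp add: mpoly_eval_Cons mpoly_eval_map sum_negf)
  qed
  have c3: "mpoly_eval ((- 1, unit_exps M 0) # map (\<lambda>r. (1, weight_exps M i r)) [0..<M * M]) xs
      = (\<Sum>a<M. \<Sum>b<M. xs ! var_x a * xs ! var_x b * xs ! var_p i a b) - xs ! 0" if "i < k" for i
  proof -
    have "(\<Sum>r<M * M. prod_list (map2 (\<lambda>x e. x ^ e) xs (weight_exps M i r)))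
        = (\<Sum>r<M * M. xs ! var_x (r div M) * xs ! var_x (r mod M) * xs ! var_p i (r div M) (r mod M))"
      using prod_weight_exps[OF len, of i] that assms by (intro sum.cong) auto
    also have "\<dots> = (\<Sum>a<M. \<Sum>b<M. xs ! var_x a * xs ! var_x b * xs ! var_p i a b)"
      by (rule sum_div_mod)
    finally show ?thesis
      using prod_unit_exps[OF len var_less(3)] by (simp add: mpoly_eval_Cons mpoly_eval_map)
  qed
  have c4: "mpoly_eval [(- of_bool (colouring_valid m Q M j), hom_exps m Q M j)] xs
      = - of_bool (colouring_valid m Q M j) * (xs ! 0 * (\<Prod>v\<in>{v. v < num_vars M \<and> hom_var m Q M j v}. xs ! v))" for j
    by (simp add: mpoly_eval_Cons mpoly_eval_Nil prod_hom_exps[OF len])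
  show ?thesis
    using len c1 c3 c4
    by (auto simp: rainbow_problem_def rainbow_constraints_def ball_Un c2 ball_conj_distrib)
qed (simp add: rainbow_problem_def)

section \<open>Optimal values\<close>

text \<open>\<open>Q\<close> may list an edge in either orientation or in both, hence the
  disjunctions; \<open>upair\<close> forgets the orientation.\<close>

lemma edge_relation:
  assumes T: "tree_order m par g ({..<m}, (\<lambda>(u, v). {u, v}) ` {(u, v). Q u v})"
  shows "j \<in> {1..<m} \<Longrightarrow> Q (g j) (g (par j)) \<or> Q (g (par j)) (g j)"
    and "Q u v \<Longrightarrow> \<exists>j\<in>{1..<m}. u = g j \<and> v = g (par j) \<or> u = g (par j) \<and> v = g j"
    and "inj_on (\<lambda>j. upair (g j) (g (par j))) {1..<m}"
    and "j \<in> {1..<m} \<Longrightarrow> par j < m" and "j < m \<Longrightarrow> g j < m" and "inj_on g {..<m}"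
proof -
  have par: "\<And>j. j \<in> {1..<m} \<Longrightarrow> par j < j" and g: "bij_betw g {..<m} {..<m}"
    and E: "(\<lambda>(u, v). {u, v}) ` {(u, v). Q u v} = (\<lambda>j. {g j, g (par j)}) ` {1..<m}"
    using T by (auto simp: tree_order_def)
  show inj: "inj_on g {..<m}" using g by (simp add: bij_betw_def)
  show "j \<in> {1..<m} \<Longrightarrow> par j < m" using par[of j] by auto
  show "j < m \<Longrightarrow> g j < m" using g by (auto simp: bij_betw_def)
  show "Q (g j) (g (par j)) \<or> Q (g (par j)) (g j)" if "j \<in> {1..<m}"
  proof -
    have "{g j, g (par j)} \<in> (\<lambda>(u, v). {u, v}) ` {(u, v). Q u v}" unfolding E using that by blast
    then obtain u v where "Q u v" "{g j, g (par j)} = {u, v}" by auto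
    then show ?thesis by (auto simp: doubleton_eq_iff)
  qed
  show "\<exists>j\<in>{1..<m}. u = g j \<and> v = g (par j) \<or> u = g (par j) \<and> v = g j" if "Q u v"
  proof -
    have "{u, v} \<in> (\<lambda>j. {g j, g (par j)}) ` {1..<m}" unfolding E[symmetric] using that by auto
    then obtain j where "j \<in> {1..<m}" "{u, v} = {g j, g (par j)}" by blast
    then show ?thesis by (intro bexI[of _ j]) (auto simp: doubleton_eq_iff)
  qed
  show "inj_on (\<lambda>j. upair (g j) (g (par j))) {1..<m}"
    using inj_on_parent_edge[OF inj par] unfolding inj_on_def upair_eq_iff doubleton_eq_iff by blast
qed

lemma rainbow_hom_imp_valid_code:
  assumes T: "tree_order m par g ({..<m}, (\<lambda>(u, v). {u, v}) ` {(u, v). Q u v})"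
    and "k \<le> M" and hom: "rainbow_hom m par k M P" and sym: "\<And>i a b. P i a b \<Longrightarrow> P i b a"
  shows "\<exists>j<num_codes M m. colouring_valid m Q M j \<and>
    (\<forall>w. hom_var m Q M j w \<longrightarrow> (\<exists>i a b. w = var_p i a b \<and> i < k \<and> a < M \<and> b < M \<and> P i a b))"
proof -
  note E = edge_relation[OF T]
  obtain \<phi> \<psi> where \<phi>: "\<And>j. j < m \<Longrightarrow> \<phi> j < M" and \<psi>: "inj_on \<psi> {1..<m}" "\<And>j. j \<in> {1..<m} \<Longrightarrow> \<psi> j < k"
    and P: "\<And>j. j \<in> {1..<m} \<Longrightarrow> P (\<psi> j) (\<phi> j) (\<phi> (par j))"
    using hom unfolding rainbow_hom_def by blast
  have "0 < m" using T by (simp add: tree_order_def)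
  then have "0 < M" using \<phi>[of 0] by simp
  let ?e = "\<lambda>j. upair (g j) (g (par j))"
  \<comment> \<open>The digit string of \<phi> and \<psi>, transported along \<open>g\<close>.
    Positions that belong to no vertex or edge hold 0.\<close>
  define \<theta> where "\<theta> q = (if even q then if q div 2 < m then \<phi> (inv_into {..<m} g (q div 2)) else 0
    else if q div 2 \<in> ?e ` {1..<m} then \<psi> (inv_into {1..<m} ?e (q div 2)) else 0)" for q
  have g_surj: "v \<in> g ` {..<m}" if "v < m" for v
    using T that by (auto simp: tree_order_def bij_betw_def)
  have \<theta>1: "\<theta> (2 * g j) = \<phi> j" if "j < m" for j
    using that E(5)[OF that] E(6) by (simp add: \<theta>_def)
  have \<theta>2: "\<theta> (2 * ?e j + 1) = \<psi> j" if "j \<in> {1..<m}" for j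
    using inv_into_f_f[OF E(3) that] that by (simp add: \<theta>_def)
  have "\<theta> q < M" for q
  proof -
    have "\<phi> (inv_into {..<m} g v) < M" if "v < m" for v
      using inv_into_into[OF g_surj[OF that]] by (intro \<phi>) simp
    moreover have "\<psi> (inv_into {1..<m} ?e v) < M" if "v \<in> ?e ` {1..<m}" for v
      using \<psi>(2)[OF inv_into_into[OF that]] \<open>k \<le> M\<close> by linarith
    ultimately show ?thesis using \<open>0 < M\<close> by (simp add: \<theta>_def)
  qed
  then obtain c where c: "c < num_codes M m" "\<And>q. q < 2 * upair m m + 2 \<Longrightarrow> digit M c q = \<theta> q"
    using exists_digits[of "2 * upair m m + 2" \<theta> M] unfolding num_codes_def by blast
  have up: "upair u v \<le> upair m m" if "u < m" "v < m" for u v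
    using that by (intro upair_mono) auto
  have "m \<le> upair m m" unfolding upair_def using le_prod_encode_1[of "m + m" "m * m"] by linarith
  then have d1: "digit M c (2 * g j) = \<phi> j" if "j < m" for j
    using c(2)[of "2 * g j"] \<theta>1[OF that] E(5)[OF that] by simp
  have d2: "digit M c (2 * ?e j + 1) = \<psi> j" if "j \<in> {1..<m}" for j
    using c(2)[of "2 * ?e j + 1"] \<theta>2[OF that] up[of "g j" "g (par j)"] E(4)[OF that] E(5)[of j] E(5)[of "par j"] that
    by simp
  have Qe: "\<exists>j\<in>{1..<m}. upair u v = ?e j" if "Q u v" for u v
    using E(2)[OF that] upair_commute by metis
  have "colouring_valid m Q M c"
    unfolding colouring_valid_def
  proof (intro allI impI notI, elim conjE)
    fix u v u' v'
    assume Q: "Q u v" "Q u' v'" and ne: "upair u v \<noteq> upair u' v'"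
      and eq: "digit M c (2 * upair u v + 1) = digit M c (2 * upair u' v' + 1)"
    obtain j where j: "j \<in> {1..<m}" "upair u v = ?e j" using Qe[OF Q(1)] by blast
    obtain j' where j': "j' \<in> {1..<m}" "upair u' v' = ?e j'" using Qe[OF Q(2)] by blast
    have "\<psi> j = \<psi> j'" using eq d2[OF j(1)] d2[OF j'(1)] unfolding j(2) j'(2) by simp
    then have "j = j'" using inj_onD[OF \<psi>(1)] j(1) j'(1) by blast
    then show False using ne j(2) j'(2) by simp
  qed
  moreover have "\<exists>i a b. w = var_p i a b \<and> i < k \<and> a < M \<and> b < M \<and> P i a b" if w: "hom_var m Q M c w" for w
  proof -
    obtain u v where uv: "Q u v" "w = var_p (digit M c (2 * upair u v + 1)) (digit M c (2 * u)) (digit M c (2 * v))"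
      using w unfolding hom_var_def by blast
    obtain j where j: "j \<in> {1..<m}" "u = g j \<and> v = g (par j) \<or> u = g (par j) \<and> v = g j"
      using E(2)[OF uv(1)] by blast
    have lt: "j < m" "par j < m" using j(1) E(4)[OF j(1)] by auto
    have "upair u v = ?e j" using j(2) upair_commute by metis
    then have "w = var_p (\<psi> j) (\<phi> j) (\<phi> (par j))"
      using uv(2) j(2) d2[OF j(1)] d1[OF lt(1)] d1[OF lt(2)] by (auto simp: var_p_commute)
    then show ?thesis using P[OF j(1)] \<psi>(2)[OF j(1)] \<phi> lt by blast
  qed
  ultimately show ?thesis using c(1) by blast
qed

text \<open>Digits range below \<open>M\<close>, so a code may use colours that are not below
  \<open>k\<close>. The hypothesis on the variables of the monomial must therefore also supply
  \<open>i < k\<close>.\<close>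

lemma valid_code_imp_rainbow_hom:
  assumes T: "tree_order m par g ({..<m}, (\<lambda>(u, v). {u, v}) ` {(u, v). Q u v})"
    and "0 < M" and valid: "colouring_valid m Q M c"
    and P: "\<And>i a b. hom_var m Q M c (var_p i a b) \<Longrightarrow> i < k \<and> P i a b"
  shows "rainbow_hom m par k M P"
  unfolding rainbow_hom_def
proof (rule exI[of _ "\<lambda>j. digit M c (2 * g j)"],
    rule exI[of _ "\<lambda>j. digit M c (2 * upair (g j) (g (par j)) + 1)"], intro conjI allI impI ballI)
  note E = edge_relation[OF T]
  show "digit M c (2 * g j) < M" for j using \<open>0 < M\<close> by (rule digit_less)
  have lt: "g j < m" "g (par j) < m" if "j \<in> {1..<m}" for j
    using E(5)[of j] E(5)[OF E(4)[OF that]] that by auto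
  have Q: "\<exists>u<m. \<exists>v<m. Q u v \<and> upair u v = upair (g j) (g (par j))" if "j \<in> {1..<m}" for j
    using E(1)[OF that] lt[OF that] upair_commute by metis
  show "inj_on (\<lambda>j. digit M c (2 * upair (g j) (g (par j)) + 1)) {1..<m}"
  proof (rule inj_onI, rule ccontr)
    fix i j assume ij: "i \<in> {1..<m}" "j \<in> {1..<m}" "i \<noteq> j"
      and eq: "digit M c (2 * upair (g i) (g (par i)) + 1) = digit M c (2 * upair (g j) (g (par j)) + 1)"
    have "upair (g i) (g (par i)) \<noteq> upair (g j) (g (par j))"
      using inj_onD[OF E(3)] ij by blast
    with eq Q[OF ij(1)] Q[OF ij(2)] show False
      using valid unfolding colouring_valid_def by metis
  qed
  fix j assume j: "j \<in> {1..<m}"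
  have "hom_var m Q M c (var_p (digit M c (2 * upair (g j) (g (par j)) + 1)) (digit M c (2 * g j)) (digit M c (2 * g (par j))))"
    using E(1)[OF j]
  proof
    assume "Q (g j) (g (par j))"
    then show ?thesis using lt[OF j] unfolding hom_var_def by blast
  next
    assume "Q (g (par j)) (g j)"
    then show ?thesis
      using lt[OF j] unfolding hom_var_def upair_commute[of "g j"] var_p_commute[of _ "digit M c (2 * g j)"] by blast
  qed
  from P[OF this] show "digit M c (2 * upair (g j) (g (par j)) + 1) < k"
    "P (digit M c (2 * upair (g j) (g (par j)) + 1)) (digit M c (2 * g j)) (digit M c (2 * g (par j)))" by auto
qed

text \<open>The pattern is the support of the densities. A rainbow homomorphism into it would make a
  monomial positive; and since densities are at most 1, replacing them by the indicator of the
  support does not lower the weights.\<close>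

lemma feasible_imp_attainable:
  assumes T: "tree_order m par g ({..<m}, (\<lambda>(u, v). {u, v}) ` {(u, v). Q u v})"
    and "k \<le> M" and xs: "xs \<in> feasible_set (rainbow_problem m Q k M)"
  shows "attainable m par k M (xs ! 0)"
proof -
  have box: "\<And>w. w < num_vars M \<Longrightarrow> 0 \<le> xs ! w \<and> xs ! w \<le> 1"
    and sum: "(\<Sum>a<M. xs ! var_x a) \<le> 1"
    and weight: "\<And>i. i < k \<Longrightarrow> xs ! 0 \<le> (\<Sum>a<M. \<Sum>b<M. xs ! var_x a * xs ! var_x b * xs ! var_p i a b)"
    and hom: "\<And>j. \<lbrakk>j < num_codes M m; colouring_valid m Q M j\<rbrakk> \<Longrightarrow>
       xs ! 0 * (\<Prod>v\<in>{v. v < num_vars M \<and> hom_var m Q M j v}. xs ! v) \<le> 0"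
    using xs unfolding feasible_rainbow_problem_iff[OF \<open>k \<le> M\<close>] by auto
  define P where "P i a b \<longleftrightarrow> 0 < xs ! var_p i a b" for i a b
  have sym: "P i b a" if "P i a b" for i a b using that unfolding P_def by (subst var_p_commute)
  have "\<not> rainbow_hom m par k M P" if t: "0 < xs ! 0"
  proof
    assume "rainbow_hom m par k M P"
    from rainbow_hom_imp_valid_code[OF T \<open>k \<le> M\<close> this sym] obtain j where
      j: "j < num_codes M m" "colouring_valid m Q M j"
      "\<And>w. hom_var m Q M j w \<Longrightarrow> \<exists>i a b. w = var_p i a b \<and> i < k \<and> a < M \<and> b < M \<and> P i a b"
      by blast
    have "0 < (\<Prod>v\<in>{v. v < num_vars M \<and> hom_var m Q M j v}. xs ! v)"
    proof (rule prod_pos)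
      fix v assume "v \<in> {v. v < num_vars M \<and> hom_var m Q M j v}"
      then show "0 < xs ! v" using j(3)[of v] unfolding P_def by blast
    qed
    then have "0 < xs ! 0 * (\<Prod>v\<in>{v. v < num_vars M \<and> hom_var m Q M j v}. xs ! v)"
      using t by simp
    then show False using hom[OF j(1,2)] by simp
  qed
  moreover have "xs ! 0 \<le> pattern_weight M (P i) (\<lambda>a. xs ! var_x a)" if i: "i < k" for i
  proof -
    have "xs ! 0 \<le> (\<Sum>a<M. \<Sum>b<M. xs ! var_x a * xs ! var_x b * xs ! var_p i a b)" by (rule weight[OF i])
    also have "\<dots> \<le> pattern_weight M (P i) (\<lambda>a. xs ! var_x a)"
      unfolding pattern_weight_def
    proof (intro sum_mono)
      fix a b assume "a \<in> {..<M}" "b \<in> {..<M}"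
      then have ab: "a < M" "b < M" by auto
      have p: "0 \<le> xs ! var_p i a b" "xs ! var_p i a b \<le> 1"
        using box[OF var_less(2)[of i M a b]] ab i \<open>k \<le> M\<close> by auto
      have x: "0 \<le> xs ! var_x a * xs ! var_x b"
        using box[OF var_less(1)[OF ab(1)]] box[OF var_less(1)[OF ab(2)]] by simp
      show "xs ! var_x a * xs ! var_x b * xs ! var_p i a b \<le> of_bool (P i a b) * (xs ! var_x a * xs ! var_x b)"
      proof (cases "P i a b")
        case True
        then show ?thesis using mult_left_le[OF p(2) x] by simp
      next
        case False
        moreover from this have "xs ! var_p i a b = 0" using p(1) unfolding P_def by simp
        ultimately show ?thesis by simp
      qed
    qed
    finally show ?thesis .
  qed
  ultimately show ?thesis
    unfolding attainable_def using sym sum box var_less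
    by (intro conjI exI[of _ P]) (auto intro!: exI[of _ "\<lambda>a. xs ! var_x a"])
qed

lemma pattern_weight_le_1:
  assumes "\<And>a. a < M \<Longrightarrow> 0 \<le> x a" "sum x {..<M} \<le> 1"
  shows "pattern_weight M P x \<le> 1"
proof -
  have "pattern_weight M P x \<le> (\<Sum>a<M. \<Sum>b<M. x a * x b)"
    unfolding pattern_weight_def using assms(1) by (intro sum_mono) simp
  also have "\<dots> = sum x {..<M} * sum x {..<M}" by (simp add: sum_product)
  also have "\<dots> \<le> 1 * 1" using assms by (intro mult_mono) (auto intro: sum_nonneg)
  finally show ?thesis by simp
qed

lemma attainable_imp_feasible:
  assumes T: "tree_order m par g ({..<m}, (\<lambda>(u, v). {u, v}) ` {(u, v). Q u v})"
    and "1 \<le> k" "k \<le> M" and t: "attainable m par k M t"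
  shows "\<exists>xs\<in>feasible_set (rainbow_problem m Q k M). xs ! 0 = t"
proof -
  obtain P x where "0 \<le> t" and sym: "\<And>i a b. P i a b \<Longrightarrow> P i b a"
    and hom: "0 < t \<Longrightarrow> \<not> rainbow_hom m par k M P"
    and x: "\<And>a. a < M \<Longrightarrow> 0 \<le> x a" "sum x {..<M} \<le> 1"
    and weight: "\<And>i. i < k \<Longrightarrow> t \<le> pattern_weight M (P i) x"
    using t unfolding attainable_def by metis
  have "t \<le> 1" using weight[of 0] pattern_weight_le_1[of M x "P 0"] x \<open>1 \<le> k\<close> by force
  \<comment> \<open>Densities of colours from \<open>k\<close> on are 0, so monomials of codes using
    such colours vanish. The box constraint on \<open>t\<close> holds because a pattern weight is at
    most 1.\<close>
  define X where "X v = (if v = 0 then t else if odd v then if v div 2 < M then x (v div 2) else 0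
    else of_bool (\<exists>i a b. v = var_p i a b \<and> i < k \<and> P i a b))" for v
  define xs where "xs = map X [0..<num_vars M]"
  have nth: "xs ! v = X v" if "v < num_vars M" for v using that by (simp add: xs_def)
  have X0: "xs ! 0 = t" using nth[OF var_less(3)] by (simp add: X_def)
  have Xx: "xs ! var_x a = x a" if "a < M" for a
    using nth[OF var_less(1)[OF that]] that by (simp add: X_def var_x_def)
  have Xp: "X (var_p i a b) = of_bool (i < k \<and> P i a b)" for i a b
  proof -
    have "(\<exists>i' a' b'. var_p i a b = var_p i' a' b' \<and> i' < k \<and> P i' a' b') \<longleftrightarrow> i < k \<and> P i a b"
      using sym unfolding var_p_eq_iff by blast
    moreover have "var_p i a b \<noteq> 0" "even (var_p i a b)" by (simp_all add: var_p_def)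
    ultimately show ?thesis by (simp add: X_def)
  qed
  have x1: "x a \<le> 1" if "a < M" for a
    using member_le_sum[of a "{..<M}" x] x that by auto
  have "xs \<in> feasible_set (rainbow_problem m Q k M)"
    unfolding feasible_rainbow_problem_iff[OF \<open>k \<le> M\<close>]
  proof (intro conjI allI impI)
    show "length xs = num_vars M" by (simp add: xs_def)
  next
    fix w assume w: "w < num_vars M"
    have "0 \<le> X w \<and> X w \<le> 1" using \<open>0 \<le> t\<close> \<open>t \<le> 1\<close> x(1) x1 by (simp add: X_def)
    then show "0 \<le> xs ! w" "xs ! w \<le> 1" using nth[OF w] by auto
  next
    show "(\<Sum>a<M. xs ! var_x a) \<le> 1" using x(2) Xx by simp
  next
    fix i assume i: "i < k"
    have "(\<Sum>a<M. \<Sum>b<M. xs ! var_x a * xs ! var_x b * xs ! var_p i a b) = pattern_weight M (P i) x"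
      unfolding pattern_weight_def
    proof (intro sum.cong refl)
      fix a b assume ab: "a \<in> {..<M}" "b \<in> {..<M}"
      then have "xs ! var_p i a b = of_bool (P i a b)"
        using nth[OF var_less(2)[of i M a b]] Xp i \<open>k \<le> M\<close> by simp
      then show "xs ! var_x a * xs ! var_x b * xs ! var_p i a b = of_bool (P i a b) * (x a * x b)"
        using Xx ab by simp
    qed
    then show "xs ! 0 \<le> (\<Sum>a<M. \<Sum>b<M. xs ! var_x a * xs ! var_x b * xs ! var_p i a b)"
      using weight[OF i] X0 by simp
  next
    fix j assume "j < num_codes M m" and valid: "colouring_valid m Q M j"
    show "xs ! 0 * (\<Prod>v\<in>{v. v < num_vars M \<and> hom_var m Q M j v}. xs ! v) \<le> 0"
    proof (cases "0 < t")
      case True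
      have "0 < M" using \<open>1 \<le> k\<close> \<open>k \<le> M\<close> by simp
      with valid_code_imp_rainbow_hom[OF T this valid, of k P] hom[OF True] obtain i a b where
        v: "hom_var m Q M j (var_p i a b)" "\<not> (i < k \<and> P i a b)" by blast
      have less: "var_p i a b < num_vars M"
      proof -
        obtain i' a' b' where "var_p i a b = var_p (digit M j i') (digit M j a') (digit M j b')"
          using v(1) unfolding hom_var_def by blast
        then show ?thesis using var_less(2) digit_less[OF \<open>0 < M\<close>] by simp
      qed
      then have "xs ! var_p i a b = 0" using nth Xp v(2) by simp
      then have "(\<Prod>v\<in>{v. v < num_vars M \<and> hom_var m Q M j v}. xs ! v) = 0"
        using v(1) less by (intro prod_zero) auto
      then show ?thesis by (simp only: mult_zero_right order_refl)
    qed (use X0 \<open>0 \<le> t\<close> in auto)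
  qed
  with X0 show ?thesis by blast
qed

text \<open>Compactness, applied to functions on all indices: a product of unit intervals is
  compact, and the constraints cut out a closed subset. Lists correspond to the first
  \<open>num_vars M\<close> coordinates.\<close>

lemma rainbow_problem_optimum:
  assumes T: "tree_order m par g ({..<m}, (\<lambda>(u, v). {u, v}) ` {(u, v). Q u v})"
    and "1 \<le> k" "k \<le> M"
  shows "\<exists>xs\<in>feasible_set (rainbow_problem m Q k M). \<forall>ys\<in>feasible_set (rainbow_problem m Q k M). ys ! 0 \<le> xs ! 0"
proof -
  let ?L = "\<lambda>f. map f [0..<num_vars M]"
  define box where "box = {f :: nat \<Rightarrow> real. \<forall>v. f v \<in> {0..1}}"
  define C where "C = box \<inter> ({f. (\<Sum>a<M. f (var_x a)) \<le> 1} \<inter>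
    ((\<Inter>i\<in>{..<k}. {f. f 0 \<le> (\<Sum>a<M. \<Sum>b<M. f (var_x a) * f (var_x b) * f (var_p i a b))}) \<inter>
    (\<Inter>j\<in>{j. j < num_codes M m \<and> colouring_valid m Q M j}.
       {f. f 0 * (\<Prod>v\<in>{v. v < num_vars M \<and> hom_var m Q M j v}. f v) \<le> 0})))"
  have "compactin (product_topology (\<lambda>_. euclidean) UNIV) (PiE UNIV (\<lambda>_::nat. {0..1::real}))"
    by (simp add: compactin_PiE)
  moreover have "PiE UNIV (\<lambda>_::nat. {0..1::real}) = box" by (auto simp: box_def PiE_UNIV_domain)
  ultimately have "compact box" by (simp add: euclidean_product_topology)
  have coord: "continuous_on UNIV (\<lambda>f :: nat \<Rightarrow> real. f v)" for v
    by (rule continuous_on_product_coordinates)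
  have "compact C"
    unfolding C_def
    by (intro compact_Int_closed[OF \<open>compact box\<close>] closed_Int closed_INT ballI closed_Collect_le
        continuous_on_sum continuous_on_mult continuous_on_prod coord continuous_on_const)
  have feasible: "?L f \<in> feasible_set (rainbow_problem m Q k M)" if "f \<in> C" for f
  proof -
    have nth: "?L f ! v = f v" if "v < num_vars M" for v using that by simp
    have "(\<Sum>a<M. ?L f ! var_x a) = (\<Sum>a<M. f (var_x a))"
      by (intro sum.cong refl nth var_less) auto
    moreover have "(\<Sum>a<M. \<Sum>b<M. ?L f ! var_x a * ?L f ! var_x b * ?L f ! var_p i a b)
        = (\<Sum>a<M. \<Sum>b<M. f (var_x a) * f (var_x b) * f (var_p i a b))" if "i < k" for i
      using that \<open>k \<le> M\<close> by (intro sum.cong refl arg_cong2[where f = "(*)"] nth var_less) auto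
    moreover have "(\<Prod>v\<in>{v. v < num_vars M \<and> hom_var m Q M j v}. ?L f ! v)
        = (\<Prod>v\<in>{v. v < num_vars M \<and> hom_var m Q M j v}. f v)" for j
      by (intro prod.cong refl nth) auto
    ultimately show ?thesis
      using that nth var_less(3)[of M] unfolding feasible_rainbow_problem_iff[OF \<open>k \<le> M\<close>] C_def box_def
      by simp
  qed
  have covered: "\<exists>f\<in>C. f 0 = ys ! 0" if ys: "ys \<in> feasible_set (rainbow_problem m Q k M)" for ys
  proof -
    define f where "f v = (if v < num_vars M then ys ! v else 0)" for v
    have nth: "f v = ys ! v" if "v < num_vars M" for v using that by (simp add: f_def)
    have "(\<Sum>a<M. f (var_x a)) = (\<Sum>a<M. ys ! var_x a)"
      by (intro sum.cong refl nth var_less) auto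
    moreover have "(\<Sum>a<M. \<Sum>b<M. f (var_x a) * f (var_x b) * f (var_p i a b))
        = (\<Sum>a<M. \<Sum>b<M. ys ! var_x a * ys ! var_x b * ys ! var_p i a b)" if "i < k" for i
      using that \<open>k \<le> M\<close> by (intro sum.cong refl arg_cong2[where f = "(*)"] nth var_less) auto
    moreover have "(\<Prod>v\<in>{v. v < num_vars M \<and> hom_var m Q M j v}. f v)
        = (\<Prod>v\<in>{v. v < num_vars M \<and> hom_var m Q M j v}. ys ! v)" for j
      by (intro prod.cong refl nth) auto
    moreover have "f 0 = ys ! 0" by (rule nth[OF var_less(3)])
    moreover have "f v \<in> {0..1}" for v
      using ys unfolding feasible_rainbow_problem_iff[OF \<open>k \<le> M\<close>] by (simp add: f_def)
    ultimately have "f \<in> C"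
      using ys unfolding feasible_rainbow_problem_iff[OF \<open>k \<le> M\<close>] C_def box_def by simp
    with \<open>f 0 = ys ! 0\<close> show ?thesis by blast
  qed
  have "C \<noteq> {}" using attainable_imp_feasible[OF assms attainable_0] covered by blast
  from continuous_attains_sup[OF \<open>compact C\<close> this continuous_on_subset[OF coord[of 0]]]
  obtain f where f: "f \<in> C" "\<And>h. h \<in> C \<Longrightarrow> h 0 \<le> f 0" by auto
  have "?L f ! 0 = f 0" using var_less(3)[of M] by simp
  then show ?thesis
    using feasible[OF f(1)] covered f(2) by (intro bexI[of _ "?L f"]) fastforce+
qed

lemma rainbow_problem_solves:
  assumes T: "tree_order m par g ({..<m}, (\<lambda>(u, v). {u, v}) ` {(u, v). Q u v})"
    and "1 \<le> k" "k \<le> M"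
  shows "\<exists>t. attainable m par k M t \<and> (\<forall>s. attainable m par k M s \<longrightarrow> s \<le> t) \<and>
    solved_by t [rainbow_problem m Q k M]"
proof -
  let ?F = "feasible_set (rainbow_problem m Q k M)"
  obtain xs where xs: "xs \<in> ?F" "\<And>ys. ys \<in> ?F \<Longrightarrow> ys ! 0 \<le> xs ! 0"
    using rainbow_problem_optimum[OF assms] by blast
  have obj: "objective (rainbow_problem m Q k M) ys = ys ! 0" if "ys \<in> ?F" for ys
  proof -
    have "length ys = num_vars M"
      using that unfolding feasible_rainbow_problem_iff[OF \<open>k \<le> M\<close>] by blast
    from prod_unit_exps[OF this var_less(3)] show ?thesis
      by (simp add: rainbow_problem_def mpoly_eval_Cons mpoly_eval_Nil)
  qed
  have opt: "optimal_value (rainbow_problem m Q k M) v \<longleftrightarrow> v = xs ! 0" for v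
  proof
    assume "optimal_value (rainbow_problem m Q k M) v"
    then obtain ys where "ys \<in> ?F" "ys ! 0 = v" "xs ! 0 \<le> v"
      unfolding optimal_value_def using obj xs(1) by metis
    then show "v = xs ! 0" using xs(2) by fastforce
  next
    assume "v = xs ! 0"
    then show "optimal_value (rainbow_problem m Q k M) v"
      unfolding optimal_value_def using obj xs by auto
  qed
  have "solved_by (xs ! 0) [rainbow_problem m Q k M]"
    unfolding solved_by_def using opt by auto
  moreover have "s \<le> xs ! 0" if "attainable m par k M s" for s
    using attainable_imp_feasible[OF assms that] xs(2) by blast
  ultimately show ?thesis using feasible_imp_attainable[OF T \<open>k \<le> M\<close> xs(1)] by blast
qed

text \<open>With the optimal pattern fixed, \<open>t\<close> is a maximum over the weights alone,
  because changing them does not affect the absence of rainbow homomorphisms.\<close>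

lemma algebraic_max_attainable:
  assumes t: "attainable m par k M t" and max: "\<And>s. attainable m par k M s \<Longrightarrow> s \<le> t" and "1 \<le> k"
  shows "algebraic t"
proof (cases "t = 0")
  case False
  then have "0 < t" using t unfolding attainable_def by simp
  then obtain P x where sym: "\<forall>i a b. P i a b \<longrightarrow> P i b a"
    and hom: "\<not> rainbow_hom m par k M P"
    and x: "\<And>a. a < M \<Longrightarrow> 0 \<le> x a" "sum x {..<M} \<le> 1"
    and weight: "\<And>i. i < k \<Longrightarrow> t \<le> pattern_weight M (P i) x"
    using t unfolding attainable_def by metis
  show ?thesis
  proof (rule algebraic_max_min_pattern_weight[OF x weight])
    fix y :: "nat \<Rightarrow> real" and s
    assume y: "\<And>a. a < M \<Longrightarrow> 0 \<le> y a" "sum y {..<M} \<le> 1" "\<And>i. i < k \<Longrightarrow> s \<le> pattern_weight M (P i) y"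
    show "s \<le> t"
    proof (cases "0 \<le> s")
      case True
      then have "attainable m par k M s"
        unfolding attainable_def using sym hom y by blast
      then show ?thesis by (rule max)
    qed (use \<open>0 < t\<close> in auto)
  qed (use \<open>1 \<le> k\<close> in auto)
qed simp

section \<open>Computing the optimization problem\<close>

lemma computable_upair:
  "computable n f \<Longrightarrow> computable n g \<Longrightarrow> computable n (\<lambda>xs. upair (f xs) (g xs))"
  unfolding upair_def by (intro computable_prod_encode computable_add computable_mult)

lemma computable_var_x: "computable n f \<Longrightarrow> computable n (\<lambda>xs. var_x (f xs))"
  unfolding var_x_def by (intro computable_add computable_mult computable_const)

lemma computable_var_p:
  "computable n f \<Longrightarrow> computable n g \<Longrightarrow> computable n h \<Longrightarrow>
     computable n (\<lambda>xs. var_p (f xs) (g xs) (h xs))"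
  unfolding var_p_def
  by (intro computable_add computable_mult computable_const computable_prod_encode computable_upair)

lemma computable_num_vars: "computable n f \<Longrightarrow> computable n (\<lambda>xs. num_vars (f xs))"
  unfolding num_vars_def
  by (intro computable_add computable_mult computable_const computable_prod_encode computable_upair)

lemma computable_digit:
  "computable n f \<Longrightarrow> computable n g \<Longrightarrow> computable n h \<Longrightarrow>
     computable n (\<lambda>xs. digit (f xs) (g xs) (h xs))"
  unfolding digit_def by (intro computable_div computable_mod computable_power)

lemma computable_num_codes:
  "computable n f \<Longrightarrow> computable n g \<Longrightarrow> computable n (\<lambda>xs. num_codes (f xs) (g xs))"
  unfolding num_codes_def
  by (intro computable_power computable_add computable_mult computable_upair computable_const)

lemma computable_type_bound:
  assumes "computable n f" "computable n g"
  shows "computable n (\<lambda>xs. type_bound (f xs) (g xs))"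
proof -
  have "computable n (\<lambda>xs. rec_nat 1 (\<lambda>_ y. y * 2 ^ (f xs * y)) (g xs))"
    by (intro computable_rec computable_mult computable_power computable_const computable_nth
        computable_tl[of _ "\<lambda>ys. f (tl ys)"] computable_tl assms) auto
  moreover have "rec_nat 1 (\<lambda>_ y. y * 2 ^ (k * y)) d = type_bound k d" for k d
    by (induction d) auto
  ultimately show ?thesis by simp
qed

section \<open>Reading the tree from its code\<close>

definition code_edge :: "nat \<Rightarrow> nat \<Rightarrow> nat \<Rightarrow> bool" where
  "code_edge c u v \<longleftrightarrow> list_code_mem (prod_encode (u, v)) (snd (prod_decode c))"

definition code_verts :: "nat \<Rightarrow> nat" where
  "code_verts c = fst (prod_decode c)"

lemma computable_code_edge:
  "computable n f \<Longrightarrow> computable n g \<Longrightarrow> computable n h \<Longrightarrow>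
     computable n (\<lambda>xs. of_bool (code_edge (f xs) (g xs) (h xs)))"
  unfolding code_edge_def
  by (intro computable_list_code_mem computable_prod_encode computable_snd_prod_decode)

lemma computable_code_verts: "computable n f \<Longrightarrow> computable n (\<lambda>xs. code_verts (f xs))"
  unfolding code_verts_def by (rule computable_fst_prod_decode)

text \<open>Access to the arguments under up to five binders.\<close>

lemmas computable_nths = computable_nth computable_tl[OF computable_nth]
  computable_tl[OF computable_tl[OF computable_nth]]
  computable_tl[OF computable_tl[OF computable_tl[OF computable_nth]]]
  computable_tl[OF computable_tl[OF computable_tl[OF computable_tl[OF computable_nth]]]]
  computable_tl[OF computable_tl[OF computable_tl[OF computable_tl[OF computable_tl[OF computable_nth]]]]]

text \<open>Computability is first shown with projections as arguments, to which
  \<open>computable_nths\<close> applies below the quantifiers; composition then admits arbitrary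
  arguments.\<close>

lemma computable_colouring_valid:
  assumes "computable n c" "computable n M" "computable n j"
  shows "computable n (\<lambda>xs. of_bool (colouring_valid (code_verts (c xs)) (code_edge (c xs)) (M xs) (j xs)))"
proof -
  have "computable (Suc (Suc (Suc 0))) (\<lambda>xs. of_bool
      (colouring_valid (code_verts (xs ! 0)) (code_edge (xs ! 0)) (xs ! Suc 0) (xs ! Suc (Suc 0))))"
    unfolding colouring_valid_def
    by (intro computable_ball computable_not computable_conj computable_eq computable_code_verts
        computable_code_edge computable_digit computable_add computable_mult computable_upair
        computable_const computable_nths) simp_all
  from computable_compose[of "[c, M, j]", OF _ , of _ n] this assms show ?thesis by force
qed

lemma computable_hom_var:
  assumes "computable n c" "computable n M" "computable n j" "computable n w"
  shows "computable n (\<lambda>xs. of_bool (hom_var (code_verts (c xs)) (code_edge (c xs)) (M xs) (j xs) (w xs)))"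
proof -
  have "computable (Suc (Suc (Suc (Suc 0)))) (\<lambda>xs. of_bool
      (hom_var (code_verts (xs ! 0)) (code_edge (xs ! 0)) (xs ! Suc 0) (xs ! Suc (Suc 0)) (xs ! Suc (Suc (Suc 0)))))"
    unfolding hom_var_def
    by (intro computable_bex computable_conj computable_eq computable_code_verts computable_var_p
        computable_code_edge computable_digit computable_add computable_mult computable_upair
        computable_const computable_nths) simp_all
  from computable_compose[of "[c, M, j, w]", OF _ , of _ n] this assms show ?thesis by force
qed

section \<open>Tabulating the code of the problem\<close>

lemma list_encode_tab: "list_encode (map f [0..<n]) = list_code_tab n f 0"
  using list_code_tab_list_encode[of n f "[]"] by simp

lemma mpoly_encode_Cons:
  "mpoly_encode ((c, es) # p) = Suc (prod_encode (prod_encode (int_encode c, list_encode es), mpoly_encode p))"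
  by (simp add: mpoly_encode_def)

lemma mpoly_encode_Nil: "mpoly_encode [] = 0"
  by (simp add: mpoly_encode_def)

lemma mpoly_encode_map:
  "mpoly_encode (map (\<lambda>r. (c, F r)) [0..<R]) =
     list_code_tab R (\<lambda>r. prod_encode (int_encode c, list_encode (F r))) 0"
  by (simp add: mpoly_encode_def comp_def list_encode_tab)

lemma int_encode_coeffs: "int_encode 1 = 2" "int_encode (- 1) = 1" "int_encode (- of_bool b) = of_bool b"
  by (auto simp: int_encode_def sum_encode_def)

lemma computable_rainbow_constraints:
  "computable (Suc (Suc (Suc 0))) (\<lambda>xs. list_encode (map mpoly_encode
     (rainbow_constraints (code_verts (xs ! 0)) (code_edge (xs ! 0)) (xs ! Suc 0) (xs ! Suc (Suc 0)))))"
  unfolding rainbow_constraints_def map_append map_map comp_def list.map append_Cons append_Nil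
    list_code_tab_list_encode[symmetric] list_encode.simps mpoly_encode_Cons mpoly_encode_Nil
    mpoly_encode_map int_encode_coeffs weight_exps_def hom_exps_def list_encode_tab
  by (intro computable_list_code_tab computable_Suc computable_prod_encode computable_num_vars
      computable_eq computable_disj computable_add computable_mult computable_div computable_mod
      computable_var_x computable_var_p computable_colouring_valid computable_hom_var
      computable_code_verts computable_num_codes computable_const computable_nths) simp_all

text \<open>The sum \<open>k + type_bound k c\<close> exceeds both lower bounds imposed on
  \<open>M\<close>: one from the colours, one from the types of depth \<open>c\<close>.\<close>

lemma computable_rainbow_problem:
  "\<exists>A. \<forall>c k. rec_eval A [c, k]
     (problems_encode [rainbow_problem (code_verts c) (code_edge c) k (k + type_bound k c)])"
proof -
  have 3: "computable (Suc (Suc (Suc 0))) (\<lambda>xs. problems_encode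
      [rainbow_problem (code_verts (xs ! 0)) (code_edge (xs ! 0)) (xs ! Suc 0) (xs ! Suc (Suc 0))])"
    unfolding problems_encode_def rainbow_problem_def list.map problem_encode.simps list_encode.simps
      mpoly_encode_Cons mpoly_encode_Nil int_encode_coeffs list_encode_tab
    by (intro computable_Suc computable_prod_encode computable_list_code_tab computable_eq
        computable_rainbow_constraints computable_num_vars computable_const computable_nths) simp_all
  let ?gs = "[\<lambda>xs. xs ! 0, \<lambda>xs. xs ! 1, \<lambda>xs. xs ! 1 + type_bound (xs ! 1) (xs ! 0)]"
  have "computable 2 g" if "g \<in> set ?gs" for g
    using that by (auto intro!: computable_add computable_type_bound computable_nth simp del: One_nat_def)
  with computable_compose[of ?gs _ 2] 3 have "computable 2 (\<lambda>xs. problems_encode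
      [rainbow_problem (code_verts (xs ! 0)) (code_edge (xs ! 0)) (xs ! 1) (xs ! 1 + type_bound (xs ! 1) (xs ! 0))])"
    by fastforce
  then obtain A where A: "\<And>xs. length xs = 2 \<Longrightarrow> rec_eval A xs (problems_encode
      [rainbow_problem (code_verts (xs ! 0)) (code_edge (xs ! 0)) (xs ! 1) (xs ! 1 + type_bound (xs ! 1) (xs ! 0))])"
    unfolding computable_def by blast
  have "rec_eval A [c, k] (problems_encode [rainbow_problem (code_verts c) (code_edge c) k (k + type_bound k c)])" for c k
    using A[of "[c, k]"] by simp
  then show ?thesis by blast
qed

text \<open>The parent function of \<open>T\<close> serves every code of \<open>T\<close>, since an
  isomorphism changes only the enumeration. As \<open>m \<le> c\<close>, the code is an admissible
  depth.\<close>

lemma encodes_graph_tree_order: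
  assumes T: "tree_order m par g T" and c: "encodes_graph c T"
  shows "\<exists>g'. tree_order m par g' ({..<m}, (\<lambda>(u, v). {u, v}) ` {(u, v). code_edge c u v})"
    and "code_verts c = m" and "m \<le> c"
proof -
  obtain m' es where c: "c = prod_encode (m', list_encode (map prod_encode es))"
    and iso: "graph_iso T ({..<m'}, (\<lambda>(u, v). {u, v}) ` set es)"
    using c unfolding encodes_graph_def by blast
  obtain g' where g': "tree_order m par g' ({..<m'}, (\<lambda>(u, v). {u, v}) ` set es)"
    using tree_order_iso[OF T iso] by blast
  then have "bij_betw g' {..<m} {..<m'}" by (simp add: tree_order_def)
  then have m: "m' = m" using bij_betw_same_card by fastforce
  have es: "{(u, v). code_edge c u v} = set es"
    by (auto simp: code_edge_def c list_code_mem_list_encode)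
  show "\<exists>g'. tree_order m par g' ({..<m}, (\<lambda>(u, v). {u, v}) ` {(u, v). code_edge c u v})"
    using g' unfolding m es by blast
  show "code_verts c = m" by (simp add: code_verts_def c m)
  show "m \<le> c" unfolding c m by (rule le_prod_encode_1)
qed

theorem theorem1p2:
  "\<exists>A :: recf. \<forall>(T :: 'a graph) (k :: nat). is_tree T \<and> k \<ge> 1 \<longrightarrow>
     convergent (rainbow_ratio k T) \<and>
     (\<forall>c. encodes_graph c T \<longrightarrow>
        (\<exists>Ps. rec_eval A [c, k] (problems_encode Ps) \<and> solved_by (rainbow_density k T) Ps)) \<and>
     algebraic (rainbow_density k T)"
proof -
  obtain A where A: "\<And>c k. rec_eval A [c, k]
     (problems_encode [rainbow_problem (code_verts c) (code_edge c) k (k + type_bound k c)])"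
    using computable_rainbow_problem by blast
  have "convergent (rainbow_ratio k T) \<and>
     (\<forall>c. encodes_graph c T \<longrightarrow>
        (\<exists>Ps. rec_eval A [c, k] (problems_encode Ps) \<and> solved_by (rainbow_density k T) Ps)) \<and>
     algebraic (rainbow_density k T)" if "is_tree T" and k: "1 \<le> k" for T :: "'a graph" and k
  proof -
    obtain m par g where T: "tree_order m par g T" using is_tree_imp_tree_order[OF \<open>is_tree T\<close>] by blast
    have limit: "rainbow_ratio k T \<longlonglongrightarrow> t"
      if "attainable m par k (k + type_bound k D) t" "\<forall>s. attainable m par k (k + type_bound k D) s \<longrightarrow> s \<le> t"
        "m \<le> D" for t D
      using rainbow_ratio_tendsto[OF T k \<open>m \<le> D\<close> _ that(1)] that(2) by simp
    have solve: "\<exists>t. attainable m par k (k + type_bound k D) t \<and>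
        (\<forall>s. attainable m par k (k + type_bound k D) s \<longrightarrow> s \<le> t) \<and>
        solved_by t [rainbow_problem m Q k (k + type_bound k D)]"
      if "tree_order m par g' ({..<m}, (\<lambda>(u, v). {u, v}) ` {(u, v). Q u v})" for g' Q D
      by (rule rainbow_problem_solves[OF that k]) simp
    \<comment> \<open>The parent relation itself is a possible \<open>Q\<close>; it yields the
      maximum \<open>t\<close> without reference to a code.\<close>
    have "{(u, v). \<exists>j\<in>{1..<m}. u = j \<and> v = par j} = (\<lambda>j. (j, par j)) ` {1..<m}" by auto
    then have "tree_order m par id ({..<m}, (\<lambda>(u, v). {u, v}) ` {(u, v). \<exists>j\<in>{1..<m}. u = j \<and> v = par j})"
      using T by (simp add: tree_order_def image_image)
    from solve[OF this, of m] obtain t where t: "attainable m par k (k + type_bound k m) t"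
      "\<forall>s. attainable m par k (k + type_bound k m) s \<longrightarrow> s \<le> t" by blast
    have lim: "rainbow_ratio k T \<longlonglongrightarrow> t" by (rule limit[OF t order_refl])
    have density: "rainbow_density k T = t" unfolding rainbow_density_def by (rule limI[OF lim])
    have "\<exists>Ps. rec_eval A [c, k] (problems_encode Ps) \<and> solved_by t Ps" if c: "encodes_graph c T" for c
    proof -
      note code = encodes_graph_tree_order[OF T c]
      obtain s where s: "attainable m par k (k + type_bound k c) s"
        "\<forall>s'. attainable m par k (k + type_bound k c) s' \<longrightarrow> s' \<le> s"
        "solved_by s [rainbow_problem m (code_edge c) k (k + type_bound k c)]"
        using code(1) solve by blast
      \<comment> \<open>The optima for depths \<open>c\<close> and \<open>m\<close> are limits of
        the same sequence.\<close>
      have "s = t" by (rule LIMSEQ_unique[OF limit[OF s(1,2) code(3)] lim])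
      then show ?thesis using A[of c k] s(3) unfolding code(2) by blast
    qed
    moreover have "algebraic t"
      using algebraic_max_attainable[OF t(1) _ k] t(2) by blast
    ultimately show ?thesis using lim unfolding density by (auto simp: convergent_def)
  qed
  then show ?thesis by blast
qed

end
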